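(* Let $F(w)=w+cw^2+O(w^3)\in w\mathbb{C}\{w\}$ with $c\in\mathbb{C}^*$, and let $f,a,\rho,b,b_1$ be attached to $F$ as in the context. The equation $$\varphi(z-1)=\varphi\big(z+b(z)\big)+b_1(z)$$ admits a unique formal solution of the form $\tilde\varphi(z)=\sum_{n\ge 0}c_n z^{-n-1}\in z^{-1}\mathbb{C}[[z^{-1}]]$. Its formal Borel transform $\hat\varphi(\zeta)=\sum_{n\ge0}c_n\frac{\zeta^n}{n!}$ is $2\pi\mathrm{i}\mathbb{Z}$-resurgent, in the sense that it converges for $|\zeta|<2\pi$ and extends analytically along any path issuing from $0$ and staying in $\mathbb{C}\setminus 2\pi\mathrm{i}\mathbb{Z}$ except for its origin. Moreover, for every such path $\gamma$ with endpoint $\zeta_*\in\mathrm{i}\mathbb{R}$, or for $\gamma=\{0\}$ and $\zeta_*=0$, and for every $\delta_0\in(0,\frac{\pi}{2})$, there exist $C_0,R_0>0$ such that the analytic continuation $\operatorname{cont}_\gamma\hat\varphi$ of $\hat\varphi$ along $\gamma$ (which is a holomorphic germ at $\zeta_*$) satisfies $$\big|\operatorname{cont}_\gamma\hat\varphi\big(\zeta_*+t\,\mathrm{e}^{\mathrm{i}\theta}\big)\big|\le C_0\,\mathrm{e}^{R_0t}\quad\text{for all } t\ge0 \text{ and } \theta\in I^+_{\delta_0}\cup I^-_{\delta_0},$$ where $I^+_{\delta_0}=[-\delta_0,\delta_0]$ and $I^-_{\delta_0}=[\pi-\delta_0,\pi+\delta_0]$.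
   Context: Given $F(w)=w+cw^2+O(w^3)\in w\mathbb{C}\{w\}$ with $c\in\mathbb{C}^*$ (a simple parabolic germ at $0$), rewrite it at $\infty$ via $z=-1/(cw)$: $$f(z)=-\frac{1}{c\,F\big(-\frac{1}{cz}\big)}=z+1+a(z),\qquad a(z)=-\rho z^{-1}+O(z^{-2})\in z^{-1}\mathbb{C}\{z^{-1}\},$$ which defines $\rho\in\mathbb{C}$. Set $$b(z)=a(z-1)\in z^{-1}\mathbb{C}\{z^{-1}\},\qquad b_1(z)=b(z)+\rho\log\frac{1+z^{-1}b(z)}{1-z^{-1}}\in z^{-2}\mathbb{C}\{z^{-1}\},$$ where $\log$ is the principal branch (expanded in powers of $z^{-1}$). For a formal series $\varphi\in\mathbb{C}[[z^{-1}]]$, $\varphi(z-1)$ and $\varphi(z+b(z))$ denote formal composition (Taylor expansion), e.g. $\varphi(z+b(z))=\sum_{k\ge0}\frac1{k!}b(z)^k\big(\frac{\mathrm d}{\mathrm dz}\big)^k\varphi(z)$. The formal Borel transform is the linear map $\sum_{n\ge0}c_nz^{-n-1}\mapsto\sum_{n\ge0}c_n\frac{\zeta^n}{n!}$. In the last inequality, $\operatorname{cont}_\gamma\hat\varphi(\zeta_*+t\,\mathrm e^{\mathrm i\theta})$ denotes the value at $\zeta_*+t\,\mathrm e^{\mathrm i\theta}$ of the analytic continuation of the germ $\operatorname{cont}_\gamma\hat\varphi$ along the segment $[\zeta_*,\zeta_*+t\,\mathrm e^{\mathrm i\theta}]$. *)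

theory Defs
  imports
    "HOL-Analysis.Analysis"
    "HOL-Computational_Algebra.Formal_Laurent_Series"
begin

text \<open>
  Elements of \<open>\<complex>[[z\<^sup>-\<^sup>1]]\<close> are encoded as formal power series in \<open>X = z\<^sup>-\<^sup>1\<close>, so that
  \<open>z\<close> itself is the Laurent series \<^const>\<open>fls_X_inv\<close>. Convergent germs (at \<open>0\<close>, or in \<open>z\<^sup>-\<^sup>1\<close>)
  are identified with their expansions.
\<close>

subsection \<open>The germ at infinity\<close>

text \<open>\<open>f(z) = - 1 / (c F(- 1 / (c z)))\<close>\<close>

definition germ_at_infinity :: "complex fps \<Rightarrow> complex \<Rightarrow> complex fls" where
  "germ_at_infinity F c =
     - inverse (fls_const c * fps_to_fls (fps_compose F (fps_const (- 1 / c) * fps_X)))"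

text \<open>
  \<open>a(z) = f(z) - z - 1\<close>. Taking the regular part only changes the type: see the lemma
  \<open>germ_at_infinity_eq\<close> below.
\<close>

definition a_series :: "complex fps \<Rightarrow> complex \<Rightarrow> complex fps" where
  "a_series F c = fls_regpart (germ_at_infinity F c - fls_X_inv - 1)"

lemma germ_at_infinity_eq:
  assumes "fps_nth F 0 = 0" "fps_nth F 1 = 1" "fps_nth F 2 = c" "c \<noteq> 0"
  shows "germ_at_infinity F c = fls_X_inv + 1 + fps_to_fls (a_series F c)"
    and "fps_nth (a_series F c) 0 = 0"
proof -
  define g where "g = fps_const (- c) * fps_compose F (fps_const (- 1 / c) * fps_X)"
  have g_nth: "fps_nth g n = - c * ((- 1 / c) ^ n * fps_nth F n)" for n
    by (simp add: g_def fps_compose_linear)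
  define u where "u = fps_shift 1 g"
  have u0: "fps_nth u 0 = 1" and u1: "fps_nth u 1 = - 1"
    using assms by (auto simp: u_def g_nth power2_eq_square simp flip: numeral_2_eq_2)
  have g: "g = fps_X * u"
    by (rule fps_ext) (use assms in \<open>auto simp: u_def g_nth\<close>)
  define v where "v = inverse u"
  have uv: "v * u = 1"
    using u0 by (simp add: v_def inverse_mult_eq_1)
  have v0: "fps_nth v 0 = 1"
    using u0 by (simp add: v_def)
  have "fps_nth (v * u) 1 = 0"
    by (simp add: uv)
  hence v1: "fps_nth v 1 = 1"
    using u0 u1 v0 by (simp add: fps_mult_nth)
  define w where "w = fps_shift 2 v"
  have v: "v = 1 + fps_X + fps_X ^ 2 * w"
  proof (rule fps_ext)
    fix n
    show "fps_nth v n = fps_nth (1 + fps_X + fps_X ^ 2 * w) n"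
    proof (cases "n < 2")
      case True
      hence "n = 0 \<or> n = 1" by auto
      thus ?thesis using v0 v1 by (auto simp: fps_X_power_mult_nth)
    next
      case False
      hence "Suc (Suc (n - 2)) = n" by simp
      thus ?thesis using False by (auto simp: fps_X_power_mult_nth w_def)
    qed
  qed
  have X: "fls_X_inv * fls_X = (1 :: complex fls)"
    by (simp add: fls_X_inv_times_conv_shift)
  have gg: "fls_const (- c) * fps_to_fls (fps_compose F (fps_const (- 1 / c) * fps_X)) =
             fps_to_fls g"
    by (simp add: g_def fls_times_fps_to_fls del: fls_const_uminus fps_const_neg)
  have "germ_at_infinity F c = inverse (fps_to_fls g)"
    unfolding gg[symmetric] germ_at_infinity_def
    by (simp only: fls_const_uminus mult_minus_left inverse_minus_eq)
  also have "\<dots> = fls_X_inv * fps_to_fls v"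
  proof (rule inverse_unique)
    have "fps_to_fls g * (fls_X_inv * fps_to_fls v) =
          (fls_X_inv * fls_X) * fps_to_fls (v * u)"
      by (simp add: g fls_times_fps_to_fls mult_ac)
    thus "fps_to_fls g * (fls_X_inv * fps_to_fls v) = 1"
      by (simp add: X uv)
  qed
  also have "\<dots> = fls_X_inv + fls_X_inv * fls_X + (fls_X_inv * fls_X) * fps_to_fls (fps_X * w)"
    by (simp add: v fls_times_fps_to_fls power2_eq_square algebra_simps)
  finally have f: "germ_at_infinity F c = fls_X_inv + 1 + fps_to_fls (fps_X * w)"
    by (simp add: X)
  hence "germ_at_infinity F c - fls_X_inv - 1 = fps_to_fls (fps_X * w)"
    by simp
  hence a: "a_series F c = fps_X * w"
    by (simp add: a_series_def)
  show "germ_at_infinity F c = fls_X_inv + 1 + fps_to_fls (a_series F c)"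
    by (simp only: f a)
  show "fps_nth (a_series F c) 0 = 0"
    by (simp add: a)
qed

definition resit :: "complex fps \<Rightarrow> complex \<Rightarrow> complex" where
  "resit F c = - fps_nth (a_series F c) 1"

subsection \<open>Formal composition\<close>

text \<open>\<open>d/dz = - X\<^sup>2 d/dX\<close>\<close>

definition ddz :: "complex fps \<Rightarrow> complex fps" where
  "ddz \<phi> = - (fps_X ^ 2 * fps_deriv \<phi>)"

text \<open>
  \<open>\<phi>(z + g(z))\<close> for \<open>g \<in> \<complex>[[z\<^sup>-\<^sup>1]]\<close>, as a Taylor expansion. The sum is taken in the
  \<open>X\<close>-adic topology of \<^typ>\<open>complex fps\<close>, where it always converges: see \<open>summable_comp_shift\<close>.
\<close>

definition comp_shift :: "complex fps \<Rightarrow> complex fps \<Rightarrow> complex fps" where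
  "comp_shift \<phi> g = (\<Sum>k. fps_const (1 / fact k) * g ^ k * (ddz ^^ k) \<phi>)"

lemma fps_nth_ddz_funpow_eq_0: "n < k \<Longrightarrow> fps_nth ((ddz ^^ k) \<phi>) n = 0"
proof (induction k arbitrary: n)
  case (Suc k)
  show ?case
  proof (cases "n < 2")
    case True
    thus ?thesis by (simp add: ddz_def fps_X_power_mult_nth)
  next
    case False
    with Suc.prems have "Suc (n - 2) < k" by simp
    thus ?thesis using False Suc.IH[of "Suc (n - 2)"]
      by (simp add: ddz_def fps_X_power_mult_nth)
  qed
qed simp

lemma summable_comp_shift:
  "summable (\<lambda>k. fps_const (1 / fact k) * g ^ k * (ddz ^^ k) \<phi>)"
proof -
  define t where "t k = fps_const (1 / fact k) * g ^ k * (ddz ^^ k) \<phi>" for k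
  have t0: "fps_nth (t k) n = 0" if "n < k" for n k
    using that by (auto simp: t_def fps_mult_nth[of "_ * _"] fps_nth_ddz_funpow_eq_0 intro!: sum.neutral)
  have "(\<lambda>m. \<Sum>k<m. t k) \<longlonglongrightarrow> Abs_fps (\<lambda>n. \<Sum>k\<le>n. fps_nth (t k) n)"
  proof (rule tendsto_fpsI)
    fix n
    have "fps_nth (\<Sum>k<m. t k) n = (\<Sum>k\<le>n. fps_nth (t k) n)" if "m > n" for m
      unfolding fps_sum_nth
      by (rule sum.mono_neutral_right) (use that in \<open>auto intro!: t0\<close>)
    thus "\<forall>\<^sub>F m in sequentially.
            fps_nth (\<Sum>k<m. t k) n = fps_nth (Abs_fps (\<lambda>n. \<Sum>k\<le>n. fps_nth (t k) n)) n"
      by (intro eventually_mono[OF eventually_gt_at_top[of n]]) simp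
  qed
  hence "summable t"
    by (auto simp: summable_def sums_def)
  thus ?thesis
    by (simp add: t_def[abs_def])
qed

subsection \<open>The data of the equation\<close>

definition b_series :: "complex fps \<Rightarrow> complex \<Rightarrow> complex fps" where
  "b_series F c = comp_shift (a_series F c) (- 1)"

text \<open>\<^term>\<open>fps_ln 1\<close> is the expansion of \<open>log (1 + X)\<close>.\<close>

definition b1_series :: "complex fps \<Rightarrow> complex \<Rightarrow> complex fps" where
  "b1_series F c = b_series F c +
     fps_const (resit F c) *
       fps_compose (fps_ln 1) ((1 + fps_X * b_series F c) / (1 - fps_X) - 1)"

definition is_formal_solution :: "complex fps \<Rightarrow> complex \<Rightarrow> complex fps \<Rightarrow> bool" where
  "is_formal_solution F c \<phi> \<longleftrightarrow>
     fps_nth \<phi> 0 = 0 \<and>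
     comp_shift \<phi> (- 1) = comp_shift \<phi> (b_series F c) + b1_series F c"

text \<open>The index shift reflects that \<open>c\<^sub>n\<close> is the coefficient of \<open>X^(n+1)\<close>.\<close>

definition borel_transform :: "complex fps \<Rightarrow> complex fps" where
  "borel_transform \<phi> = Abs_fps (\<lambda>n. fps_nth \<phi> (Suc n) / fact n)"

subsection \<open>Analytic continuation along paths\<close>

text \<open>
  A holomorphic germ at \<open>p\<close> is encoded by its Taylor series at \<open>p\<close>, that is, by the
  power series \<open>h\<close> with positive radius of convergence such that the germ is
  \<open>\<zeta> \<mapsto> eval_fps h (\<zeta> - p)\<close>. In \<open>analytic_cont \<gamma> g h\<close>, the germ \<open>g\<close> lives at
  \<open>pathstart \<gamma>\<close> and the germ \<open>h\<close> at \<open>pathfinish \<gamma>\<close>; \<open>G t\<close> is the germ carried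
  to the point \<open>\<gamma> t\<close>.
\<close>

definition analytic_cont ::
    "(real \<Rightarrow> complex) \<Rightarrow> complex fps \<Rightarrow> complex fps \<Rightarrow> bool" where
  "analytic_cont \<gamma> g h \<longleftrightarrow>
     (\<exists>G. G 0 = g \<and> G 1 = h \<and>
        (\<forall>t\<in>{0..1}. fps_conv_radius (G t) > 0) \<and>
        (\<forall>t\<in>{0..1}. \<forall>\<^sub>F s in at t within {0..1}.
           ereal (norm (\<gamma> s - \<gamma> t)) < fps_conv_radius (G t) \<and>
           (\<forall>\<^sub>F w in nhds 0. eval_fps (G s) w = eval_fps (G t) (\<gamma> s - \<gamma> t + w))))"

definition two_pi_i_Z :: "complex set" where
  "two_pi_i_Z = range (\<lambda>k::int. 2 * of_real pi * \<i> * of_int k)"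

definition admissible_path :: "(real \<Rightarrow> complex) \<Rightarrow> bool" where
  "admissible_path \<gamma> \<longleftrightarrow>
     path \<gamma> \<and> pathstart \<gamma> = 0 \<and> (\<forall>t\<in>{0<..1}. \<gamma> t \<notin> two_pi_i_Z)"

definition resurgent :: "complex fps \<Rightarrow> bool" where
  "resurgent g \<longleftrightarrow>
     fps_conv_radius g \<ge> ereal (2 * pi) \<and>
     (\<forall>\<gamma>. admissible_path \<gamma> \<longrightarrow> (\<exists>h. analytic_cont \<gamma> g h))"

end

theory Submission
  imports Defs "HOL-Complex_Analysis.Complex_Analysis"
begin

text \<open>
  Taylor expansion and the Borel transform turn \<open>\<phi>(z - 1) = \<phi>(z + b(z)) + b\<^sub>1(z)\<close> into the linear
  Volterra equation
  \<open>(exp \<zeta> - 1) \<phi>(\<zeta>) = g(\<zeta>) + \<integral>\<^sub>0\<^sup>\<zeta> k(\<zeta>, \<xi>) \<xi> \<phi>(\<xi>) d\<xi>\<close> for the Borel transform, where \<open>k\<close> and \<open>g\<close> are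
  entire. Moving the base point of the integral along a path changes \<open>g\<close> only by an entire function,
  so a germ that solves such an equation can be continued to every domain which is star-shaped about
  its base point and does not meet the zeros of \<open>exp \<zeta> - 1\<close>; this gives the continuation along
  paths.

  On rays to the right \<open>1 / (exp \<zeta> - 1)\<close> decays exponentially, which compensates the growth of \<open>k\<close>
  in \<open>\<xi>\<close>, and Gronwall's inequality yields an exponential bound. On rays to the left there is no
  such decay. There one uses a second Volterra equation with the same solution, obtained by inverting
  \<open>\<phi> \<mapsto> \<phi> \<circ> (id + b)\<close> with Lagrange's formula, whose kernel contains the decaying factor \<open>exp \<xi>\<close>.
\<close>

subsection \<open>Holomorphic parameter integrals and linear Volterra equations\<close>

text \<open>The admissible directions have real part as small as \<open>cos \<delta>0\<close>, so
  decay is available only at an arbitrarily small rate, and the kernels may grow in \<open>w\<close>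
  (on the right) or in \<open>z\<close> (on the left) only at a rate \<eta> chosen afterwards. This
  is possible because \<open>b\<close> has no constant term: only powers \<open>x ^ k\<close> with
  \<open>k \<le> n\<close> accompany \<open>u ^ n\<close> in \<open>shift_kernel b x u\<close>, so a
  small \<eta> merely costs a larger growth rate in \<open>z - w\<close>. Growth in
  \<open>z - w\<close> is harmless, since an exponential weight removes it before Gronwall's
  inequality is applied. On the left, Lagrange's formula puts the derivatives outside the product
  with \<open>b ^ k\<close>, so that the powers of the Borel variable fall on \<open>z\<close>
  instead of \<open>w\<close>; it is applied to \<phi>(z - 1), whose Borel transform supplies the
  factor \<open>exp w\<close>. The two equations have different inhomogeneous terms and travel along
  a path independently; all that is remembered about these terms is that they are entire of
  exponential type. The formal solution itself is also constructed in the Borel plane: the equation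
  is solved for |\<zeta>| < 2 \<pi> and the Borel transform is undone.\<close>

lemma contour_integral_linepath_integral:
  "contour_integral (linepath a b) f = (b - a) * integral {0..1} (\<lambda>x. f (linepath a b x))"
  by (simp add: contour_integral_integral mult.commute)

lemma contour_integral_linepath_scaled:
  assumes "0 \<le> t"
  shows "contour_integral (linepath p (p + of_real t * d)) f =
         d * integral {0..t} (\<lambda>s. f (p + of_real s * d))"
proof (cases "t = 0")
  case False
  with assms have t: "t > 0" by simp
  have "integral ((\<lambda>x. x / t) ` {0..t}) (\<lambda>x. f (p + of_real (t * x) * d)) =
          (1 / \<bar>t\<bar>) *\<^sub>R integral {0..t} (\<lambda>s. f (p + of_real s * d))"
    using t by (intro integral_stretch_real) auto
  moreover have "(\<lambda>x. x / t) ` {0..t} = {0..1}"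
    using t image_divide_atLeastAtMost[of t 0 t] by simp
  moreover have "linepath p (p + of_real t * d) x = p + of_real (t * x) * d" for x
    by (simp add: linepath_def algebra_simps scaleR_conv_of_real)
  ultimately have "contour_integral (linepath p (p + of_real t * d)) f =
      of_real t * d * ((1 / \<bar>t\<bar>) *\<^sub>R integral {0..t} (\<lambda>s. f (p + of_real s * d)))"
    by (simp only: contour_integral_linepath_integral) simp
  thus ?thesis
    using t by (simp only: scaleR_conv_of_real) simp
qed auto

text \<open>Morera's theorem on triangles: Fubini exchanges the parameter integral with the integral
  over each side, and Cauchy's theorem makes the boundary integral vanish for every fixed
  \<open>t\<close>.\<close>

lemma holomorphic_on_integral_param:
  fixes f :: "complex \<Rightarrow> real \<Rightarrow> complex"
  assumes S: "open S"
    and cont: "continuous_on (S \<times> {0..1}) (\<lambda>(z, t). f z t)"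
    and hol: "\<And>t. t \<in> {0..1} \<Longrightarrow> (\<lambda>z. f z t) holomorphic_on S"
  shows "(\<lambda>z. integral {0..1} (f z)) holomorphic_on S"
proof -
  have "(\<lambda>z. integral {0..1} (f z)) analytic_on S"
  proof (rule Morera_triangle)
    show "continuous_on S (\<lambda>z. integral {0..1} (f z))"
      using integral_continuous_on_param[of S 0 1 f] cont by simp
    show "convex hull {a, b, c} \<subseteq> S \<longrightarrow>
            contour_integral (linepath a b) (\<lambda>z. integral {0..1} (f z)) +
            contour_integral (linepath b c) (\<lambda>z. integral {0..1} (f z)) +
            contour_integral (linepath c a) (\<lambda>z. integral {0..1} (f z)) = 0" for a b c
    proof
      assume sub: "convex hull {a, b, c} \<subseteq> S"
      have seg: "closed_segment x y \<subseteq> S" if "x \<in> {a, b, c}" "y \<in> {a, b, c}" for x y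
        by (rule order_trans[OF _ sub], rule closed_segment_subset_convex_hull) (use that in \<open>auto
            simp: hull_inc\<close>)
      have cont2: "continuous_on ({0..1} \<times> {0..1}) (\<lambda>(x, t). f (linepath u v x) t)"
        if "closed_segment u v \<subseteq> S" for u v
      proof -
        have lp: "linepath u v x \<in> S" if "x \<in> {0..1}" for x
          using \<open>closed_segment u v \<subseteq> S\<close> linepath_in_path[OF that, of u v] by blast
        have "continuous_on ({0..1} \<times> {0..1}) (\<lambda>q. (linepath u v (fst q), snd q))"
          by (auto simp: linepath_def intro!: continuous_intros)
        from continuous_on_compose2[OF cont this] lp show ?thesis
          by (simp add: case_prod_unfold image_subset_iff)
      qed
      have swap: "contour_integral (linepath u v) (\<lambda>z. integral {0..1} (f z)) =
                  integral {0..1} (\<lambda>t. contour_integral (linepath u v) (\<lambda>z. f z t))"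
        if "closed_segment u v \<subseteq> S" for u v
      proof -
        have "integral {0..1} (\<lambda>x. integral {0..1} (\<lambda>t. f (linepath u v x) t)) =
              integral {0..1} (\<lambda>t. integral {0..1} (\<lambda>x. f (linepath u v x) t))"
          using integral_swap_continuous[of "0::real" "0::real" 1 1 "\<lambda>x t. f (linepath u v x) t"]
              cont2[OF that] by (simp add: cbox_Pair_eq)
        thus ?thesis
          by (simp add: contour_integral_linepath_integral)
      qed
      have int: "(\<lambda>t. contour_integral (linepath u v) (\<lambda>z. f z t)) integrable_on {0..1}"
        if "closed_segment u v \<subseteq> S" for u v
      proof -
        have "continuous_on ({0..1} \<times> {0..1}) (\<lambda>(t, x). f (linepath u v x) t)"
        proof -
          have "continuous_on ({0..1} \<times> {0..1}) (\<lambda>q :: real \<times> real. (snd q, fst q))"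
            by (intro continuous_intros)
          from continuous_on_compose2[OF cont2[OF that] this] show ?thesis
            by (simp add: case_prod_unfold image_subset_iff)
        qed
        hence "continuous_on {0..1} (\<lambda>t. integral {0..1} (\<lambda>x. f (linepath u v x) t))"
          using integral_continuous_on_param[of "{0..1::real}" "0::real" 1 "\<lambda>t x. f (linepath u v x)
              t"] by simp
        thus ?thesis unfolding contour_integral_linepath_integral
          by (intro integrable_continuous_real continuous_intros)
      qed
      have zero: "contour_integral (linepath a b) (\<lambda>z. f z t) +
            contour_integral (linepath b c) (\<lambda>z. f z t) +
            contour_integral (linepath c a) (\<lambda>z. f z t) = 0" if "t \<in> {0..1}" for t
      proof -
        have "((\<lambda>z. f z t) has_contour_integral 0)
                (linepath a b +++ linepath b c +++ linepath c a)"
          by (rule Cauchy_theorem_triangle) (rule holomorphic_on_subset[OF hol[OF that] sub])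
        thus ?thesis
          by (intro has_chain_integral_chain_integral3)
      qed
      have "contour_integral (linepath a b) (\<lambda>z. integral {0..1} (f z)) +
            contour_integral (linepath b c) (\<lambda>z. integral {0..1} (f z)) +
            contour_integral (linepath c a) (\<lambda>z. integral {0..1} (f z)) =
            integral {0..1} (\<lambda>t. contour_integral (linepath a b) (\<lambda>z. f z t) +
            contour_integral (linepath b c) (\<lambda>z. f z t) +
            contour_integral (linepath c a) (\<lambda>z. f z t))"
        using swap[OF seg, of a b] swap[OF seg, of b c] swap[OF seg, of c a]
          int[OF seg, of a b] int[OF seg, of b c] int[OF seg, of c a]
        by (simp only: insert_iff simp_thms integral_add integrable_add)
      also have "\<dots> = integral {0..1} (\<lambda>t::real. 0)"
        by (rule integral_cong) (rule zero)
      finally show "contour_integral (linepath a b) (\<lambda>z. integral {0..1} (f z)) +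
            contour_integral (linepath b c) (\<lambda>z. integral {0..1} (f z)) +
            contour_integral (linepath c a) (\<lambda>z. integral {0..1} (f z)) = 0" by simp
    qed
  qed (use S in auto)
  thus ?thesis by (rule analytic_imp_holomorphic)
qed

text \<open>Rescaling the segment to \<open>{0..1}\<close> moves the endpoint \<open>z\<close> into
  the integrand. This is why \<open>hol\<close> asks for holomorphy along
  \<open>w = linepath p z s\<close> with \<open>s\<close> fixed.\<close>

lemma holomorphic_on_contour_integral_linepath:
  assumes S: "open S" and star: "\<And>z. z \<in> S \<Longrightarrow> closed_segment p z \<subseteq> S"
    and cont: "continuous_on (S \<times> S) (\<lambda>(z, w). q z w)"
    and hol: "\<And>s. s \<in> {0..1} \<Longrightarrow> (\<lambda>z. q z (linepath p z s)) holomorphic_on S"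
  shows "(\<lambda>z. contour_integral (linepath p z) (q z)) holomorphic_on S"
  unfolding contour_integral_linepath_integral
proof (rule holomorphic_on_mult[OF _ holomorphic_on_integral_param[OF S _ hol]])
  show "(\<lambda>z. z - p) holomorphic_on S" by (intro holomorphic_intros)
  have lp: "linepath p z s \<in> S" if "z \<in> S" "s \<in> {0..1}" for z s
    using star[OF that(1)] linepath_in_path[OF that(2), of p z] by blast
  have "continuous_on (S \<times> {0..1}) (\<lambda>q. (fst q, linepath p (fst q) (snd q)))"
    by (auto simp: linepath_def intro!: continuous_intros)
  from continuous_on_compose2[OF cont this] lp
  show "continuous_on (S \<times> {0..1}) (\<lambda>(z, s). q z (linepath p z s))"
    by (simp add: case_prod_unfold image_subset_iff)
qed

text \<open>Maximise \<open>v t * exp (- 2 * M * t)\<close>. At a point \<open>x\<close> where this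
  maximum is positive, the integral term is at most half of \<open>v x\<close>, because the weight
  grows at twice the rate \<open>M\<close>; solving for \<open>v x\<close> produces the factor
  2.\<close>

lemma Gronwall_exp_bound:
  fixes v :: "real \<Rightarrow> real"
  assumes cont: "continuous_on {0..T} v" and "M > 0" "G \<ge> 0"
    and le: "\<And>t. t \<in> {0..T} \<Longrightarrow> v t \<le> G + M * integral {0..t} v"
    and t: "t \<in> {0..T}"
  shows "v t \<le> 2 * G * exp (2 * M * t)"
proof -
  define u where "u t = v t * exp (- 2 * M * t)" for t
  have "continuous_on {0..T} u"
    unfolding u_def by (intro continuous_intros cont)
  moreover have "{0..T} \<noteq> {}" using t by auto
  ultimately obtain x where x: "x \<in> {0..T}" and max: "\<And>y. y \<in> {0..T} \<Longrightarrow> u y \<le> u x"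
    using continuous_attains_sup[of "{0..T}" u] by auto
  have v: "v s = u s * exp (2 * M * s)" for s
    by (simp add: u_def flip: exp_add)
  have "u x \<le> 2 * G"
  proof (cases "u x \<le> 0")
    case False
    have hi: "((\<lambda>s. u x * exp (2 * M * s)) has_integral u x / (2 * M) * exp (2 * M * x) - u x / (2 *
        M) * exp (2 * M * 0)) {0..x}"
      using x \<open>M > 0\<close> by (intro fundamental_theorem_of_calculus)
         (auto intro!: derivative_eq_intros simp flip:
             has_real_derivative_iff_has_vector_derivative)
    have "integral {0..x} v \<le> integral {0..x} (\<lambda>s. u x * exp (2 * M * s))"
    proof (rule integral_le)
      show "v integrable_on {0..x}"
        using x by (intro integrable_continuous_real continuous_on_subset[OF cont]) auto
      show "(\<lambda>s. u x * exp (2 * M * s)) integrable_on {0..x}"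
        using hi by blast
    qed (use x max in \<open>auto simp: v intro!: mult_right_mono\<close>)
    also have "\<dots> = u x / (2 * M) * exp (2 * M * x) - u x / (2 * M)"
      using integral_unique[OF hi] by (metis exp_zero mult.right_neutral mult_zero_right)
    also have "\<dots> \<le> u x / (2 * M) * exp (2 * M * x)"
      using False \<open>M > 0\<close> by auto
    finally have "M * integral {0..x} v \<le> M * (u x / (2 * M) * exp (2 * M * x))"
      using \<open>M > 0\<close> by (intro mult_left_mono) auto
    also have "\<dots> = v x / 2"
      using \<open>M > 0\<close> by (simp add: v)
    finally have "v x \<le> 2 * G"
      using le[OF x] by linarith
    moreover have "exp (- 2 * M * x) \<le> 1"
      using x \<open>M > 0\<close> by auto
    ultimately have "u x \<le> 2 * G * 1"
      unfolding u_def using \<open>G \<ge> 0\<close> by (intro mult_mono) auto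
    thus ?thesis by simp
  qed (use \<open>G \<ge> 0\<close> in auto)
  hence "u t \<le> 2 * G"
    using max[OF t] by linarith
  thus ?thesis
    by (simp add: v)
qed

lemma continuous_on_compact_norm_bound:
  fixes f :: "'a :: topological_space \<Rightarrow> 'b :: real_normed_vector"
  assumes "compact K" "continuous_on K f"
  obtains M where "M > 0" "\<And>x. x \<in> K \<Longrightarrow> norm (f x) \<le> M"
  using compact_imp_bounded[OF compact_continuous_image[OF assms(2,1)]]
  unfolding bounded_pos by blast

text \<open>The union of the segments from \<open>p\<close> to the points of \<open>C\<close>. The
  iteration estimates need a compact set that contains every segment of integration ending in
  it.\<close>

lemma compact_cone:
  fixes S :: "'a :: real_normed_vector set"
  assumes star: "\<And>z. z \<in> S \<Longrightarrow> closed_segment p z \<subseteq> S"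
    and C: "compact C" "C \<subseteq> S"
  obtains K where "compact K" "C \<subseteq> K" "K \<subseteq> S" "\<And>z. z \<in> K \<Longrightarrow> closed_segment p z \<subseteq> K"
proof
  define K where "K = (\<lambda>(z, s). linepath p z s) ` (C \<times> {0..1})"
  show "compact K"
    unfolding K_def linepath_def case_prod_unfold
    by (intro compact_continuous_image compact_Times C compact_Icc continuous_intros)
  show "C \<subseteq> K"
  proof
    fix z assume "z \<in> C"
    thus "z \<in> K"
      unfolding K_def by (intro image_eqI[of _ _ "(z, 1)"]) (auto simp: linepath_def)
  qed
  show "K \<subseteq> S"
  proof
    fix w assume "w \<in> K"
    then obtain x s where s: "x \<in> C" "s \<in> {0..1}" "w = linepath p x s"
      by (auto simp: K_def)
    have "x \<in> S" using s C by blast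
    thus "w \<in> S" using star linepath_in_path[OF s(2), of p x] s(3) by blast
  qed
  show "closed_segment p z \<subseteq> K" if "z \<in> K" for z
  proof
    fix w assume "w \<in> closed_segment p z"
    then obtain t where t: "t \<in> {0..1}" "w = linepath p z t"
      by (metis imageE linepath_image_01)
    from that obtain x s where s: "x \<in> C" "s \<in> {0..1}" "z = linepath p x s"
      by (auto simp: K_def)
    have "w = linepath p x (t * s)"
      by (simp add: t s linepath_def algebra_simps)
    moreover have "t * s \<in> {0..1}"
      using t s by (auto intro: mult_le_one)
    ultimately show "w \<in> K"
      unfolding K_def using s by (intro image_eqI[of _ _ "(x, t * s)"]) auto
  qed
qed

text \<open>Each integration gains a power of the distance to \<open>p\<close> and a factor
  \<open>1 / Suc n\<close>; repeated, this yields the factorials in the Neumann series.\<close>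

lemma norm_contour_integral_linepath_power_bound:
  assumes cont: "continuous_on (closed_segment p z) f"
    and bound: "\<And>w. w \<in> closed_segment p z \<Longrightarrow> norm (f w) \<le> A * norm (w - p) ^ n"
  shows "norm (contour_integral (linepath p z) f) \<le> A * norm (z - p) ^ Suc n / Suc n"
proof -
  have "norm (integral {0..1} (\<lambda>x. f (linepath p z x))) \<le>
        integral {0..1} (\<lambda>x. A * norm (z - p) ^ n * x ^ n)"
  proof (rule integral_norm_bound_integral)
    show "(\<lambda>x. f (linepath p z x)) integrable_on {0..1}"
      using cont by (intro integrable_continuous_real continuous_on_compose2[OF cont]
          continuous_on_linepath)
        (auto simp: linepath_in_path)
    fix x :: real assume x: "x \<in> {0..1}"
    have "norm (f (linepath p z x)) \<le> A * norm (linepath p z x - p) ^ n"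
      using x by (intro bound linepath_in_path)
    also have "linepath p z x - p = x *\<^sub>R (z - p)"
      by (simp add: linepath_def algebra_simps)
    finally show "norm (f (linepath p z x)) \<le> A * norm (z - p) ^ n * x ^ n"
      using x by (simp add: power_mult_distrib mult_ac)
  qed (intro integrable_continuous_real continuous_intros)
  also have "\<dots> = A * norm (z - p) ^ n / Suc n"
  proof -
    have "((\<lambda>x::real. x ^ n) has_integral (1 ^ Suc n / Suc n - 0 ^ Suc n / Suc n)) {0..1}"
      by (intro fundamental_theorem_of_calculus)
         (auto intro!: derivative_eq_intros simp flip: has_real_derivative_iff_has_vector_derivative
             simp del: power_Suc)
    thus ?thesis by (simp add: integral_unique)
  qed
  finally have "norm (z - p) * norm (integral {0..1} (\<lambda>x. f (linepath p z x))) \<le>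
                norm (z - p) * (A * norm (z - p) ^ n / Suc n)"
    by (intro mult_left_mono) auto
  thus ?thesis
    by (simp add: contour_integral_linepath_integral norm_mult mult_ac)
qed

text \<open>Neumann series. On a compact set star-shaped about \<open>p\<close>, the
  \<open>n\<close>-th iterate is bounded by \<open>B * M ^ n * norm (z - p) ^ n / fact n\<close>, so
  the series converges locally uniformly whatever the size of \<open>Q\<close> and of
  \<open>S\<close>.\<close>

theorem Volterra_solution_exists:
  assumes S: "open S" and star: "\<And>z. z \<in> S \<Longrightarrow> closed_segment p z \<subseteq> S"
    and cont: "continuous_on (S \<times> S) (\<lambda>(z, w). Q z w)"
    and hol: "\<And>s. s \<in> {0..1} \<Longrightarrow> (\<lambda>z. Q z (linepath p z s)) holomorphic_on S"
    and h: "h holomorphic_on S"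
  obtains \<psi> where "\<psi> holomorphic_on S"
    "\<And>z. z \<in> S \<Longrightarrow> \<psi> z = h z + contour_integral (linepath p z) (\<lambda>w. Q z w * \<psi> w)"
proof -
  define T where "T f z = contour_integral (linepath p z) (\<lambda>w. Q z w * f w)" for f z
  define F where "F n = (T ^^ n) h" for n
  have F_0: "F 0 = h" and F_Suc: "F (Suc n) = T (F n)" for n
    by (simp_all add: F_def)
  have pS: "closed_segment p z \<subseteq> S" if "z \<in> S" for z using star that .
  have Q_seg: "continuous_on (closed_segment p z) (Q z)" if "z \<in> S" for z
  proof -
    have "continuous_on (closed_segment p z) (\<lambda>w. case (z, w) of (z, w) \<Rightarrow> Q z w)"
      using pS[OF that] that by (intro continuous_on_compose2[OF cont] continuous_intros) auto
    thus ?thesis by simp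
  qed
  have T_hol: "T f holomorphic_on S" if f: "f holomorphic_on S" for f
    unfolding T_def
  proof (rule holomorphic_on_contour_integral_linepath[OF S star])
    have "continuous_on (S \<times> S) (\<lambda>x. f (snd x))"
      by (intro continuous_on_compose2[OF holomorphic_on_imp_continuous_on[OF f]] continuous_intros)
          auto
    thus "continuous_on (S \<times> S) (\<lambda>(z, w). Q z w * f w)"
      using cont unfolding case_prod_unfold by (intro continuous_intros)
    have lp: "(\<lambda>z. linepath p z s) holomorphic_on S" for s
      unfolding linepath_def scaleR_conv_of_real by (intro holomorphic_intros)
    have "(\<lambda>z. f (linepath p z s)) holomorphic_on S" if "s \<in> {0..1}" for s
    proof -
      have "linepath p z s \<in> S" if "z \<in> S" for z
        using star[OF that] linepath_in_path[OF \<open>s \<in> {0..1}\<close>, of p z] by blast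
      thus ?thesis
        using holomorphic_on_compose_gen[OF lp f, of s] by (simp add: o_def image_subset_iff)
    qed
    thus "(\<lambda>z. Q z (linepath p z s) * f (linepath p z s)) holomorphic_on S" if "s \<in> {0..1}" for s
      using hol[OF that] that by (intro holomorphic_intros)
  qed
  have F_hol: "F n holomorphic_on S" for n
    by (induction n) (auto simp: F_0 F_Suc h T_hol)
  have F_cont: "continuous_on A (F n)" if "A \<subseteq> S" for A n
    using F_hol holomorphic_on_imp_continuous_on continuous_on_subset that by blast
  have bound: "\<exists>c. summable c \<and> (\<forall>n. \<forall>z\<in>C. norm (F n z) \<le> c n)"
    if C: "compact C" "C \<subseteq> S" for C
  proof -
    obtain K where K: "compact K" "C \<subseteq> K" "K \<subseteq> S" "\<And>z. z \<in> K \<Longrightarrow> closed_segment p z \<subseteq> K"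
      using compact_cone[OF star C] by metis
    have "continuous_on (K \<times> K) (\<lambda>(z, w). Q z w)"
      using K by (intro continuous_on_subset[OF cont]) auto
    then obtain M where M: "M > 0" "\<And>x. x \<in> K \<times> K \<Longrightarrow> norm (case x of (z, w) \<Rightarrow> Q z w) \<le> M"
      using continuous_on_compact_norm_bound[OF compact_Times[OF K(1) K(1)]] by metis
    have M': "norm (Q z w) \<le> M" if "z \<in> K" "w \<in> K" for z w
      using M(2)[of "(z, w)"] that by simp
    have "continuous_on K h"
      using K by (intro continuous_on_subset[OF holomorphic_on_imp_continuous_on[OF h]]) auto
    then obtain B where B: "B > 0" "\<And>z. z \<in> K \<Longrightarrow> norm (h z) \<le> B"
      using continuous_on_compact_norm_bound[OF K(1)] by metis
    have "continuous_on K (\<lambda>z. z - p)"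
      by (intro continuous_intros)
    then obtain D where D: "D > 0" "\<And>z. z \<in> K \<Longrightarrow> norm (z - p) \<le> D"
      using continuous_on_compact_norm_bound[OF K(1)] by metis
    have Fb: "norm (F n z) \<le> (B * M ^ n / fact n) * norm (z - p) ^ n" if "z \<in> K" for n z
      using that
    proof (induction n arbitrary: z)
      case 0
      thus ?case by (simp add: F_0 B)
    next
      case (Suc n)
      have sub: "closed_segment p z \<subseteq> K" "closed_segment p z \<subseteq> S"
        using K(3,4) Suc.prems by auto
      have "norm (T (F n) z) \<le> (M * (B * M ^ n / fact n)) * norm (z - p) ^ Suc n / Suc n"
        unfolding T_def
      proof (rule norm_contour_integral_linepath_power_bound)
        show "continuous_on (closed_segment p z) (\<lambda>w. Q z w * F n w)"
          using Suc.prems K sub by (intro continuous_intros Q_seg F_cont) auto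
        fix w assume w: "w \<in> closed_segment p z"
        have "norm (Q z w * F n w) \<le> M * (B * M ^ n / fact n * norm (w - p) ^ n)"
          unfolding norm_mult using w sub Suc M(1) M' by (intro mult_mono) auto
        thus "norm (Q z w * F n w) \<le> M * (B * M ^ n / fact n) * norm (w - p) ^ n" by simp
      qed
      thus ?case
        by (simp add: F_Suc field_simps)
    qed
    show ?thesis
    proof (intro exI[of _ "\<lambda>n. B * ((M * D) ^ n / fact n)"] conjI allI ballI)
      show "summable (\<lambda>n. B * ((M * D) ^ n / fact n))"
        using summable_exp[of "M * D"] by (intro summable_mult) (simp add: divide_inverse mult_ac)
      fix n z assume z: "z \<in> C"
      have "norm (F n z) \<le> (B * M ^ n / fact n) * norm (z - p) ^ n"
        using z K by (intro Fb) auto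
      also have "\<dots> \<le> (B * M ^ n / fact n) * D ^ n"
        using z K D B M by (intro mult_left_mono power_mono) auto
      finally show "norm (F n z) \<le> B * ((M * D) ^ n / fact n)"
        by (simp add: power_mult_distrib)
    qed
  qed
  define \<psi> where "\<psi> z = (\<Sum>n. F n z)" for z
  have unif: "uniform_limit C (\<lambda>n z. \<Sum>k<n. F k z) \<psi> sequentially" if "compact C" "C \<subseteq> S" for C
  proof -
    from bound[OF that] obtain c where c: "summable c" "\<And>n z. z \<in> C \<Longrightarrow> norm (F n z) \<le> c n"
      by blast
    show ?thesis
      unfolding \<psi>_def using c by (intro Weierstrass_m_test[of C F c]) auto
  qed
  have psi_hol: "\<psi> holomorphic_on S"
  proof (rule holomorphic_uniform_sequence[OF S])
    show "(\<lambda>z. \<Sum>k<n. F k z) holomorphic_on S" for n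
      by (intro holomorphic_intros F_hol)
    fix x assume "x \<in> S"
    then obtain d where "d > 0" "cball x d \<subseteq> S"
      using S open_contains_cball by blast
    thus "\<exists>d>0. cball x d \<subseteq> S \<and> uniform_limit (cball x d) (\<lambda>n z. \<Sum>k<n. F k z) \<psi> sequentially"
      using unif[OF compact_cball, of x d] by metis
  qed
  \<comment> \<open>Uniform convergence on the segment allows \<open>T\<close> to be applied term by
    term; the result is the same series without its first term.\<close>
  have eq: "\<psi> z = h z + T \<psi> z" if z: "z \<in> S" for z
  proof -
    let ?s = "closed_segment p z"
    have ul: "uniform_limit ?s (\<lambda>n w. Q z w * (\<Sum>k<n. F k w)) (\<lambda>w. Q z w * \<psi> w) sequentially"
    proof (rule uniform_lim_mult)
      show "uniform_limit ?s (\<lambda>n w. \<Sum>k<n. F k w) \<psi> sequentially"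
        by (rule unif[OF compact_segment pS[OF z]])
      show "bounded (Q z ` ?s)"
        using Q_seg[OF z] by (intro compact_imp_bounded compact_continuous_image) auto
      show "bounded (\<psi> ` ?s)"
        using psi_hol pS[OF z] 
        by (intro compact_imp_bounded compact_continuous_image continuous_on_subset[OF
            holomorphic_on_imp_continuous_on[OF psi_hol]]) auto
    qed (auto intro: uniform_limit_const)
    have Fc: "continuous_on ?s (\<lambda>w. Q z w * F k w)" for k
      using pS[OF z] by (intro continuous_intros Q_seg z F_cont)
    have "(\<lambda>n. contour_integral (linepath p z) (\<lambda>w. Q z w * (\<Sum>k<n. F k w))) \<longlonglongrightarrow> T \<psi> z"
      unfolding T_def
    proof (rule contour_integral_uniform_limit(2)[where \<gamma> = "linepath p z" and B = "norm (z - p)"])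
      show "\<forall>\<^sub>F n in sequentially. (\<lambda>w. Q z w * (\<Sum>k<n. F k w)) contour_integrable_on linepath p z"
        using pS[OF z] by (intro always_eventually allI contour_integrable_continuous_linepath
            continuous_intros Q_seg z F_cont)
    qed (use ul in auto)
    also have "(\<lambda>n. contour_integral (linepath p z) (\<lambda>w. Q z w * (\<Sum>k<n. F k w))) = 
               (\<lambda>n. \<Sum>k<n. F (Suc k) z)"
      using Fc by (subst sum_distrib_left, subst contour_integral_sum) 
         (auto simp: F_Suc T_def intro!: contour_integrable_continuous_linepath)
    finally have 1: "(\<lambda>k. F (Suc k) z) sums T \<psi> z"
      by (simp add: sums_def)
    have "summable (\<lambda>n. F n z)"
    proof -
      from bound[of "{z}"] z obtain c where "summable c" "\<forall>n. \<forall>z\<in>{z}. norm (F n z) \<le> c n"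
        by (metis compact_sing empty_subsetI insert_subset)
      hence c: "summable c" "\<And>n. norm (F n z) \<le> c n" by simp_all
      show ?thesis by (rule summable_comparison_test'[OF c(1), of 0]) (rule c(2))
    qed
    hence "\<psi> z = F 0 z + (\<Sum>n. F (Suc n) z)"
      unfolding \<psi>_def by (subst suminf_split_head) auto
    with 1 show ?thesis by (simp add: sums_iff F_0)
  qed
  show ?thesis
    using that[OF psi_hol] eq unfolding T_def by blast
qed

text \<open>Gronwall's inequality with constant term 0, along the segment parametrised by
  \<open>{0..1}\<close>.\<close>

lemma Volterra_homogeneous_unique:
  assumes cont: "continuous_on (closed_segment p z \<times> closed_segment p z) (\<lambda>(z, w). Q z w)"
    and f: "continuous_on (closed_segment p z) f"
    and eq: "\<And>w. w \<in> closed_segment p z \<Longrightarrow> f w = contour_integral (linepath p w) (\<lambda>x. Q w x * f x)"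
  shows "f z = 0"
proof -
  define l where "l t = p + of_real t * (z - p)" for t
  have l: "l t \<in> closed_segment p z" if "t \<in> {0..1}" for t
    using linepath_in_path[OF that, of p z] by (simp add: l_def linepath_def algebra_simps
        scaleR_conv_of_real)
  have l_cont: "continuous_on A l" for A
    unfolding l_def by (intro continuous_intros)
  define v where "v t = norm (f (l t))" for t
  have v_cont: "continuous_on {0..1} v"
    unfolding v_def by (intro continuous_intros continuous_on_compose2[OF f l_cont]) (use l in auto)
  obtain M where M_pos: "M > 0" and M_bound: "\<And>x. x \<in> closed_segment p z \<times> closed_segment p z \<Longrightarrow> norm
      (case x of (z, w) \<Rightarrow> Q z w) \<le> M"
    using continuous_on_compact_norm_bound[OF compact_Times[OF compact_segment compact_segment]
        cont] by metis
  have M: "norm (Q x w) \<le> M" if "x \<in> closed_segment p z" "w \<in> closed_segment p z" for x w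
    using M_bound[of "(x, w)"] that by auto
  \<comment> \<open>The added 1 keeps the Gronwall constant positive when
    \<open>z = p\<close>.\<close>
  define M' where "M' = (norm (z - p) + 1) * M"
  have "M' > 0" using M_pos by (simp add: M'_def add_nonneg_pos)
  have "v t \<le> 0 + M' * integral {0..t} v" if t: "t \<in> {0..1}" for t
  proof -
    have "f (l t) = (z - p) * integral {0..t} (\<lambda>s. Q (l t) (l s) * f (l s))"
      using eq[OF l[OF t]] contour_integral_linepath_scaled[of t p "z - p" "\<lambda>x. Q (l t) x * f x"] t
      by (simp add: l_def)
    moreover have "norm (integral {0..t} (\<lambda>s. Q (l t) (l s) * f (l s))) \<le> integral {0..t} (\<lambda>s. M * v
        s)"
    proof (rule integral_norm_bound_integral)
      have "continuous_on {0..t} (\<lambda>s. case (l t, l s) of (z, w) \<Rightarrow> Q z w)"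
        using t l by (intro continuous_on_compose2[OF cont] continuous_intros l_cont) auto
      moreover have "continuous_on {0..t} (\<lambda>s. f (l s))"
        using t l by (intro continuous_on_compose2[OF f] l_cont) auto
      ultimately show "(\<lambda>s. Q (l t) (l s) * f (l s)) integrable_on {0..t}"
        by (intro integrable_continuous_real continuous_intros) auto
      show "(\<lambda>s. M * v s) integrable_on {0..t}"
        using t by (intro integrable_continuous_real continuous_intros continuous_on_subset[OF
            v_cont]) auto
      fix s assume "s \<in> {0..t}"
      thus "norm (Q (l t) (l s) * f (l s)) \<le> M * v s"
        unfolding norm_mult v_def using t by (intro mult_right_mono M l) auto
    qed
    ultimately have "v t \<le> norm (z - p) * integral {0..t} (\<lambda>s. M * v s)"
      unfolding v_def[of t] by (simp only: norm_mult mult_left_mono norm_ge_zero)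
    also have "integral {0..t} (\<lambda>s. M * v s) = M * integral {0..t} v"
      by simp
    also have "norm (z - p) * (M * integral {0..t} v) \<le> (norm (z - p) + 1) * (M * integral {0..t}
        v)"
    proof (intro mult_right_mono)
      have "integral {0..t} v \<ge> 0"
        using t by (intro integral_nonneg integrable_continuous_real continuous_on_subset[OF
            v_cont]) (auto simp: v_def)
      thus "0 \<le> M * integral {0..t} v" using M_pos by auto
    qed auto
    finally show ?thesis by (simp add: M'_def mult_ac)
  qed
  from Gronwall_exp_bound[OF v_cont \<open>M' > 0\<close> _ this, of 1]
  show ?thesis by (simp add: v_def l_def)
qed

subsection \<open>The Volterra equation in the Borel plane\<close>

text \<open>Joint holomorphy is expressed through substitution of one-variable holomorphic
  functions, the form in which it is applied. The growth clause, uniform for bounded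
  \<open>w\<close>, makes integrals of \<open>k z w\<close> over a fixed segment functions of
  exponential type in \<open>z\<close>.\<close>

definition entire_kernel :: "(complex \<Rightarrow> complex \<Rightarrow> complex) \<Rightarrow> bool" where
  "entire_kernel k \<longleftrightarrow>
     continuous_on UNIV (\<lambda>(z, w). k z w) \<and>
     (\<forall>S f g. open S \<longrightarrow> f holomorphic_on S \<longrightarrow> g holomorphic_on S \<longrightarrow>
        (\<lambda>z. k (f z) (g z)) holomorphic_on S) \<and>
     (\<forall>r. \<exists>A B. \<forall>z w. norm w \<le> r \<longrightarrow> norm (k z w) \<le> A * exp (B * norm z))"

definition exp_type :: "(complex \<Rightarrow> complex) \<Rightarrow> bool" where
  "exp_type g \<longleftrightarrow> g holomorphic_on UNIV \<and> (\<exists>A B. \<forall>z. norm (g z) \<le> A * exp (B * norm z))"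

text \<open>The factor \<open>w\<close> is kept outside the kernel so that
  \<open>w * \<phi> w\<close> can serve as the unknown function.\<close>

definition volterra_eq ::
    "(complex \<Rightarrow> complex \<Rightarrow> complex) \<Rightarrow> (complex \<Rightarrow> complex) \<Rightarrow> complex \<Rightarrow> (complex \<Rightarrow> complex) \<Rightarrow> complex \<Rightarrow>
        bool"
  where
  "volterra_eq k g p \<phi> z \<longleftrightarrow>
     (exp z - 1) * \<phi> z = g z + contour_integral (linepath p z) (\<lambda>w. k z w * (w * \<phi> w))"

text \<open>The inhomogeneous term is quantified existentially because it depends on the base point,
  whereas \<open>k\<close> does not.\<close>

definition volterra_germ :: "(complex \<Rightarrow> complex \<Rightarrow> complex) \<Rightarrow> complex \<Rightarrow> complex fps \<Rightarrow> bool" where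
  "volterra_germ k p h \<longleftrightarrow> fps_conv_radius h > 0 \<and>
     (\<exists>g. exp_type g \<and> (\<forall>\<^sub>F z in nhds p. volterra_eq k g p (\<lambda>z. eval_fps h (z - p)) z))"

section \<open>Entire kernels and functions of exponential type\<close>

lemma entire_kernel_continuous:
  assumes "entire_kernel k" "continuous_on A f" "continuous_on A g"
  shows "continuous_on A (\<lambda>x. k (f x) (g x))"
proof -
  have "continuous_on UNIV (\<lambda>(z, w). k z w)"
    using assms(1) by (simp add: entire_kernel_def)
  from continuous_on_compose2[OF this continuous_on_Pair[OF assms(2,3)]] show ?thesis by simp
qed

lemma entire_kernel_holomorphic:
  assumes "entire_kernel k" "open S" "f holomorphic_on S" "g holomorphic_on S"
  shows "(\<lambda>z. k (f z) (g z)) holomorphic_on S"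
  using assms unfolding entire_kernel_def by blast

lemma exp_type_holomorphic: "exp_type g \<Longrightarrow> g holomorphic_on S"
  unfolding exp_type_def using holomorphic_on_subset by blast

lemma exp_typeE:
  assumes "exp_type g"
  obtains A B where "A > 0" "B > 0" "\<And>z. norm (g z) \<le> A * exp (B * norm z)"
proof -
  obtain A B where AB: "\<And>z. norm (g z) \<le> A * exp (B * norm z)"
    using assms by (auto simp: exp_type_def)
  show thesis
  proof (rule that[of "\<bar>A\<bar> + 1" "\<bar>B\<bar> + 1"])
    fix z :: complex
    have "A * exp (B * norm z) \<le> (\<bar>A\<bar> + 1) * exp ((\<bar>B\<bar> + 1) * norm z)"
      by (intro mult_mono) (auto intro!: mult_right_mono)
    with AB[of z] show "norm (g z) \<le> (\<bar>A\<bar> + 1) * exp ((\<bar>B\<bar> + 1) * norm z)" by linarith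
  qed auto
qed

lemma exp_type_add:
  assumes "exp_type f" "exp_type g"
  shows "exp_type (\<lambda>z. f z + g z)"
proof -
  from exp_typeE[OF assms(1)] obtain A B where A: "A > 0" "B > 0" "\<And>z. norm (f z) \<le> A * exp (B *
      norm z)" by metis
  from exp_typeE[OF assms(2)] obtain A' B' where A': "A' > 0" "B' > 0" "\<And>z. norm (g z) \<le> A' * exp
      (B' * norm z)" by metis
  have "norm (f z + g z) \<le> (A + A') * exp ((B + B') * norm z)" for z
  proof -
    have "norm (f z + g z) \<le> A * exp (B * norm z) + A' * exp (B' * norm z)"
      by (rule order_trans[OF norm_triangle_ineq]) (rule add_mono[OF A(3) A'(3)])
    also have "\<dots> \<le> A * exp ((B + B') * norm z) + A' * exp ((B + B') * norm z)"
      using A A' by (intro add_mono mult_left_mono) (auto intro!: mult_right_mono)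
    finally show ?thesis by (simp add: algebra_simps)
  qed
  moreover have "(\<lambda>z. f z + g z) holomorphic_on UNIV"
    using assms by (intro holomorphic_intros exp_type_holomorphic)
  ultimately show ?thesis unfolding exp_type_def by blast
qed

text \<open>This integral is what the inhomogeneous term gains when the base point moves from
  \<open>p\<close> to \<open>q\<close>.\<close>

lemma exp_type_kernel_integral:
  assumes k: "entire_kernel k" and f: "continuous_on (closed_segment p q) f"
  shows "exp_type (\<lambda>z. contour_integral (linepath p q) (\<lambda>w. k z w * f w))"
  unfolding exp_type_def
proof
  have f_lp: "continuous_on {0..1} (\<lambda>s. f (linepath p q s))"
    by (rule continuous_on_compose2[OF f continuous_on_linepath]) (auto simp: linepath_in_path)
  show "(\<lambda>z. contour_integral (linepath p q) (\<lambda>w. k z w * f w)) holomorphic_on UNIV"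
    unfolding contour_integral_linepath_integral
  proof (rule holomorphic_on_mult[OF holomorphic_on_const holomorphic_on_integral_param])
    have "continuous_on (UNIV \<times> {0..1}) (\<lambda>x. k (fst x) (linepath p q (snd x)))"
      unfolding linepath_def by (intro entire_kernel_continuous[OF k] continuous_intros)
    moreover have "continuous_on (UNIV \<times> {0..1}) (\<lambda>x::complex\<times>real. f (linepath p q (snd x)))"
      by (rule continuous_on_compose2[OF f_lp]) (auto intro!: continuous_intros)
    ultimately show "continuous_on (UNIV \<times> {0..1}) (\<lambda>(z, s). k z (linepath p q s) * f (linepath p q
        s))"
      unfolding case_prod_unfold by (rule continuous_on_mult)
    show "(\<lambda>z. k z (linepath p q s) * f (linepath p q s)) holomorphic_on UNIV" for s
      by (rule holomorphic_on_mult[OF entire_kernel_holomorphic[OF k open_UNIV holomorphic_on_ident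
          holomorphic_on_const] holomorphic_on_const])
  qed auto
  obtain M where M: "M > 0" "\<And>w. w \<in> closed_segment p q \<Longrightarrow> norm (f w) \<le> M"
    using continuous_on_compact_norm_bound[OF compact_segment f] by metis
  obtain r where r: "\<And>w. w \<in> closed_segment p q \<Longrightarrow> norm w \<le> r"
    using continuous_on_compact_norm_bound[OF compact_segment continuous_on_id] by metis
  obtain A B where AB: "\<And>z w. norm w \<le> r \<Longrightarrow> norm (k z w) \<le> A * exp (B * norm z)"
    using k unfolding entire_kernel_def by metis
  show "\<exists>A B. \<forall>z. norm (contour_integral (linepath p q) (\<lambda>w. k z w * f w)) \<le> A * exp (B * norm z)"
  proof (intro exI allI)
    fix z
    have "norm (contour_integral (linepath p q) (\<lambda>w. k z w * f w)) \<le> (\<bar>A\<bar> * exp (B * norm z) * M) *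
        norm (q - p)"
    proof (rule contour_integral_bound_linepath)
      show "(\<lambda>w. k z w * f w) contour_integrable_on linepath p q"
        by (intro contour_integrable_continuous_linepath continuous_on_mult f
              entire_kernel_continuous[OF k] continuous_on_const continuous_on_id)
      fix w assume w: "w \<in> closed_segment p q"
      have "norm (k z w) \<le> A * exp (B * norm z)" by (rule AB[OF r[OF w]])
      also have "\<dots> \<le> \<bar>A\<bar> * exp (B * norm z)" by (intro mult_right_mono) auto
      finally show "norm (k z w * f w) \<le> \<bar>A\<bar> * exp (B * norm z) * M"
        unfolding norm_mult using M(2)[OF w] by (intro mult_mono) auto
    qed (use M(1) in auto)
    thus "norm (contour_integral (linepath p q) (\<lambda>w. k z w * f w)) \<le> (\<bar>A\<bar> * M * norm (q - p)) * exp
        (B * norm z)"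
      by (simp add: mult_ac)
  qed
qed

section \<open>Solution germs and change of base point\<close>

lemma volterra_eq_cong:
  assumes "\<And>w. w \<in> closed_segment p z \<Longrightarrow> \<phi> w = \<phi>' w"
  shows "volterra_eq k g p \<phi> z \<longleftrightarrow> volterra_eq k g p \<phi>' z"
proof -
  have "contour_integral (linepath p z) (\<lambda>w. k z w * (w * \<phi> w)) = contour_integral (linepath p z)
      (\<lambda>w. k z w * (w * \<phi>' w))"
    by (intro contour_integral_eq) (use assms in auto)
  thus ?thesis using assms[of z] by (simp add: volterra_eq_def)
qed

lemma eventually_volterra_eq_cong:
  assumes "\<forall>\<^sub>F z in nhds p. \<phi> z = \<phi>' z"
  shows "(\<forall>\<^sub>F z in nhds p. volterra_eq k g p \<phi> z) \<longleftrightarrow> (\<forall>\<^sub>F z in nhds p. volterra_eq k g p \<phi>' z)"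
proof -
  obtain d where d: "d > 0" "\<And>z. dist z p < d \<Longrightarrow> \<phi> z = \<phi>' z"
    using assms unfolding eventually_nhds_metric by blast
  have "\<forall>\<^sub>F z in nhds p. z \<in> ball p d"
    using d by (intro eventually_nhds_in_open) auto
  hence "\<forall>\<^sub>F z in nhds p. volterra_eq k g p \<phi> z \<longleftrightarrow> volterra_eq k g p \<phi>' z"
  proof eventually_elim
    case (elim z)
    show ?case
    proof (rule volterra_eq_cong)
      fix w assume "w \<in> closed_segment p z"
      hence "w \<in> ball p d"
        using elim d(1) closed_segment_subset[of p "ball p d" z] by auto
      thus "\<phi> w = \<phi>' w" using d(2)[of w] by (simp add: dist_commute)
    qed
  qed
  thus ?thesis by (rule eventually_cong)
qed

lemma eventually_eval_fps_expansion:
  assumes "\<phi> holomorphic_on S" "open S" "p \<in> S"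
  shows "fps_conv_radius (fps_expansion \<phi> p) > 0"
    and "\<forall>\<^sub>F z in nhds p. eval_fps (fps_expansion \<phi> p) (z - p) = \<phi> z"
proof -
  obtain r where r: "r > 0" "ball p r \<subseteq> S"
    using assms open_contains_ball by blast
  have hol: "\<phi> holomorphic_on eball p (ereal r)"
    using holomorphic_on_subset[OF assms(1) r(2)] by simp
  show "fps_conv_radius (fps_expansion \<phi> p) > 0"
    using conv_radius_fps_expansion[OF hol] r(1)
    by (metis ereal_less(2) less_le_trans)
  have "\<forall>\<^sub>F z in nhds p. z \<in> ball p r"
    using r by (intro eventually_nhds_in_open) auto
  thus "\<forall>\<^sub>F z in nhds p. eval_fps (fps_expansion \<phi> p) (z - p) = \<phi> z"
    by eventually_elim (rule eval_fps_expansion[OF hol], simp)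
qed

lemma volterra_germ_fps_expansion_iff:
  assumes "\<phi> holomorphic_on S" "open S" "p \<in> S"
  shows "volterra_germ k p (fps_expansion \<phi> p) \<longleftrightarrow>
           (\<exists>g. exp_type g \<and> (\<forall>\<^sub>F z in nhds p. volterra_eq k g p \<phi> z))"
  unfolding volterra_germ_def
  using eventually_eval_fps_expansion(1)[OF assms]
    eventually_volterra_eq_cong[OF eventually_eval_fps_expansion(2)[OF assms]] by auto

lemma holomorphic_on_volterra_integral:
  assumes k: "entire_kernel k" and S: "open S" and star: "\<And>z. z \<in> S \<Longrightarrow> closed_segment p z \<subseteq> S"
    and \<phi>: "\<phi> holomorphic_on S"
  shows "(\<lambda>z. contour_integral (linepath p z) (\<lambda>w. k z w * (w * \<phi> w))) holomorphic_on S"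
proof (rule holomorphic_on_contour_integral_linepath[OF S star])
  have "continuous_on (S \<times> S) (\<lambda>x. k (fst x) (snd x))"
    by (intro entire_kernel_continuous[OF k] continuous_intros)
  moreover have "continuous_on (S \<times> S) (\<lambda>x. \<phi> (snd x))"
    by (rule continuous_on_compose2[OF holomorphic_on_imp_continuous_on[OF \<phi>]]) (auto intro!:
        continuous_intros)
  ultimately show "continuous_on (S \<times> S) (\<lambda>(z, w). k z w * (w * \<phi> w))"
    unfolding case_prod_unfold by (intro continuous_on_mult continuous_on_snd continuous_on_id)
  fix s :: real assume s: "s \<in> {0..1}"
  have lp: "(\<lambda>z. linepath p z s) holomorphic_on S"
    unfolding linepath_def scaleR_conv_of_real by (intro holomorphic_intros)
  have "linepath p z s \<in> S" if "z \<in> S" for z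
    using star[OF that] linepath_in_path[OF s, of p z] by blast
  hence "(\<lambda>z. \<phi> (linepath p z s)) holomorphic_on S"
    using holomorphic_on_compose_gen[OF lp \<phi>] by (simp add: o_def image_subset_iff)
  thus "(\<lambda>z. k z (linepath p z s) * (linepath p z s * \<phi> (linepath p z s))) holomorphic_on S"
    by (intro holomorphic_on_mult lp entire_kernel_holomorphic[OF k S] holomorphic_on_ident)
qed auto

text \<open>Both sides are holomorphic on \<open>S\<close>, which is star-shaped and hence
  connected, so the identity theorem applies.\<close>

lemma volterra_eq_identity:
  assumes k: "entire_kernel k" and S: "open S" "p \<in> S" and star: "\<And>z. z \<in> S \<Longrightarrow> closed_segment p z \<subseteq>
      S"
    and \<phi>: "\<phi> holomorphic_on S" and g: "g holomorphic_on UNIV"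
    and ev: "\<forall>\<^sub>F z in nhds p. volterra_eq k g p \<phi> z" and z: "z \<in> S"
  shows "volterra_eq k g p \<phi> z"
proof -
  obtain U where U: "open U" "p \<in> U" "\<And>z. z \<in> U \<Longrightarrow> volterra_eq k g p \<phi> z"
    using ev unfolding eventually_nhds by blast
  have "connected S"
    using S(2) star by (intro starlike_imp_connected) (auto simp: starlike_def)
  have "(exp z - 1) * \<phi> z = g z + contour_integral (linepath p z) (\<lambda>w. k z w * (w * \<phi> w))"
  proof (rule analytic_continuation_open[of "U \<inter> S" S "\<lambda>z. (exp z - 1) * \<phi> z"
        "\<lambda>z. g z + contour_integral (linepath p z) (\<lambda>w. k z w * (w * \<phi> w))"])
    show "(\<lambda>z. (exp z - 1) * \<phi> z) holomorphic_on S"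
      using \<phi> by (intro holomorphic_intros)
    show "(\<lambda>z. g z + contour_integral (linepath p z) (\<lambda>w. k z w * (w * \<phi> w))) holomorphic_on S"
      by (intro holomorphic_on_add holomorphic_on_volterra_integral[OF k S(1) star \<phi>]
          holomorphic_on_subset[OF g]) auto
  qed (use U S \<open>connected S\<close> z in \<open>auto simp: volterra_eq_def\<close>)
  thus ?thesis by (simp add: volterra_eq_def)
qed

text \<open>Cauchy's theorem on the triangle \<open>p\<close>, \<open>q\<close>, \<open>z\<close>,
  which lies in \<open>S\<close> by convexity: the integral from \<open>p\<close> to
  \<open>z\<close> is the integral from \<open>q\<close> to \<open>z\<close> plus one over the fixed
  segment from \<open>p\<close> to \<open>q\<close>, and the latter joins the inhomogeneous
  term.\<close>

lemma volterra_rebase: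
  assumes k: "entire_kernel k" and S: "open S" "convex S" "p \<in> S" "q \<in> S"
    and \<phi>: "\<phi> holomorphic_on S" and g: "exp_type g"
    and ev: "\<forall>\<^sub>F z in nhds p. volterra_eq k g p \<phi> z"
  shows "\<exists>g'. exp_type g' \<and> (\<forall>z\<in>S. volterra_eq k g' q \<phi> z)"
proof (intro exI conjI ballI)
  let ?F = "\<lambda>z w. k z w * (w * \<phi> w)"
  have seg: "closed_segment x y \<subseteq> S" if "x \<in> S" "y \<in> S" for x y
    using that S(2) by (simp add: closed_segment_subset)
  have \<phi>c: "continuous_on A \<phi>" if "A \<subseteq> S" for A
    using continuous_on_subset[OF holomorphic_on_imp_continuous_on[OF \<phi>] that] .
  show "exp_type (\<lambda>z. g z + contour_integral (linepath p q) (?F z))"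
    by (intro exp_type_add g exp_type_kernel_integral k continuous_on_mult continuous_on_id \<phi>c seg
        S)
  fix z assume z: "z \<in> S"
  have "volterra_eq k g p \<phi> z"
    by (rule volterra_eq_identity[OF k S(1,3) seg[OF S(3)] \<phi> _ ev z]) (use g exp_type_holomorphic in
        auto)
  moreover have "contour_integral (linepath p q) (?F z) + contour_integral (linepath q z) (?F z) +
      contour_integral (linepath z p) (?F z) = 0"
  proof (rule has_chain_integral_chain_integral3, rule Cauchy_theorem_triangle)
    have "convex hull {p, q, z} \<subseteq> S"
      using S z by (intro hull_minimal) auto
    moreover have "?F z holomorphic_on S"
      by (intro holomorphic_on_mult \<phi> entire_kernel_holomorphic[OF k S(1)] holomorphic_on_const
          holomorphic_on_ident)
    ultimately show "?F z holomorphic_on convex hull {p, q, z}"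
      by (rule holomorphic_on_subset[rotated])
  qed
  moreover have "contour_integral (linepath z p) (?F z) = - contour_integral (linepath p z) (?F z)"
  proof (rule contour_integral_reverse_linepath)
    show "continuous_on (closed_segment z p) (?F z)"
      by (intro continuous_on_mult \<phi>c seg z S entire_kernel_continuous[OF k] continuous_on_const
          continuous_on_id)
  qed
  ultimately show "volterra_eq k (\<lambda>z. g z + contour_integral (linepath p q) (?F z)) q \<phi> z"
    by (simp add: volterra_eq_def algebra_simps)
qed

section \<open>Solving the equation on star-shaped domains\<close>

lemma holomorphic_difference_quotient_0:
  assumes "f holomorphic_on S" "open S"
  shows "(\<lambda>z. if z = 0 then deriv f 0 else (f z - f 0) / z) holomorphic_on S"
proof (cases "(0::complex) \<in> S")
  case True
  thus ?thesis using pole_lemma[OF assms(1), of 0] assms(2) by (simp add: interior_open cong: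
      if_cong)
next
  case False
  have "(\<lambda>z. (f z - f 0) / z) holomorphic_on S"
    using False assms by (intro holomorphic_intros) auto
  thus ?thesis by (rule holomorphic_transform) (use False in auto)
qed

definition exp_quotient :: "complex \<Rightarrow> complex" where
  "exp_quotient z = (if z = 0 then 1 else (exp z - 1) / z)"

lemma exp_quotient_mult: "exp_quotient z * z = exp z - 1"
  by (simp add: exp_quotient_def)

lemma holomorphic_exp_quotient: "exp_quotient holomorphic_on S"
proof -
  have "(\<lambda>z::complex. if z = 0 then deriv exp 0 else (exp z - exp 0) / z) holomorphic_on UNIV"
    by (rule holomorphic_difference_quotient_0) (auto intro: holomorphic_intros)
  moreover have "deriv exp (0::complex) = 1" using DERIV_imp_deriv[OF DERIV_exp, of "0::complex"] by
      simp
  ultimately have "exp_quotient holomorphic_on UNIV"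
    unfolding exp_quotient_def[abs_def] by (simp cong: if_cong)
  thus ?thesis by (rule holomorphic_on_subset) simp
qed

text \<open>The origin is tolerated only as the base point, where the integral vanishes together
  with \<open>exp z - 1\<close>. After continuation around other zeros the origin may be singular,
  so a domain based elsewhere has to avoid it as well.\<close>

definition punctured_star :: "complex \<Rightarrow> complex set \<Rightarrow> bool" where
  "punctured_star p S \<longleftrightarrow> open S \<and> p \<in> S \<and> (\<forall>z\<in>S. closed_segment p z \<subseteq> S) \<and>
     (\<forall>z\<in>S. exp z = 1 \<longrightarrow> z = 0 \<and> p = 0)"

lemma punctured_starD:
  assumes "punctured_star p S"
  shows "open S" "p \<in> S" "\<And>z. z \<in> S \<Longrightarrow> closed_segment p z \<subseteq> S"
    "\<And>z. z \<in> S \<Longrightarrow> exp_quotient z \<noteq> 0" "0 \<in> S \<Longrightarrow> p = 0"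
  using assms by (auto simp: punctured_star_def exp_quotient_def)

lemma volterra_kernel_quotient_continuous:
  assumes k: "entire_kernel k" and "\<And>z. z \<in> A \<Longrightarrow> exp_quotient z \<noteq> 0"
  shows "continuous_on (A \<times> B) (\<lambda>(z, w). k z w / exp_quotient z)"
proof -
  have "continuous_on (A \<times> B) (\<lambda>x. exp_quotient (fst x))"
    by (rule continuous_on_compose2[OF holomorphic_on_imp_continuous_on[OF
        holomorphic_exp_quotient[of UNIV]]])
       (auto intro!: continuous_intros)
  thus ?thesis
    unfolding case_prod_unfold
    by (intro continuous_on_divide entire_kernel_continuous[OF k] continuous_intros) (use assms(2)
        in auto)
qed

text \<open>The substitution \<open>\<psi> = z \<phi>\<close> removes the zero of \<open>exp z - 1\<close> at the origin.\<close>

lemma volterra_solution_exists: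
  assumes k: "entire_kernel k" and S: "punctured_star p S" and g: "g holomorphic_on UNIV"
    and g0: "p = 0 \<Longrightarrow> g 0 = 0"
  obtains \<phi> where "\<phi> holomorphic_on S" "\<And>z. z \<in> S \<Longrightarrow> volterra_eq k g p \<phi> z"
proof -
  note S' = punctured_starD[OF S]
  have hol: "(\<lambda>z. k z (linepath p z s) / exp_quotient z) holomorphic_on S" for s
  proof (intro holomorphic_on_divide entire_kernel_holomorphic[OF k S'(1)] holomorphic_on_ident
      holomorphic_exp_quotient S'(4))
    show "(\<lambda>z. linepath p z s) holomorphic_on S"
      unfolding linepath_def scaleR_conv_of_real by (intro holomorphic_intros)
  qed
  have h: "(\<lambda>z. g z / exp_quotient z) holomorphic_on S"
    by (intro holomorphic_on_divide holomorphic_exp_quotient S'(4) holomorphic_on_subset[OF g]) auto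
  obtain \<psi> where \<psi>: "\<psi> holomorphic_on S"
    "\<And>z. z \<in> S \<Longrightarrow> \<psi> z = g z / exp_quotient z + contour_integral (linepath p z) (\<lambda>w. k z w /
        exp_quotient z * \<psi> w)"
    using Volterra_solution_exists[OF S'(1,3) volterra_kernel_quotient_continuous[OF k S'(4)] hol h]
        by metis
  have \<psi>_eq: "exp_quotient z * \<psi> z = g z + contour_integral (linepath p z) (\<lambda>w. k z w * \<psi> w)" if z:
      "z \<in> S" for z
  proof -
    have "continuous_on (closed_segment p z) (\<lambda>w. k z w * \<psi> w)"
      by (intro continuous_on_mult entire_kernel_continuous[OF k] continuous_on_const
          continuous_on_id
           continuous_on_subset[OF holomorphic_on_imp_continuous_on[OF \<psi>(1)] S'(3)[OF z]])
    hence "contour_integral (linepath p z) (\<lambda>w. k z w * \<psi> w / exp_quotient z) = contour_integral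
        (linepath p z) (\<lambda>w. k z w * \<psi> w) / exp_quotient z"
      by (intro contour_integral_div contour_integrable_continuous_linepath)
    thus ?thesis
      using \<psi>(2)[OF z] S'(4)[OF z] by (simp add: field_simps)
  qed
  \<comment> \<open>Here \<open>0 \<in> S\<close> forces \<open>p = 0\<close>, so the integral runs
    over a trivial segment and \<open>g 0 = 0\<close> remains.\<close>
  have \<psi>0: "\<psi> 0 = 0" if "0 \<in> S"
    using \<psi>_eq[OF that] S'(5)[OF that] g0 by (simp add: exp_quotient_def)
  \<comment> \<open>The subtracted value is 0 in either case. It is written so that for
    \<open>0 \<in> S\<close> this is literally the difference quotient of
    \<open>holomorphic_difference_quotient_0\<close>.\<close>
  define \<phi> where "\<phi> z = (if z = 0 then deriv \<psi> 0 else (\<psi> z - (if 0 \<in> S then \<psi> 0 else 0)) / z)" for z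
  have \<phi>_\<psi>: "z * \<phi> z = \<psi> z" if "z \<in> S" for z
    using that \<psi>0 by (auto simp: \<phi>_def)
  show thesis
  proof (rule that)
    show "\<phi> holomorphic_on S"
    proof (cases "0 \<in> S")
      case True
      thus ?thesis using holomorphic_difference_quotient_0[OF \<psi>(1) S'(1)] unfolding \<phi>_def[abs_def]
          by simp
    next
      case False
      have "(\<lambda>z. \<psi> z / z) holomorphic_on S"
        using False \<psi> by (intro holomorphic_intros) auto
      thus ?thesis by (rule holomorphic_transform) (use False in \<open>auto simp: \<phi>_def\<close>)
    qed
    fix z assume z: "z \<in> S"
    have "contour_integral (linepath p z) (\<lambda>w. k z w * (w * \<phi> w)) = contour_integral (linepath p z)
        (\<lambda>w. k z w * \<psi> w)"
      by (intro contour_integral_eq) (use S'(3)[OF z] \<phi>_\<psi> in auto)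
    thus "volterra_eq k g p \<phi> z"
      using \<psi>_eq[OF z] \<phi>_\<psi>[OF z] unfolding volterra_eq_def by (simp add: mult.assoc flip:
          exp_quotient_mult)
  qed
qed

text \<open>The difference multiplied by \<open>z\<close> solves a homogeneous equation with kernel
  \<open>k z w / exp_quotient z\<close>. The factor \<open>z\<close> loses the value at 0, which the
  identity theorem recovers.\<close>

lemma volterra_eq_unique:
  assumes k: "entire_kernel k" and S: "punctured_star p S"
    and f: "\<phi> holomorphic_on S" "\<phi>' holomorphic_on S"
    and eq: "\<And>z. z \<in> S \<Longrightarrow> volterra_eq k g p \<phi> z" "\<And>z. z \<in> S \<Longrightarrow> volterra_eq k g p \<phi>' z"
    and z: "z \<in> S"
  shows "\<phi> z = \<phi>' z"
proof -
  note S' = punctured_starD[OF S]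
  note cont = f[THEN holomorphic_on_imp_continuous_on, THEN continuous_on_subset]
  have zero: "z * (\<phi> z - \<phi>' z) = 0" if z: "z \<in> S" for z
  proof (rule Volterra_homogeneous_unique[of p z "\<lambda>z w. k z w / exp_quotient z"])
    show "continuous_on (closed_segment p z \<times> closed_segment p z) (\<lambda>(z, w). k z w / exp_quotient z)"
      by (rule volterra_kernel_quotient_continuous[OF k]) (use S'(3)[OF z] S'(4) in auto)
    show "continuous_on (closed_segment p z) (\<lambda>w. w * (\<phi> w - \<phi>' w))"
      by (intro continuous_on_mult continuous_on_diff continuous_on_id cont S'(3) z)
    fix w assume "w \<in> closed_segment p z"
    hence w: "w \<in> S" using S'(3)[OF z] by auto
    have int: "(\<lambda>x. k w x * (x * \<phi> x)) contour_integrable_on linepath p w" "(\<lambda>x. k w x * (x * \<phi>' x))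
        contour_integrable_on linepath p w"
      by (intro contour_integrable_continuous_linepath continuous_on_mult
          entire_kernel_continuous[OF k] 
           continuous_on_const continuous_on_id cont S'(3) w)+
    have "exp_quotient w * (w * (\<phi> w - \<phi>' w)) = (exp w - 1) * \<phi> w - (exp w - 1) * \<phi>' w"
      by (simp add: algebra_simps flip: exp_quotient_mult)
    also have "\<dots> = contour_integral (linepath p w) (\<lambda>x. k w x * (x * \<phi> x)) - contour_integral
        (linepath p w) (\<lambda>x. k w x * (x * \<phi>' x))"
      using eq[OF w] by (simp add: volterra_eq_def)
    also have "\<dots> = contour_integral (linepath p w) (\<lambda>x. k w x * (x * \<phi> x) - k w x * (x * \<phi>' x))"
      by (rule contour_integral_diff[symmetric]) (rule int)+
    also have "(\<lambda>x. k w x * (x * \<phi> x) - k w x * (x * \<phi>' x)) = (\<lambda>x. k w x * (x * (\<phi> x - \<phi>' x)))"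
      by (simp add: algebra_simps)
    finally have "w * (\<phi> w - \<phi>' w) = contour_integral (linepath p w) (\<lambda>x. k w x * (x * (\<phi> x - \<phi>'
        x))) / exp_quotient w"
      using S'(4)[OF w] by (simp add: field_simps)
    also have "\<dots> = contour_integral (linepath p w) (\<lambda>x. k w x * (x * (\<phi> x - \<phi>' x)) / exp_quotient
        w)"
      by (intro contour_integral_div[symmetric] contour_integrable_continuous_linepath
          continuous_on_mult entire_kernel_continuous[OF k] 
           continuous_on_const continuous_on_id continuous_on_diff cont S'(3) w)
    finally show "w * (\<phi> w - \<phi>' w) = contour_integral (linepath p w) (\<lambda>x. k w x / exp_quotient w *
        (x * (\<phi> x - \<phi>' x)))"
      by simp
  qed
  show ?thesis
  proof (rule analytic_continuation_open[of "S - {0}" S \<phi> \<phi>'])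
    show "open (S - {0})" using S'(1) by auto
    show "S - {0} \<noteq> {}"
      using S'(1,2) by (metis Diff_eq_empty_iff not_open_singleton subset_singleton_iff empty_iff)
    show "connected S"
      using S'(2,3) by (intro starlike_imp_connected) (auto simp: starlike_def)
    show "\<phi> z = \<phi>' z" if "z \<in> S - {0}" for z
      using zero[of z] that by simp
  qed (use S' f z in auto)
qed

lemma holomorphic_on_eval_fps_shift:
  "(\<lambda>z. eval_fps h (z - p)) holomorphic_on eball p (fps_conv_radius h)" for h :: "complex fps"
proof -
  have "(\<lambda>z. z - p) ` eball p (fps_conv_radius h) \<subseteq> eball 0 (fps_conv_radius h)"
    by (auto simp: dist_norm norm_minus_commute)
  moreover have "(\<lambda>z. z - p) holomorphic_on eball p (fps_conv_radius h)"
    by (intro holomorphic_intros)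
  ultimately show ?thesis
    using holomorphic_on_compose_gen[of "\<lambda>z. z - p" _ "eval_fps h" "eball 0 (fps_conv_radius h)"]
      holomorphic_on_eval_fps[OF order_refl, of h]
    by (simp add: o_def)
qed

lemma eventually_nhds_shift_0:
  fixes p :: "'a :: real_normed_vector"
  shows "(\<forall>\<^sub>F z in nhds p. P z) \<longleftrightarrow> (\<forall>\<^sub>F w in nhds 0. P (p + w))"
  by (subst nhds_to_0) (simp add: eventually_filtermap add.commute)

lemma fps_expansion_unique:
  assumes "\<phi> holomorphic_on S" "open S" "p \<in> S" "fps_conv_radius h > 0"
    and "\<forall>\<^sub>F w in nhds 0. eval_fps h w = \<phi> (p + w)"
  shows "fps_expansion \<phi> p = h"
proof (rule eval_fps_eqD[OF eventually_eval_fps_expansion(1)[OF assms(1-3)] assms(4)])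
  have "\<forall>\<^sub>F w in nhds 0. eval_fps (fps_expansion \<phi> p) w = \<phi> (p + w)"
    using eventually_eval_fps_expansion(2)[OF assms(1-3)] by (subst (asm) eventually_nhds_shift_0)
        simp
  with assms(5) show "\<forall>\<^sub>F w in nhds 0. eval_fps (fps_expansion \<phi> p) w = eval_fps h w"
    by eventually_elim simp
qed

text \<open>The elementary continuation step: the equation is solved on all of \<open>S\<close> with
  the same \<open>g\<close>, and uniqueness on a small disc identifies the germ of this solution
  with \<open>h\<close>.\<close>

lemma volterra_germ_extend:
  assumes k: "entire_kernel k" and S: "punctured_star p S" and h: "volterra_germ k p h"
  obtains \<phi> g where "\<phi> holomorphic_on S" "exp_type g" "\<And>z. z \<in> S \<Longrightarrow> volterra_eq k g p \<phi> z"
    "fps_expansion \<phi> p = h"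
proof -
  note S' = punctured_starD[OF S]
  from h obtain g where conv: "fps_conv_radius h > 0" and g: "exp_type g"
    and ev: "\<forall>\<^sub>F z in nhds p. volterra_eq k g p (\<lambda>z. eval_fps h (z - p)) z"
    unfolding volterra_germ_def by blast
  \<comment> \<open>Evaluate the equation at \<open>z = p = 0\<close>, where
    \<open>exp z - 1\<close> and the integral both vanish.\<close>
  have "g 0 = 0" if "p = 0"
    using eventually_nhds_x_imp_x[OF ev] that by (simp add: volterra_eq_def)
  then obtain \<phi> where \<phi>: "\<phi> holomorphic_on S" "\<And>z. z \<in> S \<Longrightarrow> volterra_eq k g p \<phi> z"
    using volterra_solution_exists[OF k S exp_type_holomorphic[OF g]] by metis
  obtain U where U: "open U" "p \<in> U" "\<And>z. z \<in> U \<Longrightarrow> volterra_eq k g p (\<lambda>z. eval_fps h (z - p)) z"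
    using ev unfolding eventually_nhds by blast
  obtain r where r: "r > 0" "ball p r \<subseteq> U \<inter> S \<inter> eball p (fps_conv_radius h)"
  proof -
    have "open (U \<inter> S \<inter> eball p (fps_conv_radius h))" "p \<in> U \<inter> S \<inter> eball p (fps_conv_radius h)"
      using U S' conv by (auto simp: zero_ereal_def)
    then obtain r where "r > 0" "ball p r \<subseteq> U \<inter> S \<inter> eball p (fps_conv_radius h)"
      using openE by blast
    thus ?thesis by (rule that)
  qed
  have star: "punctured_star p (ball p r)"
    unfolding punctured_star_def
  proof (intro conjI ballI)
    show "closed_segment p z \<subseteq> ball p r" if "z \<in> ball p r" for z
      using that r(1) by (intro closed_segment_subset) auto
    show "exp z = 1 \<longrightarrow> z = 0 \<and> p = 0" if "z \<in> ball p r" for z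
      using that r(2) S unfolding punctured_star_def by blast
  qed (use r in auto)
  have eq: "\<phi> z = eval_fps h (z - p)" if "z \<in> ball p r" for z
  proof (rule volterra_eq_unique[OF k star _ _ _ _ that, where g = g])
    show "\<phi> holomorphic_on ball p r" using \<phi>(1) r by (auto intro: holomorphic_on_subset)
    show "(\<lambda>z. eval_fps h (z - p)) holomorphic_on ball p r"
      by (rule holomorphic_on_subset[OF holomorphic_on_eval_fps_shift]) (use r in auto)
  qed (use r U \<phi> in auto)
  have "fps_expansion \<phi> p = h"
  proof (rule fps_expansion_unique[OF \<phi>(1) S'(1,2) conv])
    have "\<forall>\<^sub>F z in nhds p. z \<in> ball p r"
      using r by (intro eventually_nhds_in_open) auto
    hence "\<forall>\<^sub>F z in nhds p. eval_fps h (z - p) = \<phi> z"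
      by eventually_elim (use eq in auto)
    thus "\<forall>\<^sub>F w in nhds 0. eval_fps h w = \<phi> (p + w)"
      by (subst (asm) eventually_nhds_shift_0) simp
  qed
  show thesis by (rule that[OF \<phi>(1) g \<phi>(2) \<open>fps_expansion \<phi> p = h\<close>])
qed

subsection \<open>Analytic continuation of solutions\<close>

lemma two_pi_i_Z_eq: "two_pi_i_Z = {z. exp z = 1}"
proof (intro set_eqI iffI)
  fix z assume "z \<in> two_pi_i_Z"
  then obtain k :: int where "z = 2 * of_real pi * \<i> * of_int k" by (auto simp: two_pi_i_Z_def)
  thus "z \<in> {z. exp z = 1}" by (auto simp: exp_eq_1)
next
  fix z :: complex assume "z \<in> {z. exp z = 1}"
  then obtain n :: int where "Re z = 0" "Im z = of_int (2 * n) * pi" by (auto simp: exp_eq_1)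
  hence "z = 2 * of_real pi * \<i> * of_int n" by (simp add: complex_eq_iff)
  thus "z \<in> two_pi_i_Z" by (auto simp: two_pi_i_Z_def)
qed

lemma exp_eq_1_in_ball_2pi:
  assumes "exp z = 1" "norm (z :: complex) < 2 * pi"
  shows "z = 0"
proof -
  obtain n :: int where n: "Re z = 0" "Im z = of_int (2 * n) * pi"
    using assms(1) by (auto simp: exp_eq_1)
  have "\<bar>Im z\<bar> < 2 * pi" using abs_Im_le_cmod[of z] assms(2) by linarith
  hence "\<bar>real_of_int n\<bar> < 1" by (simp add: n abs_mult)
  hence "n = 0" by linarith
  thus ?thesis using n by (simp add: complex_eq_iff)
qed

lemma volterra_germ_rebase:
  assumes "entire_kernel k" "\<phi> holomorphic_on S" "open S" "convex S" "p \<in> S" "q \<in> S"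
    and "volterra_germ k p (fps_expansion \<phi> p)"
  shows "volterra_germ k q (fps_expansion \<phi> q)"
proof -
  from assms(7) obtain g where g: "exp_type g" "\<forall>\<^sub>F z in nhds p. volterra_eq k g p \<phi> z"
    using volterra_germ_fps_expansion_iff[OF assms(2,3,5)] by auto
  from volterra_rebase[OF assms(1,3,4,5,6,2) g]
  obtain g' where g': "exp_type g'" "\<forall>z\<in>S. volterra_eq k g' q \<phi> z" by blast
  have "\<forall>\<^sub>F z in nhds q. z \<in> S"
    using assms by (intro eventually_nhds_in_open) auto
  hence "\<forall>\<^sub>F z in nhds q. volterra_eq k g' q \<phi> z"
    by eventually_elim (use g' in auto)
  thus ?thesis
    using g' volterra_germ_fps_expansion_iff[OF assms(2,3,6)] by auto
qed

text \<open>The condition of \<open>analytic_cont\<close> on an arbitrary parameter interval, so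
  that continuations can be concatenated.\<close>

definition analytic_cont_on :: "real \<Rightarrow> real \<Rightarrow> (real \<Rightarrow> complex) \<Rightarrow> (real \<Rightarrow> complex fps) \<Rightarrow> bool" where
  "analytic_cont_on a b \<gamma> G \<longleftrightarrow>
        (\<forall>t\<in>{a..b}. fps_conv_radius (G t) > 0) \<and>
        (\<forall>t\<in>{a..b}. \<forall>\<^sub>F s in at t within {a..b}.
           ereal (norm (\<gamma> s - \<gamma> t)) < fps_conv_radius (G t) \<and>
           (\<forall>\<^sub>F w in nhds 0. eval_fps (G s) w = eval_fps (G t) (\<gamma> s - \<gamma> t + w)))"

lemma analytic_cont_iff:
  "analytic_cont \<gamma> g h \<longleftrightarrow> (\<exists>G. G 0 = g \<and> G 1 = h \<and> analytic_cont_on 0 1 \<gamma> G)"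
  by (simp add: analytic_cont_def analytic_cont_on_def)

lemma analytic_cont_on_fps_expansion:
  assumes \<phi>: "\<phi> holomorphic_on S" "open S" and \<gamma>: "continuous_on {a..b} \<gamma>" "\<And>t. t \<in> {a..b} \<Longrightarrow> \<gamma> t \<in>
      S"
  shows "analytic_cont_on a b \<gamma> (\<lambda>t. fps_expansion \<phi> (\<gamma> t))"
  unfolding analytic_cont_on_def
proof (intro conjI ballI)
  fix t assume t: "t \<in> {a..b}"
  show "fps_conv_radius (fps_expansion \<phi> (\<gamma> t)) > 0"
    by (rule eventually_eval_fps_expansion(1)[OF \<phi> \<gamma>(2)[OF t]])
  obtain r where r: "r > 0" "ball (\<gamma> t) r \<subseteq> S"
    using openE[OF \<phi>(2) \<gamma>(2)[OF t]] by blast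
  have hol: "\<phi> holomorphic_on eball (\<gamma> t) (ereal r)"
    using holomorphic_on_subset[OF \<phi>(1) r(2)] by simp
  have conv: "ereal r \<le> fps_conv_radius (fps_expansion \<phi> (\<gamma> t))"
    by (rule conv_radius_fps_expansion[OF hol])
  have "(\<gamma> \<longlongrightarrow> \<gamma> t) (at t within {a..b})"
    using \<gamma>(1) t by (auto simp: continuous_on_def)
  hence "\<forall>\<^sub>F s in at t within {a..b}. dist (\<gamma> s) (\<gamma> t) < r"
    using r(1) by (rule tendstoD)
  moreover have "\<forall>\<^sub>F s in at t within {a..b}. s \<in> {a..b}"
    by (auto simp: eventually_at_filter)
  ultimately show "\<forall>\<^sub>F s in at t within {a..b}.
     ereal (norm (\<gamma> s - \<gamma> t)) < fps_conv_radius (fps_expansion \<phi> (\<gamma> t)) \<and>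
     (\<forall>\<^sub>F w in nhds 0. eval_fps (fps_expansion \<phi> (\<gamma> s)) w = eval_fps (fps_expansion \<phi> (\<gamma> t)) (\<gamma> s -
         \<gamma> t + w))"
  proof eventually_elim
    case (elim s)
    have "ereal (norm (\<gamma> s - \<gamma> t)) < ereal r" using elim by (simp add: dist_norm)
    have "\<forall>\<^sub>F z in nhds (\<gamma> s). z \<in> ball (\<gamma> t) r"
      using elim by (intro eventually_nhds_in_open) (auto simp: dist_commute)
    hence "\<forall>\<^sub>F w in nhds 0. \<gamma> s + w \<in> ball (\<gamma> t) r"
      by (subst (asm) eventually_nhds_shift_0)
    moreover have "\<forall>\<^sub>F w in nhds 0. eval_fps (fps_expansion \<phi> (\<gamma> s)) w = \<phi> (\<gamma> s + w)"
      using eventually_eval_fps_expansion(2)[OF \<phi> \<gamma>(2)[OF elim(2)]]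
      by (subst (asm) eventually_nhds_shift_0) simp
    ultimately have "\<forall>\<^sub>F w in nhds 0. eval_fps (fps_expansion \<phi> (\<gamma> s)) w = eval_fps (fps_expansion \<phi>
        (\<gamma> t)) (\<gamma> s - \<gamma> t + w)"
    proof eventually_elim
      case (elim w)
      thus ?case using eval_fps_expansion[OF hol, of "\<gamma> s + w"] by (simp add: algebra_simps)
    qed
    thus ?case
      using less_le_trans[OF \<open>ereal (norm (\<gamma> s - \<gamma> t)) < ereal r\<close> conv] by blast
  qed
qed

text \<open>At a parameter other than \<open>b\<close>, a small neighbourhood lies on one side of
  \<open>b\<close>; at \<open>b\<close> both families agree, so the smaller of the two radii
  works.\<close>

lemma analytic_cont_on_join:
  assumes ab: "a \<le> b" "b \<le> c" and G: "analytic_cont_on a b \<gamma> G1" "analytic_cont_on b c \<gamma> G2" "G1 b =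
      G2 b"
  shows "analytic_cont_on a c \<gamma> (\<lambda>t. if t \<le> b then G1 t else G2 t)"
proof -
  define G where "G t = (if t \<le> b then G1 t else G2 t)" for t
  define L where "L G t s \<longleftrightarrow> ereal (norm (\<gamma> s - \<gamma> t)) < fps_conv_radius (G t) \<and>
           (\<forall>\<^sub>F w in nhds 0. eval_fps (G s) w = eval_fps (G t) (\<gamma> s - \<gamma> t + w))" for G t s
  have G1: "G t = G1 t" if "t \<le> b" for t using that by (simp add: G_def)
  have G2: "G t = G2 t" if "t \<ge> b" for t using that G(3) by (auto simp: G_def)
  have L1: "L G t s \<longleftrightarrow> L G1 t s" if "t \<le> b" "s \<le> b" for t s
    using that by (simp add: L_def G1)
  have L2: "L G t s \<longleftrightarrow> L G2 t s" if "t \<ge> b" "s \<ge> b" for t s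
    using that by (simp add: L_def G2)
  have e1: "\<exists>d>0. \<forall>s\<in>{a..b}. s \<noteq> t \<and> dist s t < d \<longrightarrow> L G1 t s" if "t \<in> {a..b}" for t
    using G(1) that unfolding analytic_cont_on_def L_def eventually_at by blast
  have e2: "\<exists>d>0. \<forall>s\<in>{b..c}. s \<noteq> t \<and> dist s t < d \<longrightarrow> L G2 t s" if "t \<in> {b..c}" for t
    using G(2) that unfolding analytic_cont_on_def L_def eventually_at by blast
  have "\<exists>d>0. \<forall>s\<in>{a..c}. s \<noteq> t \<and> dist s t < d \<longrightarrow> L G t s" if t: "t \<in> {a..c}" for t
  proof -
    consider "t < b" | "t = b" | "t > b" by linarith
    thus ?thesis
    proof cases
      case 1
      with t e1[of t] obtain d where d: "d > 0" "\<forall>s\<in>{a..b}. s \<noteq> t \<and> dist s t < d \<longrightarrow> L G1 t s" by auto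
      show ?thesis
        by (rule exI[of _ "min d (b - t)"]) (use d 1 in \<open>auto simp: L1 dist_real_def\<close>)
    next
      case 3
      with t e2[of t] obtain d where d: "d > 0" "\<forall>s\<in>{b..c}. s \<noteq> t \<and> dist s t < d \<longrightarrow> L G2 t s" by auto
      show ?thesis
        by (rule exI[of _ "min d (t - b)"]) (use d 3 in \<open>auto simp: L2 dist_real_def\<close>)
    next
      case 2
      from e1[of b] ab obtain d where d: "d > 0" "\<forall>s\<in>{a..b}. s \<noteq> b \<and> dist s b < d \<longrightarrow> L G1 b s" by
          auto
      from e2[of b] ab obtain d' where d': "d' > 0" "\<forall>s\<in>{b..c}. s \<noteq> b \<and> dist s b < d' \<longrightarrow> L G2 b s" by
          auto
      show ?thesis
      proof (intro exI[of _ "min d d'"] conjI ballI impI)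
        fix s assume s: "s \<in> {a..c}" "s \<noteq> t \<and> dist s t < min d d'"
        show "L G t s"
          by (cases "s \<le> b") (use s d(2) d'(2) 2 in \<open>auto simp: L1 L2\<close>)
      qed (use d d' in auto)
    qed
  qed
  hence "\<forall>t\<in>{a..c}. \<forall>\<^sub>F s in at t within {a..c}. L G t s"
    unfolding eventually_at by blast
  moreover have "\<forall>t\<in>{a..c}. fps_conv_radius (G t) > 0"
    using G(1,2) by (auto simp: G_def analytic_cont_on_def)
  ultimately show ?thesis
    unfolding analytic_cont_on_def L_def G_def[abs_def] by blast
qed

text \<open>The growth estimate concerns an arbitrary given continuation \<open>h\<close>, so
  \<open>h\<close> has to be recognised as a solution germ. Being one is locally constant along the
  path, because neighbouring germs are expansions of one function on a disc; \<open>Bolzano\<close>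
  passes from local to global.\<close>

lemma volterra_germ_analytic_cont:
  assumes k: "entire_kernel k" and "analytic_cont \<gamma> g h" and g: "volterra_germ k (pathstart \<gamma>) g"
  shows "volterra_germ k (pathfinish \<gamma>) h"
proof -
  from assms(2) obtain G where G: "G 0 = g" "G 1 = h" "analytic_cont_on 0 1 \<gamma> G"
    by (auto simp: analytic_cont_iff)
  define Q where "Q t \<longleftrightarrow> volterra_germ k (\<gamma> t) (G t)" for t
  define P where "P a b \<longleftrightarrow> (0 \<le> a \<longrightarrow> b \<le> 1 \<longrightarrow> Q a = Q b)" for a b
  have "P 0 1"
  proof (rule Bolzano)
    show "(0::real) \<le> 1" by simp
    show "P a c" if "P a b" "P b c" "a \<le> b" "b \<le> c" for a b c
      using that by (auto simp: P_def)
    fix x :: real assume x: "0 \<le> x" "x \<le> 1"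
    have conv: "fps_conv_radius (G x) > 0" using G(3) x by (auto simp: analytic_cont_on_def)
    have "\<forall>\<^sub>F s in at x within {0..1}.
           ereal (norm (\<gamma> s - \<gamma> x)) < fps_conv_radius (G x) \<and>
           (\<forall>\<^sub>F w in nhds 0. eval_fps (G s) w = eval_fps (G x) (\<gamma> s - \<gamma> x + w))"
      using G(3) x by (auto simp: analytic_cont_on_def)
    moreover have "\<forall>\<^sub>F s in at x within {0..1}. s \<in> {0..1}"
      by (auto simp: eventually_at_filter)
    ultimately have "\<forall>\<^sub>F s in at x within {0..1}. Q s = Q x"
    proof eventually_elim
      case (elim s)
      obtain r where r: "norm (\<gamma> s - \<gamma> x) < r" "ereal r < fps_conv_radius (G x)"
        using elim ereal_dense2 by (metis ereal_less_eq(3) less_ereal.simps(1))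
      define \<phi> where "\<phi> z = eval_fps (G x) (z - \<gamma> x)" for z
      have hol: "\<phi> holomorphic_on ball (\<gamma> x) r"
        unfolding \<phi>_def by (rule holomorphic_on_subset[OF holomorphic_on_eval_fps_shift])
          (rule ball_eball_mono[OF less_imp_le[OF r(2)]])
      have "r > 0" using r(1) norm_ge_zero[of "\<gamma> s - \<gamma> x"] by linarith
      have in_ball: "\<gamma> x \<in> ball (\<gamma> x) r" "\<gamma> s \<in> ball (\<gamma> x) r"
        using r(1) \<open>r > 0\<close> by (auto simp: dist_norm norm_minus_commute)
      have 1: "fps_expansion \<phi> (\<gamma> x) = G x"
        by (rule fps_expansion_unique[OF hol _ in_ball(1) conv]) (auto simp: \<phi>_def)
      have 2: "fps_expansion \<phi> (\<gamma> s) = G s"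
      proof (rule fps_expansion_unique[OF hol _ in_ball(2)])
        show "fps_conv_radius (G s) > 0" using G(3) elim by (auto simp: analytic_cont_on_def)
        show "\<forall>\<^sub>F w in nhds 0. eval_fps (G s) w = \<phi> (\<gamma> s + w)"
          using elim by (simp add: \<phi>_def algebra_simps)
      qed auto
      show "Q s = Q x"
        unfolding Q_def 1[symmetric] 2[symmetric]
        using volterra_germ_rebase[OF k hol open_ball convex_ball in_ball] volterra_germ_rebase[OF k
            hol open_ball convex_ball in_ball(2,1)]
        by (rule iffI[rotated])
    qed
    then obtain d where d: "d > 0" "\<And>s. s \<in> {0..1} \<Longrightarrow> s \<noteq> x \<Longrightarrow> dist s x < d \<Longrightarrow> Q s = Q x"
      unfolding eventually_at by blast
    have d': "Q s = Q x" if "s \<in> {0..1}" "dist s x < d" for s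
      using d(2)[of s] that by (cases "s = x") auto
    show "\<exists>d>0. \<forall>a b. a \<le> x \<and> x \<le> b \<and> b - a < d \<longrightarrow> P a b"
    proof (intro exI[of _ d] conjI allI impI)
      fix a b assume ab: "a \<le> x \<and> x \<le> b \<and> b - a < d"
      show "P a b"
        unfolding P_def
      proof (intro impI)
        assume "0 \<le> a" "b \<le> 1"
        with ab have "a \<in> {0..1}" "dist a x < d" "b \<in> {0..1}" "dist b x < d"
          by (auto simp: dist_real_def)
        thus "Q a = Q b" using d'[of a] d'[of b] by metis
      qed
    qed (rule d(1))
  qed
  thus ?thesis using g by (simp add: P_def Q_def G pathstart_def pathfinish_def)
qed

text \<open>Bisection: short intervals are handled by solving the equation on one disc.
  \<open>P\<close> quantifies over all solution germs at the left end so that \<open>P a b\<close>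
  and \<open>P b c\<close> compose.\<close>

lemma analytic_cont_exists:
  assumes k: "entire_kernel k" and \<gamma>: "admissible_path \<gamma>" and g: "volterra_germ k 0 g"
  shows "\<exists>h. analytic_cont \<gamma> g h"
proof -
  define P where "P a b \<longleftrightarrow> (0 \<le> a \<longrightarrow> a \<le> b \<longrightarrow> b \<le> 1 \<longrightarrow>
      (\<forall>h. volterra_germ k (\<gamma> a) h \<longrightarrow>
         (\<exists>G. G a = h \<and> analytic_cont_on a b \<gamma> G \<and> volterra_germ k (\<gamma> b) (G b))))" for a b
  have \<gamma>_cont: "continuous_on {0..1} \<gamma>" and \<gamma>0: "\<gamma> 0 = 0" and \<gamma>_avoid: "\<And>t. t \<in> {0<..1} \<Longrightarrow> exp (\<gamma> t)
      \<noteq> 1"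
    using \<gamma> unfolding admissible_path_def path_def pathstart_def two_pi_i_Z_eq by auto
  have "P 0 1"
  proof (rule Bolzano)
    show "(0::real) \<le> 1" by simp
    show "P a c" if P: "P a b" "P b c" and le: "a \<le> b" "b \<le> c" for a b c
      unfolding P_def
    proof (intro impI allI)
      fix h assume *: "0 \<le> a" "a \<le> c" "c \<le> 1" "volterra_germ k (\<gamma> a) h"
      from P(1) * le obtain G1 where G1: "G1 a = h" "analytic_cont_on a b \<gamma> G1" "volterra_germ k (\<gamma>
          b) (G1 b)"
        unfolding P_def by fastforce
      from P(2) * le G1(3) obtain G2 where G2: "G2 b = G1 b" "analytic_cont_on b c \<gamma> G2"
          "volterra_germ k (\<gamma> c) (G2 c)"
        unfolding P_def by fastforce
      show "\<exists>G. G a = h \<and> analytic_cont_on a c \<gamma> G \<and> volterra_germ k (\<gamma> c) (G c)"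
        by (rule exI[of _ "\<lambda>t. if t \<le> b then G1 t else G2 t"])
           (use analytic_cont_on_join[OF le G1(2) G2(2)] G1 G2 le in auto)
    qed
    fix x :: real assume x: "0 \<le> x" "x \<le> 1"
    \<comment> \<open>For \<open>x = 0\<close> the disc contains the zero 0 of
      \<open>exp z - 1\<close>. This is admissible: an interval around \<open>x = 0\<close> inside
      \<open>{0..1}\<close> starts at \<open>a = 0\<close>, so that the base point is 0
      itself.\<close>
    obtain r where r: "r > 0" "\<And>z. z \<in> ball (\<gamma> x) r \<Longrightarrow> exp z = 1 \<Longrightarrow> x = 0 \<and> z = 0"
    proof (cases "x = 0")
      case True
      thus ?thesis using that[of "2 * pi"] exp_eq_1_in_ball_2pi \<gamma>0 by simp
    next
      case False
      have "open {z::complex. exp z \<noteq> 1}"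
        by (intro open_Collect_neq continuous_intros)
      moreover have "\<gamma> x \<in> {z. exp z \<noteq> 1}" using \<gamma>_avoid[of x] False x by auto
      ultimately obtain r where "r > 0" "ball (\<gamma> x) r \<subseteq> {z. exp z \<noteq> 1}" by (rule openE)
      thus ?thesis using that[of r] by blast
    qed
    obtain d where d: "d > 0" "\<And>s. s \<in> {0..1} \<Longrightarrow> dist s x < d \<Longrightarrow> dist (\<gamma> s) (\<gamma> x) < r"
      using \<gamma>_cont x r(1) unfolding continuous_on_iff by (metis atLeastAtMost_iff)
    show "\<exists>d>0. \<forall>a b. a \<le> x \<and> x \<le> b \<and> b - a < d \<longrightarrow> P a b"
    proof (intro exI[of _ d] conjI allI impI)
      fix a b assume ab: "a \<le> x \<and> x \<le> b \<and> b - a < d"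
      show "P a b"
        unfolding P_def
      proof (intro impI allI)
        fix h assume *: "0 \<le> a" "a \<le> b" "b \<le> 1" "volterra_germ k (\<gamma> a) h"
        have in_ball: "\<gamma> s \<in> ball (\<gamma> x) r" if "s \<in> {a..b}" for s
          using d(2)[of s] that ab * by (auto simp: dist_real_def dist_commute)
        have star: "punctured_star (\<gamma> a) (ball (\<gamma> x) r)"
          unfolding punctured_star_def
        proof (intro conjI ballI impI)
          show "\<gamma> a \<in> ball (\<gamma> x) r" using in_ball * by auto
          show "closed_segment (\<gamma> a) z \<subseteq> ball (\<gamma> x) r" if "z \<in> ball (\<gamma> x) r" for z
            using that in_ball[of a] * by (intro closed_segment_subset) auto
          fix z assume "z \<in> ball (\<gamma> x) r" "exp z = 1"
          with r(2) have "x = 0" "z = 0" by auto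
          with ab * show "z = 0" "\<gamma> a = 0" using \<gamma>0 by auto
        qed auto
        obtain \<phi> where \<phi>: "\<phi> holomorphic_on ball (\<gamma> x) r" "fps_expansion \<phi> (\<gamma> a) = h"
          using volterra_germ_extend[OF k star *(4)] by metis
        have "analytic_cont_on a b \<gamma> (\<lambda>t. fps_expansion \<phi> (\<gamma> t))"
          by (rule analytic_cont_on_fps_expansion[OF \<phi>(1) open_ball])
             (use in_ball * in \<open>auto intro: continuous_on_subset[OF \<gamma>_cont]\<close>)
        moreover have "volterra_germ k (\<gamma> b) (fps_expansion \<phi> (\<gamma> b))"
          by (rule volterra_germ_rebase[OF k \<phi>(1) open_ball convex_ball in_ball[of a] in_ball[of
              b]])
             (use * \<phi>(2) in auto)
        ultimately show "\<exists>G. G a = h \<and> analytic_cont_on a b \<gamma> G \<and> volterra_germ k (\<gamma> b) (G b)"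
          using \<phi>(2) by (intro exI[of _ "\<lambda>t. fps_expansion \<phi> (\<gamma> t)"]) auto
      qed
    qed (use d in auto)
  qed
  with g \<gamma>0 obtain G where "G 0 = g" "analytic_cont_on 0 1 \<gamma> G"
    unfolding P_def by auto
  thus ?thesis unfolding analytic_cont_iff by blast
qed

subsection \<open>Exponential growth along rays\<close>

text \<open>The kernel is measured against \<open>norm (exp z - 1)\<close>, so that dividing the
  equation by it leaves a kernel bounded by \<open>M * exp (R * (t - s))\<close>. After weighting
  with a decreasing exponential this becomes the constant \<open>M\<close>, and Gronwall's
  inequality applies. Closer to \<open>p\<close> than \<epsilon>, where \<open>exp z - 1\<close> may
  vanish, compactness bounds \<phi>.\<close>

lemma volterra_ray_growth:
  assumes k: "entire_kernel k" and g: "exp_type g" and pos: "\<epsilon> > 0" "m > 0" "M > 0" "R > 0"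
    and S: "cball p \<epsilon> \<subseteq> S" and \<phi>: "continuous_on S \<phi>"
    and ray: "\<And>d t. d \<in> D \<Longrightarrow> 0 \<le> t \<Longrightarrow> p + of_real t * d \<in> S"
    and unit: "\<And>d. d \<in> D \<Longrightarrow> norm d = 1"
    and eq: "\<And>d t. d \<in> D \<Longrightarrow> 0 \<le> t \<Longrightarrow> volterra_eq k g p \<phi> (p + of_real t * d)"
    and lower: "\<And>d t. d \<in> D \<Longrightarrow> \<epsilon> \<le> t \<Longrightarrow> m \<le> norm (exp (p + of_real t * d) - 1)"
    and kernel: "\<And>d s t. d \<in> D \<Longrightarrow> \<epsilon> \<le> t \<Longrightarrow> 0 \<le> s \<Longrightarrow> s \<le> t \<Longrightarrow>
       norm (k (p + of_real t * d) (p + of_real s * d) * (p + of_real s * d)) \<le>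
         M * exp (R * (t - s)) * norm (exp (p + of_real t * d) - 1)"
  shows "\<exists>C0 R0. C0 > 0 \<and> R0 > 0 \<and> (\<forall>d\<in>D. \<forall>t\<ge>0. norm (\<phi> (p + of_real t * d)) \<le> C0 * exp (R0 * t))"
proof -
  obtain A B where AB: "A > 0" "B > 0" "\<And>z. norm (g z) \<le> A * exp (B * norm z)"
    using exp_typeE[OF g] by metis
  obtain B0 where B0: "B0 > 0" "\<And>z. z \<in> cball p \<epsilon> \<Longrightarrow> norm (\<phi> z) \<le> B0"
    using continuous_on_compact_norm_bound[OF compact_cball continuous_on_subset[OF \<phi> S]] by metis
  \<comment> \<open>The weight must absorb both the kernel, at rate \<open>R\<close>, and the
    inhomogeneous term, at rate \<open>B\<close>.\<close>
  define R' where "R' = R + B"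
  have "R' > 0" using AB(2) pos by (simp add: R'_def)
  define G where "G = B0 + A * exp (B * norm p) / m"
  have "G > 0" using B0(1) AB(1) pos by (simp add: G_def add_pos_pos)
  have main: "norm (\<phi> (p + of_real t * d)) \<le> 2 * G * exp ((R' + 2 * M) * t)" if d: "d \<in> D" and t: "t
      \<ge> 0" for d t
  proof -
    define z where "z s = p + of_real s * d" for s
    define v where "v s = exp (- R' * s) * norm (\<phi> (z s))" for s
    have z_cont: "continuous_on X z" for X unfolding z_def by (intro continuous_intros)
    have zS: "z s \<in> S" if "0 \<le> s" for s using ray[OF d that] by (simp add: z_def)
    have \<phi>z: "continuous_on {0..x} (\<lambda>s. \<phi> (z s))" for x
      by (rule continuous_on_compose2[OF \<phi> z_cont]) (use zS in auto)
    have v_cont: "continuous_on {0..x} v" for x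
      unfolding v_def by (intro continuous_intros \<phi>z)
    have "v x \<le> G + M * integral {0..x} v" if x: "x \<ge> 0" for x
    proof (cases "x < \<epsilon>")
      case True
      have "dist p (z x) = x" using x unit[OF d] by (simp add: z_def dist_norm norm_mult)
      hence "norm (\<phi> (z x)) \<le> B0" using True by (intro B0(2)) auto
      moreover have "exp (- R' * x) \<le> 1" using x \<open>R' > 0\<close> by simp
      ultimately have "v x \<le> 1 * B0" unfolding v_def using B0(1) by (intro mult_mono) auto
      also have "\<dots> \<le> G" using AB(1) pos by (simp add: G_def)
      also have "G \<le> G + M * integral {0..x} v"
      proof -
        have "integral {0..x} v \<ge> 0"
          by (intro integral_nonneg integrable_continuous_real v_cont) (auto simp: v_def)
        thus ?thesis using pos by simp
      qed
      finally show ?thesis .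
    next
      case False
      hence x': "\<epsilon> \<le> x" by simp
      define E where "E = norm (exp (z x) - 1)"
      have E: "m \<le> E" unfolding E_def z_def by (rule lower[OF d x'])
      have int: "contour_integral (linepath p (z x)) (\<lambda>w. k (z x) w * (w * \<phi> w)) =
                   d * integral {0..x} (\<lambda>s. k (z x) (z s) * (z s * \<phi> (z s)))"
        using contour_integral_linepath_scaled[OF x, of p d "\<lambda>w. k (z x) w * (w * \<phi> w)"] by (simp
            add: z_def)
      have "norm (integral {0..x} (\<lambda>s. k (z x) (z s) * (z s * \<phi> (z s)))) \<le>
            integral {0..x} (\<lambda>s. (M * E * exp (R' * x)) * v s)"
      proof (rule integral_norm_bound_integral)
        show "(\<lambda>s. k (z x) (z s) * (z s * \<phi> (z s))) integrable_on {0..x}"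
          by (intro integrable_continuous_real continuous_on_mult entire_kernel_continuous[OF k]
              continuous_on_const z_cont \<phi>z)
        show "(\<lambda>s. M * E * exp (R' * x) * v s) integrable_on {0..x}"
          by (intro integrable_continuous_real continuous_intros v_cont)
        fix s assume s: "s \<in> {0..x}"
        have "norm (k (z x) (z s) * (z s * \<phi> (z s))) = norm (k (z x) (z s) * z s) * norm (\<phi> (z s))"
          by (simp add: norm_mult)
        also have "\<dots> \<le> (M * exp (R * (x - s)) * E) * norm (\<phi> (z s))"
          unfolding E_def z_def by (intro mult_right_mono kernel d x') (use s in auto)
        also have "\<dots> \<le> (M * exp (R' * (x - s)) * E) * norm (\<phi> (z s))"
          using s AB(2) pos E by (intro mult_right_mono mult_left_mono) (auto simp: R'_def intro!:
              mult_right_mono)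
        also have "\<dots> = M * E * exp (R' * x) * v s"
          by (simp add: v_def algebra_simps exp_diff exp_minus field_simps)
        finally show "norm (k (z x) (z s) * (z s * \<phi> (z s))) \<le> M * E * exp (R' * x) * v s" .
      qed
      hence I: "norm (contour_integral (linepath p (z x)) (\<lambda>w. k (z x) w * (w * \<phi> w))) \<le> M * E * exp
          (R' * x) * integral {0..x} v"
        using int unit[OF d] by (simp add: norm_mult)
      have "E * norm (\<phi> (z x)) = norm (g (z x) + contour_integral (linepath p (z x)) (\<lambda>w. k (z x) w
          * (w * \<phi> w)))"
        using eq[OF d x] unfolding volterra_eq_def E_def z_def by (simp flip: norm_mult)
      also have "\<dots> \<le> A * exp (B * norm (z x)) + M * E * exp (R' * x) * integral {0..x} v"
        by (rule order_trans[OF norm_triangle_ineq add_mono[OF AB(3) I]])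
      also have "A * exp (B * norm (z x)) \<le> A * exp (B * norm p) * exp (R' * x)"
      proof -
        have "norm (z x) \<le> norm p + x"
          using norm_triangle_ineq[of p "of_real x * d"] unit[OF d] x by (simp add: z_def norm_mult)
        hence "B * norm (z x) \<le> B * (norm p + x)" using AB(2) by (intro mult_left_mono) auto
        also have "\<dots> \<le> B * norm p + R' * x" using x pos by (simp add: R'_def algebra_simps)
        finally show ?thesis using AB(1) by (simp add: mult.assoc flip: exp_add)
      qed
      finally have "E * norm (\<phi> (z x)) \<le> exp (R' * x) * (A * exp (B * norm p) + M * E * integral
          {0..x} v)"
        by (simp add: algebra_simps)
      hence "exp (- R' * x) * (E * norm (\<phi> (z x))) \<le> exp (- R' * x) * (exp (R' * x) * (A * exp (B *
          norm p) + M * E * integral {0..x} v))"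
        by (intro mult_left_mono) auto
      hence "E * v x \<le> A * exp (B * norm p) + E * (M * integral {0..x} v)"
        by (simp add: v_def mult_ac exp_minus field_simps)
      also have "A * exp (B * norm p) \<le> E * (A * exp (B * norm p) / m)"
        using E pos AB(1) by (simp add: field_simps mult_right_mono)
      finally have "E * v x \<le> E * (A * exp (B * norm p) / m + M * integral {0..x} v)"
        by (simp add: algebra_simps)
      hence "v x \<le> A * exp (B * norm p) / m + M * integral {0..x} v"
        using E pos by (simp add: mult_le_cancel_left)
      thus ?thesis using B0(1) by (simp add: G_def)
    qed
    from Gronwall_exp_bound[OF v_cont[of t] pos(3) less_imp_le[OF \<open>G > 0\<close>] this, of t]
    have "v t \<le> 2 * G * exp (2 * M * t)" using t by auto
    hence "exp (R' * t) * v t \<le> exp (R' * t) * (2 * G * exp (2 * M * t))"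
      by (intro mult_left_mono) auto
    moreover have "exp (R' * t) * v t = norm (\<phi> (z t))"
      by (simp add: v_def flip: mult.assoc exp_add)
    moreover have "exp (R' * t) * (2 * G * exp (2 * M * t)) = 2 * G * exp ((R' + 2 * M) * t)"
      by (simp add: algebra_simps exp_add)
    ultimately show ?thesis by (simp add: z_def)
  qed
  show ?thesis
    by (rule exI[of _ "2 * G"], rule exI[of _ "R' + 2 * M"])
       (use main \<open>G > 0\<close> pos AB(2) in \<open>auto simp: R'_def\<close>)
qed

text \<open>Used to absorb the factor \<open>w\<close> of the integrand into exponential growth at a
  small rate.\<close>

lemma le_exp_scaled:
  fixes x :: real assumes "\<eta> > 0" "x \<ge> 0" shows "x \<le> 1 / \<eta> * exp (\<eta> * x)"
proof -
  have "\<eta> * x \<le> exp (\<eta> * x)" using exp_ge_add_one_self[of "\<eta> * x"] by linarith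
  thus ?thesis using assms by (simp add: field_simps)
qed

text \<open>With \<eta> half of \<mu>, the kernel costs \<open>exp (\<eta> * norm w)\<close> and the
  factor \<open>w\<close> of the integrand costs the same once more. The product
  \<open>exp (\<mu> * norm w)\<close> is at most a constant times \<open>exp (\<mu> * t)\<close>,
  which the lower bound \<open>m * exp (\<mu> * t)\<close> of \<open>exp z - 1\<close>
  compensates.\<close>

lemma volterra_growth_right:
  assumes k: "entire_kernel k" and g: "exp_type g" and pos: "\<epsilon> > 0" "\<mu> > 0"
    and S: "cball p \<epsilon> \<subseteq> S" and \<phi>: "continuous_on S \<phi>" and p: "Re p = 0"
    and ray: "\<And>d t. d \<in> D \<Longrightarrow> 0 \<le> t \<Longrightarrow> p + of_real t * d \<in> S"
    and dir: "\<And>d. d \<in> D \<Longrightarrow> norm d = 1 \<and> Re d \<ge> \<mu>"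
    and eq: "\<And>d t. d \<in> D \<Longrightarrow> 0 \<le> t \<Longrightarrow> volterra_eq k g p \<phi> (p + of_real t * d)"
    and kb: "\<And>\<eta>. \<eta> > 0 \<Longrightarrow> \<exists>C>0. \<exists>R>0. \<forall>z w. norm (k z w) \<le> C * exp (\<eta> * norm w + R * norm (z - w))"
  shows "\<exists>C0 R0. C0 > 0 \<and> R0 > 0 \<and> (\<forall>d\<in>D. \<forall>t\<ge>0. norm (\<phi> (p + of_real t * d)) \<le> C0 * exp (R0 * t))"
proof -
  define \<eta> where "\<eta> = \<mu> / 2"
  have \<eta>: "\<eta> > 0" using pos by (simp add: \<eta>_def)
  obtain C R where CR: "C > 0" "R > 0" "\<And>z w. norm (k z w) \<le> C * exp (\<eta> * norm w + R * norm (z -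
      w))"
    using kb[OF \<eta>] by metis
  define m where "m = 1 - exp (- \<mu> * \<epsilon>)"
  have m: "m > 0" using pos by (simp add: m_def)
  have lower: "m * exp (\<mu> * t) \<le> norm (exp (p + of_real t * d) - 1)" if "d \<in> D" "\<epsilon> \<le> t" for d t
  proof -
    have "exp (\<mu> * t) - 1 = (1 - exp (- \<mu> * t)) * exp (\<mu> * t)"
      by (simp add: algebra_simps flip: exp_add)
    hence "m * exp (\<mu> * t) \<le> exp (\<mu> * t) - 1"
      unfolding m_def using pos that by (auto intro!: mult_right_mono)
    also have "exp (\<mu> * t) \<le> exp (t * Re d)"
      using dir[OF that(1)] that(2) pos by (simp add: mult.commute)
    also have "exp (t * Re d) = norm (exp (p + of_real t * d))" by (simp add: p)
    also have "\<dots> - 1 \<le> norm (exp (p + of_real t * d) - 1)"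
      using norm_triangle_ineq2[of "exp (p + of_real t * d)" 1] by simp
    finally show ?thesis by simp
  qed
  define M where "M = C * (1 / \<eta>) * exp (\<mu> * norm p) / m"
  have M: "M > 0" using CR(1) \<eta> m by (simp add: M_def)
  show ?thesis
  proof (rule volterra_ray_growth[OF k g pos(1) m M CR(2) S \<phi> ray])
    show "norm d = 1" if "d \<in> D" for d using dir[OF that] by simp
    show "volterra_eq k g p \<phi> (p + of_real t * d)" if "d \<in> D" "0 \<le> t" for d t using eq that .
    show "m \<le> norm (exp (p + of_real t * d) - 1)" if "d \<in> D" "\<epsilon> \<le> t" for d t
    proof -
      have "m * 1 \<le> m * exp (\<mu> * t)" using m that pos by (intro mult_left_mono) auto
      with lower[OF that] show ?thesis by simp
    qed
    fix d s t assume d: "d \<in> D" and t: "\<epsilon> \<le> t" "0 \<le> s" "s \<le> t"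
    let ?w = "p + of_real s * d" and ?z = "p + of_real t * d"
    have nd: "norm d = 1" using dir[OF d] by simp
    have "?z - ?w = of_real (t - s) * d" by (simp add: algebra_simps)
    hence zw: "norm (?z - ?w) = t - s" using nd t by (simp only: norm_mult norm_of_real) simp
    have w: "norm ?w \<le> norm p + s"
      using norm_triangle_ineq[of p "of_real s * d"] nd t by (simp add: norm_mult)
    have "norm (k ?z ?w * ?w) \<le> (C * exp (\<eta> * norm ?w + R * (t - s))) * (1 / \<eta> * exp (\<eta> * norm ?w))"
      unfolding norm_mult using CR(1) CR(3)[of ?z ?w] zw \<eta> by (intro mult_mono le_exp_scaled) auto
    also have "\<dots> = (C * (1 / \<eta>)) * exp (\<mu> * norm ?w + R * (t - s))"
      by (simp add: \<eta>_def exp_add[symmetric] algebra_simps)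
    also have "\<dots> \<le> (C * (1 / \<eta>)) * exp (\<mu> * (norm p + t) + R * (t - s))"
    proof -
      have "\<mu> * norm ?w \<le> \<mu> * (norm p + t)"
        using w t pos by (intro mult_left_mono) auto
      thus ?thesis using CR(1) \<eta> by (intro mult_left_mono) auto
    qed
    also have "(C * (1 / \<eta>)) * exp (\<mu> * (norm p + t) + R * (t - s)) = M * exp (R * (t - s)) * (m *
        exp (\<mu> * t))"
      using m by (simp add: M_def distrib_left exp_add)
    also have "\<dots> \<le> M * exp (R * (t - s)) * norm (exp ?z - 1)"
      using M by (intro mult_left_mono lower d t) auto
    finally show "norm (k ?z ?w * ?w) \<le> M * exp (R * (t - s)) * norm (exp ?z - 1)"
      .
  qed
qed

text \<open>Now \<open>exp z - 1\<close> is bounded below only by a constant, and the compensation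
  comes from \<open>exp (Re w) \<le> exp (- \<mu> * s)\<close>. With \<eta> half of \<mu>, the
  growth in \<open>z\<close> and the factor \<open>w\<close> contribute
  \<open>\<eta> * (t + s)\<close> up to a constant; subtracting \<open>\<mu> * s\<close> leaves
  \<open>\<eta> * (t - s)\<close>, which merely raises the rate to
  \<open>R + \<eta>\<close>.\<close>

lemma volterra_growth_left:
  assumes k: "entire_kernel k" and g: "exp_type g" and pos: "\<epsilon> > 0" "\<mu> > 0"
    and S: "cball p \<epsilon> \<subseteq> S" and \<phi>: "continuous_on S \<phi>" and p: "Re p = 0"
    and ray: "\<And>d t. d \<in> D \<Longrightarrow> 0 \<le> t \<Longrightarrow> p + of_real t * d \<in> S"
    and dir: "\<And>d. d \<in> D \<Longrightarrow> norm d = 1 \<and> Re d \<le> - \<mu>"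
    and eq: "\<And>d t. d \<in> D \<Longrightarrow> 0 \<le> t \<Longrightarrow> volterra_eq k g p \<phi> (p + of_real t * d)"
    and kb: "\<And>\<eta>. \<eta> > 0 \<Longrightarrow> \<exists>C>0. \<exists>R>0. \<forall>z w. norm (k z w) \<le> C * exp (\<eta> * norm z + R * norm (z - w) +
        Re w)"
  shows "\<exists>C0 R0. C0 > 0 \<and> R0 > 0 \<and> (\<forall>d\<in>D. \<forall>t\<ge>0. norm (\<phi> (p + of_real t * d)) \<le> C0 * exp (R0 * t))"
proof -
  define \<eta> where "\<eta> = \<mu> / 2"
  have \<eta>: "\<eta> > 0" using pos by (simp add: \<eta>_def)
  obtain C R where CR: "C > 0" "R > 0" "\<And>z w. norm (k z w) \<le> C * exp (\<eta> * norm z + R * norm (z - w)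
      + Re w)"
    using kb[OF \<eta>] by metis
  define m where "m = 1 - exp (- \<mu> * \<epsilon>)"
  have m: "m > 0" using pos by (simp add: m_def)
  have lower: "m \<le> norm (exp (p + of_real t * d) - 1)" if "d \<in> D" "\<epsilon> \<le> t" for d t
  proof -
    have "t * Re d \<le> t * (- \<mu>)" using dir[OF that(1)] that(2) pos by (intro mult_left_mono) auto
    also have "\<dots> \<le> - \<mu> * \<epsilon>" using that(2) pos by (simp add: mult.commute)
    finally have "norm (exp (p + of_real t * d)) \<le> exp (- \<mu> * \<epsilon>)" by (simp add: p)
    moreover have "1 - norm (exp (p + of_real t * d)) \<le> norm (exp (p + of_real t * d) - 1)"
      using norm_triangle_ineq2[of 1 "exp (p + of_real t * d)"] by (simp only: norm_one
          norm_minus_commute)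
    ultimately show ?thesis unfolding m_def by linarith
  qed
  define M where "M = C * (1 / \<eta>) * exp (\<mu> * norm p) / m"
  have M: "M > 0" using CR(1) \<eta> m by (simp add: M_def)
  have R\<eta>: "R + \<eta> > 0" using CR \<eta> by simp
  show ?thesis
  proof (rule volterra_ray_growth[OF k g pos(1) m M R\<eta> S \<phi> ray])
    show "norm d = 1" if "d \<in> D" for d using dir[OF that] by simp
    show "volterra_eq k g p \<phi> (p + of_real t * d)" if "d \<in> D" "0 \<le> t" for d t using eq that .
    show "m \<le> norm (exp (p + of_real t * d) - 1)" if "d \<in> D" "\<epsilon> \<le> t" for d t
      using lower[OF that] .
    fix d s t assume d: "d \<in> D" and t: "\<epsilon> \<le> t" "0 \<le> s" "s \<le> t"
    let ?w = "p + of_real s * d" and ?z = "p + of_real t * d"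
    have nd: "norm d = 1" using dir[OF d] by simp
    have "?z - ?w = of_real (t - s) * d" by (simp add: algebra_simps)
    hence zw: "norm (?z - ?w) = t - s" using nd t by (simp only: norm_mult norm_of_real) simp
    have w: "norm ?w \<le> norm p + s"
      using norm_triangle_ineq[of p "of_real s * d"] nd t by (simp add: norm_mult)
    have z: "norm ?z \<le> norm p + t"
      using norm_triangle_ineq[of p "of_real t * d"] nd t pos by (simp add: norm_mult)
    have "s * Re d \<le> s * (- \<mu>)" using dir[OF d] t pos by (intro mult_left_mono) auto
    hence rw: "Re ?w \<le> - \<mu> * s" by (simp add: p mult.commute)
    have "norm (k ?z ?w * ?w) \<le> (C * exp (\<eta> * norm ?z + R * (t - s) + Re ?w)) * (1 / \<eta> * exp (\<eta> *
        norm ?w))"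
      unfolding norm_mult using CR(1) CR(3)[of ?z ?w] zw \<eta> by (intro mult_mono le_exp_scaled) auto
    also have "\<dots> = (C * (1 / \<eta>)) * exp (\<eta> * norm ?z + R * (t - s) + Re ?w + \<eta> * norm ?w)"
      by (simp add: exp_add)
    also have "\<dots> \<le> (C * (1 / \<eta>)) * exp (\<mu> * norm p + (R + \<eta>) * (t - s))"
    proof -
      have "\<eta> * norm ?z \<le> \<eta> * (norm p + t)" "\<eta> * norm ?w \<le> \<eta> * (norm p + s)"
        using w z \<eta> by (auto intro!: mult_left_mono)
      moreover have "\<eta> * (norm p + t) + R * (t - s) + (- \<mu> * s) + \<eta> * (norm p + s) = \<mu> * norm p + (R
          + \<eta>) * (t - s)"
        by (simp add: \<eta>_def field_simps)
      ultimately have "\<eta> * norm ?z + R * (t - s) + Re ?w + \<eta> * norm ?w \<le> \<mu> * norm p + (R + \<eta>) * (t -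
          s)"
        using rw by linarith
      thus ?thesis using CR(1) \<eta> by (intro mult_left_mono) auto
    qed
    also have "(C * (1 / \<eta>)) * exp (\<mu> * norm p + (R + \<eta>) * (t - s)) = M * exp ((R + \<eta>) * (t - s)) *
        m"
      using m by (simp add: M_def exp_add)
    also have "\<dots> \<le> M * exp ((R + \<eta>) * (t - s)) * norm (exp ?z - 1)"
      using M by (intro mult_left_mono lower d t) auto
    finally show "norm (k ?z ?w * ?w) \<le> M * exp ((R + \<eta>) * (t - s)) * norm (exp ?z - 1)"
      .
  qed
qed

subsection \<open>Formal shifts and Lagrange's inversion\<close>

text \<open>Each derivative raises the order in \<open>X\<close> by one, so the terms with
  \<open>k > n\<close> do not reach the coefficient of \<open>X ^ n\<close>.\<close>

lemma fps_nth_comp_shift: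
  "fps_nth (comp_shift \<phi> g) n = (\<Sum>k\<le>n. fps_nth (fps_const (1 / fact k) * g ^ k * (ddz ^^ k) \<phi>) n)"
proof -
  define t where "t k = fps_const (1 / fact k) * g ^ k * (ddz ^^ k) \<phi>" for k
  have t0: "fps_nth (t k) n = 0" if "n < k" for n k
    using that by (auto simp: t_def fps_mult_nth[of "_ * _"] fps_nth_ddz_funpow_eq_0 intro!:
        sum.neutral)
  have "(\<lambda>m. \<Sum>k<m. t k) \<longlonglongrightarrow> Abs_fps (\<lambda>n. \<Sum>k\<le>n. fps_nth (t k) n)"
  proof (rule tendsto_fpsI)
    fix n
    have "fps_nth (\<Sum>k<m. t k) n = (\<Sum>k\<le>n. fps_nth (t k) n)" if "m > n" for m
      unfolding fps_sum_nth
      by (rule sum.mono_neutral_right) (use that in \<open>auto intro!: t0\<close>)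
    thus "\<forall>\<^sub>F m in sequentially.
            fps_nth (\<Sum>k<m. t k) n = fps_nth (Abs_fps (\<lambda>n. \<Sum>k\<le>n. fps_nth (t k) n)) n"
      by (intro eventually_mono[OF eventually_gt_at_top[of n]]) simp
  qed
  hence "comp_shift \<phi> g = Abs_fps (\<lambda>n. \<Sum>k\<le>n. fps_nth (t k) n)"
    unfolding comp_shift_def t_def[symmetric] by (intro sums_unique[symmetric]) (simp add: sums_def)
  thus ?thesis by (simp add: t_def)
qed

lemma fps_nth_ddz: "fps_nth (ddz f) n = - of_nat (n - 1) * fps_nth f (n - 1)"
proof -
  consider "n = 0" | "n = 1" | m where "n = m + 2"
    by (metis One_nat_def Suc_1 add_2_eq_Suc' not0_implies_Suc)
  thus ?thesis
    by cases (auto simp: ddz_def fps_X_power_mult_nth distrib_right left_diff_distrib)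
qed

lemma fps_nth_ddz_funpow:
  "fps_nth ((ddz ^^ k) f) (Suc j + k) = (- 1) ^ k * fact (j + k) / fact j * fps_nth f (Suc j)"
proof (induction k)
  case (Suc k)
  have "fps_nth ((ddz ^^ Suc k) f) (Suc j + Suc k) = - of_nat (Suc j + k) * fps_nth ((ddz ^^ k) f)
      (Suc j + k)"
    by (simp add: fps_nth_ddz)
  also have "\<dots> = (- 1) ^ Suc k * fact (j + Suc k) / fact j * fps_nth f (Suc j)"
    unfolding Suc by (simp add: field_simps)
  finally show ?case .
qed simp

lemma ddz_add: "ddz (f + g) = ddz f + ddz g"
  by (simp add: ddz_def algebra_simps)

lemma ddz_diff: "ddz (f - g) = ddz f - ddz g"
  by (simp add: ddz_def algebra_simps)

lemma ddz_mult: "ddz (f * g) = ddz f * g + f * ddz g"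
  by (simp add: ddz_def algebra_simps)

lemma ddz_cmult: "ddz (fps_const c * f) = fps_const c * ddz f"
  by (simp add: ddz_def algebra_simps)

lemma ddz_power_Suc: "ddz (f ^ Suc n) = fps_const (of_nat (Suc n)) * f ^ n * ddz f"
  by (simp add: ddz_def fps_deriv_power del: power_Suc)

lemma ddz_funpow_add: "(ddz ^^ k) (f + g) = (ddz ^^ k) f + (ddz ^^ k) g"
  by (induction k) (simp_all add: ddz_add)

lemma ddz_funpow_diff: "(ddz ^^ k) (f - g) = (ddz ^^ k) f - (ddz ^^ k) g"
  by (induction k) (simp_all add: ddz_diff)

lemma ddz_funpow_cmult: "(ddz ^^ k) (fps_const c * f) = fps_const c * (ddz ^^ k) f"
  by (induction k) (simp_all add: ddz_cmult)

section \<open>Orders of formal series and uniqueness of the formal solution\<close>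

definition ord_ge :: "nat \<Rightarrow> 'a :: zero fps \<Rightarrow> bool" where
  "ord_ge s f \<longleftrightarrow> (\<forall>i<s. fps_nth f i = 0)"

lemma ord_ge_mult:
  fixes f g :: "'a :: semiring_0 fps"
  assumes "ord_ge s f" "ord_ge t g"
  shows "ord_ge (s + t) (f * g)"
  unfolding ord_ge_def
proof (intro allI impI)
  fix n assume n: "n < s + t"
  have "fps_nth f i * fps_nth g (n - i) = 0" if "i \<le> n" for i
    using assms n that unfolding ord_ge_def by (cases "i < s") auto
  thus "fps_nth (f * g) n = 0"
    unfolding fps_mult_nth by (intro sum.neutral) auto
qed

lemma ord_ge_0 [simp]: "ord_ge 0 f"
  by (simp add: ord_ge_def)

lemma ord_ge_ddz: "ord_ge s f \<Longrightarrow> ord_ge (Suc s) (ddz f)"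
  unfolding ord_ge_def
proof (intro allI impI)
  fix i assume *: "\<forall>i<s. fps_nth f i = 0" "i < Suc s"
  show "fps_nth (ddz f) i = 0"
    by (cases i) (use * in \<open>auto simp: fps_nth_ddz\<close>)
qed

lemma ord_ge_ddz_funpow: "ord_ge s f \<Longrightarrow> ord_ge (s + k) ((ddz ^^ k) f)"
  by (induction k) (auto dest: ord_ge_ddz)

lemma ord_ge_shift_term:
  assumes "ord_ge s \<phi>"
  shows "ord_ge (s + k) (fps_const (1 / fact k) * g ^ k * (ddz ^^ k) \<phi>)"
  using ord_ge_mult[OF ord_ge_0 ord_ge_ddz_funpow[OF assms, of k]] by simp

lemma comp_shift_diff: "comp_shift (f - f') g = comp_shift f g - comp_shift f' g"
  by (rule fps_ext) (simp add: fps_nth_comp_shift ddz_funpow_diff algebra_simps sum_subtractf)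

text \<open>Let \<open>s \<ge> 1\<close> be the order of \<open>d\<close> and compare the
  coefficients of \<open>X ^ Suc s\<close>. The shift by - 1 contributes \<open>s\<close> times the
  leading coefficient of \<open>d\<close>, whereas \<open>g * ddz d\<close> already has order at
  least \<open>s + 2\<close>.\<close>

lemma comp_shift_homogeneous_unique:
  assumes d: "fps_nth d 0 = 0" and g: "fps_nth g 0 = 0" and eq: "comp_shift d (- 1) = comp_shift d
      g"
  shows "d = 0"
proof (rule ccontr)
  assume "d \<noteq> 0"
  define s where "s = subdegree d"
  have ds: "fps_nth d s \<noteq> 0" unfolding s_def by (rule nth_subdegree_nonzero[OF \<open>d \<noteq> 0\<close>])
  hence "s \<ge> 1" using d by (cases s) auto
  have ord: "ord_ge s d" unfolding ord_ge_def s_def by (intro allI impI nth_less_subdegree_zero)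
  have split: "fps_nth (comp_shift d h) (Suc s) = fps_nth d (Suc s) + fps_nth (h * ddz d) (Suc s)"
      for h
  proof -
    have "(\<Sum>k\<le>Suc s. fps_nth (fps_const (1 / fact k) * h ^ k * (ddz ^^ k) d) (Suc s)) =
          (\<Sum>k\<in>{0, 1}. fps_nth (fps_const (1 / fact k) * h ^ k * (ddz ^^ k) d) (Suc s))"
    proof (rule sum.mono_neutral_right)
      show "\<forall>k\<in>{..Suc s} - {0, 1}. fps_nth (fps_const (1 / fact k) * h ^ k * (ddz ^^ k) d) (Suc s) =
          0"
      proof
        fix k assume "k \<in> {..Suc s} - {0, 1}"
        hence "Suc s < s + k" by auto
        thus "fps_nth (fps_const (1 / fact k) * h ^ k * (ddz ^^ k) d) (Suc s) = 0"
          using ord_ge_shift_term[OF ord] unfolding ord_ge_def by blast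
      qed
    qed auto
    thus ?thesis by (simp add: fps_nth_comp_shift)
  qed
  have "ord_ge 1 g" using g by (simp add: ord_ge_def)
  from ord_ge_mult[OF this ord_ge_ddz[OF ord]] have "fps_nth (g * ddz d) (Suc s) = 0"
    by (simp add: ord_ge_def)
  with eq split[of g] split[of "- 1"] have "fps_nth (ddz d) (Suc s) = 0"
    by simp
  thus False using \<open>s \<ge> 1\<close> ds by (simp add: fps_nth_ddz)
qed

text \<open>
  Lagrange's formula for the inverse of \<open>\<psi> \<mapsto> \<psi> \<circ> (id + b)\<close>:
  \<open>\<psi> + (\<Sum>k\<ge>1. (-1)\<^sup>k / k! (d/dz)\<^sup>k\<^sup>-\<^sup>1 (b\<^sup>k \<psi>'))\<close>.
\<close>

fun lagrange_term :: "complex fps \<Rightarrow> nat \<Rightarrow> complex fps \<Rightarrow> complex fps" where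
  "lagrange_term b 0 \<psi> = \<psi>"
| "lagrange_term b (Suc k) \<psi> = fps_const ((- 1) ^ Suc k / fact (Suc k)) * (ddz ^^ k) (b ^ Suc k *
    ddz \<psi>)"

definition lagrange_inverse :: "complex fps \<Rightarrow> complex fps \<Rightarrow> complex fps" where
  "lagrange_inverse b \<psi> = Abs_fps (\<lambda>n. \<Sum>k\<le>n. fps_nth (lagrange_term b k \<psi>) n)"

lemma lagrange_term_add: "lagrange_term b k (f + g) = lagrange_term b k f + lagrange_term b k g"
  by (cases k) (simp_all add: ddz_add ddz_funpow_add algebra_simps)

lemma lagrange_term_diff: "lagrange_term b k (f - g) = lagrange_term b k f - lagrange_term b k g"
  by (cases k) (simp_all add: ddz_diff ddz_funpow_diff algebra_simps)

lemma lagrange_term_0: "lagrange_term b k 0 = 0"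
  using lagrange_term_diff[of b k 0 0] by simp

lemma lagrange_term_sum: "lagrange_term b k (\<Sum>i\<in>A. f i) = (\<Sum>i\<in>A. lagrange_term b k (f i))"
  by (induction A rule: infinite_finite_induct) (simp_all add: lagrange_term_add lagrange_term_0)

lemma lagrange_term_cmult: "lagrange_term b k (fps_const c * f) = fps_const c * lagrange_term b k f"
proof (cases k)
  case (Suc n)
  have "b ^ Suc n * ddz (fps_const c * f) = fps_const c * (b ^ Suc n * ddz f)"
    unfolding ddz_cmult by (rule mult.left_commute)
  hence "lagrange_term b (Suc n) (fps_const c * f) = fps_const c * lagrange_term b (Suc n) f"
    by (simp only: lagrange_term.simps ddz_funpow_cmult mult.left_commute[of _ "fps_const c"])
  thus ?thesis by (simp only: Suc)
qed simp

lemma ord_ge_lagrange_term: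
  assumes "ord_ge s \<psi>"
  shows "ord_ge (s + k) (lagrange_term b k \<psi>)"
proof (cases k)
  case (Suc n)
  have "ord_ge (Suc s) (b ^ Suc n * ddz \<psi>)"
    using ord_ge_mult[OF ord_ge_0 ord_ge_ddz[OF assms]] by simp
  from ord_ge_mult[OF ord_ge_0 ord_ge_ddz_funpow[OF this, of n]] show ?thesis
    by (simp add: Suc del: power_Suc)
qed (use assms in auto)

lemma lagrange_inverse_diff: "lagrange_inverse b (f - g) = lagrange_inverse b f - lagrange_inverse b
    g"
  by (rule fps_ext) (simp add: lagrange_inverse_def lagrange_term_diff sum_subtractf)

text \<open>
  The coefficient of \<open>s\<^sup>m\<close> in Lagrange's formula for \<open>id + s b\<close>, applied to
  \<open>u = \<phi> \<circ> (id + s b)\<close>, vanishes: differentiate in \<open>s\<close> and use \<open>(1 + s b') \<partial>\<^sub>s u = b \<partial>\<^sub>z u\<close>.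
\<close>

lemma of_nat_Suc_mult_div_fact:
  "of_nat (Suc n) * (x / fact (Suc n)) = (x / fact n :: 'a :: field_char_0)"
  by (simp only: fact_Suc) (simp del: of_nat_Suc)

lemma lagrange_shift_convolution:
  assumes "m > 0"
  shows "(\<Sum>k\<le>m. lagrange_term b k (fps_const (1 / fact (m - k)) * b ^ (m - k) * (ddz ^^ (m - k)) \<phi>))
      = 0"
proof -
  obtain M where M: "m = Suc M" using assms by (cases m) auto
  \<comment> \<open>\<open>C j\<close> and \<open>v j\<close> are the coefficients of
    \<open>s ^ j\<close> in \<open>u\<close> and in its derivative in \<open>s\<close>;
    \<open>ddz_C\<close> is the relation
    \<open>(1 + s b') \<partial>\<^sub>s u = b \<partial>\<^sub>z u\<close> between them.\<close>
  define C where "C j = fps_const (1 / fact j) * b ^ j * (ddz ^^ j) \<phi>" for j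
  define v where "v j = fps_const (1 / fact j) * b ^ Suc j * (ddz ^^ Suc j) \<phi>" for j
  \<comment> \<open>Replacing \<open>b ^ k * ddz w\<close> by \<open>ddz (b ^ k * w)\<close> minus
    \<open>ddz (b ^ k) * w\<close> splits \<open>lagrange_term b k w\<close> into
    \<open>A k w - D k w\<close>.\<close>
  define A where "A k w = fps_const ((- 1) ^ k / fact k) * (ddz ^^ k) (b ^ k * w)" for k w
  define D where "D k w = (case k of 0 \<Rightarrow> 0 | Suc n \<Rightarrow> fps_const ((- 1) ^ Suc n / fact n) * (ddz ^^ n)
      (b ^ n * (ddz b * w)))" for k w
  have v_C: "fps_const (of_nat (Suc j)) * C (Suc j) = v j" for j
  proof -
    have "of_nat (Suc j) * (1 / fact (Suc j)) = (1 / fact j :: complex)"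
      by (rule of_nat_Suc_mult_div_fact)
    thus ?thesis
      by (simp only: C_def v_def mult.assoc[symmetric] fps_const_mult)
  qed
  have ddz_C: "b * ddz (C j) = v j + (case j of 0 \<Rightarrow> 0 | Suc i \<Rightarrow> ddz b * v i)" for j
  proof (cases j)
    case (Suc i)
    have "ddz (C j) = fps_const (1 / fact j) * (ddz (b ^ Suc i) * (ddz ^^ Suc i) \<phi> + b ^ Suc i *
        (ddz ^^ Suc j) \<phi>)"
      unfolding C_def Suc mult.assoc ddz_cmult ddz_mult[of "b ^ Suc i"] by simp
    also have "\<dots> = fps_const (1 / fact j) * b ^ Suc i * (ddz ^^ Suc j) \<phi> + fps_const (1 / fact j *
        of_nat (Suc i)) * (b ^ i * ddz b * (ddz ^^ Suc i) \<phi>)"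
      unfolding ddz_power_Suc fps_const_mult[symmetric] by (simp add: algebra_simps del:
          fps_const_mult power_Suc of_nat_Suc)
    also have "1 / fact j * of_nat (Suc i) = (1 / fact i :: complex)"
      unfolding Suc using of_nat_Suc_mult_div_fact[of i 1] by (simp only: mult.commute)
    finally show ?thesis
      by (simp add: Suc v_def algebra_simps)
  qed (simp add: C_def v_def)
  have k_L: "fps_const (of_nat (Suc k)) * lagrange_term b (Suc k) (C j) =
              - A k (v j) + (case j of 0 \<Rightarrow> 0 | Suc i \<Rightarrow> D (Suc k) (v i))" for k j
  proof -
    have "of_nat (Suc k) * ((- 1) ^ Suc k / fact (Suc k)) = (- ((- 1) ^ k / fact k) :: complex)"
      unfolding of_nat_Suc_mult_div_fact by simp
    hence "fps_const (of_nat (Suc k)) * lagrange_term b (Suc k) (C j) = fps_const (- ((- 1) ^ k /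
        fact k)) * (ddz ^^ k) (b ^ k * (b * ddz (C j)))"
      by (simp only: lagrange_term.simps mult.assoc[symmetric] fps_const_mult power_Suc2)
    also have "b ^ k * (b * ddz (C j)) = b ^ k * v j + (case j of 0 \<Rightarrow> 0 | Suc i \<Rightarrow> b ^ k * (ddz b * v
        i))"
      unfolding ddz_C by (simp add: algebra_simps split: nat.split)
    also have "fps_const (- ((- 1) ^ k / fact k)) * (ddz ^^ k) (b ^ k * v j + (case j of 0 \<Rightarrow> 0 | Suc
        i \<Rightarrow> b ^ k * (ddz b * v i))) =
       - A k (v j) + (case j of 0 \<Rightarrow> 0 | Suc i \<Rightarrow> D (Suc k) (v i))"
      by (cases j) (simp_all add: A_def D_def ddz_funpow_add algebra_simps flip: fps_const_neg)
    finally show ?thesis .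
  qed
  have j_L: "fps_const (of_nat (Suc j)) * lagrange_term b k (C (Suc j)) = A k (v j) - D k (v j)" for
      k j
  proof -
    have "fps_const (of_nat (Suc j)) * lagrange_term b k (C (Suc j)) = lagrange_term b k (v j)"
      by (simp only: v_C flip: lagrange_term_cmult)
    also have "lagrange_term b k (v j) = A k (v j) - D k (v j)"
    proof (cases k)
      case (Suc n)
      have "b ^ Suc n * ddz (v j) = ddz (b ^ Suc n * v j) - fps_const (of_nat (Suc n)) * (b ^ n *
          (ddz b * v j))"
        unfolding ddz_mult ddz_power_Suc by (simp add: algebra_simps)
      hence "lagrange_term b k (v j) = fps_const ((- 1) ^ Suc n / fact (Suc n)) * (ddz ^^ n) (ddz (b
          ^ Suc n * v j))
           - fps_const ((- 1) ^ Suc n / fact (Suc n)) * (fps_const (of_nat (Suc n)) * (ddz ^^ n) (b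
               ^ n * (ddz b * v j)))"
        by (simp only: Suc lagrange_term.simps ddz_funpow_diff ddz_funpow_cmult right_diff_distrib)
      also have "fps_const ((- 1) ^ Suc n / fact (Suc n)) * (fps_const (of_nat (Suc n)) * (ddz ^^ n)
          (b ^ n * (ddz b * v j))) =
                 fps_const ((- 1) ^ Suc n / fact (Suc n) * of_nat (Suc n)) * (ddz ^^ n) (b ^ n *
                     (ddz b * v j))"
        by (simp only: mult.assoc[symmetric] fps_const_mult)
      also have "(- 1) ^ Suc n / fact (Suc n) * of_nat (Suc n) = ((- 1) ^ Suc n / fact n ::
          complex)"
        using of_nat_Suc_mult_div_fact[of n "(- 1) ^ Suc n"] by (simp only: mult.commute)
      finally show ?thesis
        by (simp only: Suc A_def D_def funpow_swap1 funpow.simps o_apply nat.case)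
    qed (simp add: A_def D_def)
    finally show ?thesis .
  qed
  define S where "S = (\<Sum>k\<le>m. lagrange_term b k (C (m - k)))"
  \<comment> \<open>Multiplication by \<open>m = k + (m - k)\<close> is differentiation in
    \<open>s\<close>: the first sum differentiates Lagrange's formula and the second its argument.
    Written in terms of \<open>A\<close> and \<open>D\<close>, the two cancel.\<close>
  have "fps_const (of_nat m) * S =
        (\<Sum>k\<le>m. fps_const (of_nat k) * lagrange_term b k (C (m - k))) +
        (\<Sum>k\<le>m. fps_const (of_nat (m - k)) * lagrange_term b k (C (m - k)))"
    unfolding S_def sum_distrib_left sum.distrib[symmetric]
    by (intro sum.cong refl) (simp add: of_nat_diff flip: distrib_right fps_const_add)
  also have "(\<Sum>k\<le>m. fps_const (of_nat k) * lagrange_term b k (C (m - k))) =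
             (\<Sum>k\<le>M. - A k (v (M - k)) + (case M - k of 0 \<Rightarrow> 0 | Suc i \<Rightarrow> D (Suc k) (v i)))"
    unfolding M sum.atMost_Suc_shift by (simp add: k_L del: of_nat_Suc lagrange_term.simps(2))
  also have "(\<Sum>k\<le>m. fps_const (of_nat (m - k)) * lagrange_term b k (C (m - k))) =
             (\<Sum>k\<le>M. A k (v (M - k)) - D k (v (M - k)))"
    unfolding M sum.atMost_Suc
    by (simp add: Suc_diff_le j_L del: of_nat_Suc lagrange_term.simps(2))
  also have "(\<Sum>k\<le>M. - A k (v (M - k)) + (case M - k of 0 \<Rightarrow> 0 | Suc i \<Rightarrow> D (Suc k) (v i))) + (\<Sum>k\<le>M. A
      k (v (M - k)) - D k (v (M - k))) =
      (\<Sum>k\<le>M. case M - k of 0 \<Rightarrow> 0 | Suc i \<Rightarrow> D (Suc k) (v i)) - (\<Sum>k\<le>M. D k (v (M - k)))"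
    by (simp add: sum.distrib sum_subtractf sum_negf)
  also have "(\<Sum>k\<le>M. case M - k of 0 \<Rightarrow> 0 | Suc i \<Rightarrow> D (Suc k) (v i)) = (\<Sum>k<M. D (Suc k) (v (M - Suc
      k)))"
  proof (rule sum.mono_neutral_cong_right)
    fix k assume "k \<in> {..<M}"
    hence "M - k = Suc (M - Suc k)" by auto
    thus "(case M - k of 0 \<Rightarrow> 0 | Suc i \<Rightarrow> D (Suc k) (v i)) = D (Suc k) (v (M - Suc k))" by simp
  qed auto
  also have "(\<Sum>k\<le>M. D k (v (M - k))) = (\<Sum>k<M. D (Suc k) (v (M - Suc k)))"
  proof -
    have "(\<Sum>k\<le>M. D k (v (M - k))) = D 0 (v M) + (\<Sum>k<M. D (Suc k) (v (M - Suc k)))"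
      by (simp add: lessThan_Suc_atMost[symmetric] sum.lessThan_Suc_shift del: sum.lessThan_Suc)
    moreover have "D 0 (v M) = 0" by (simp add: D_def)
    ultimately show ?thesis by simp
  qed
  finally have "fps_const (of_nat m) * S = 0" by simp
  moreover have "fps_const (of_nat m :: complex) \<noteq> 0" using assms by simp
  ultimately have "S = 0" by simp
  thus ?thesis by (simp add: S_def C_def)
qed

text \<open>By orders, a given coefficient involves only finitely many terms of the double
  expansion. Grouped by the total power \<open>m = k + j\<close> of \<open>b\<close>, all groups
  with \<open>m > 0\<close> vanish by \<open>lagrange_shift_convolution\<close>. This left-inverse
  property isolates \<phi> in the functional equation.\<close>

lemma lagrange_inverse_comp_shift: "lagrange_inverse b (comp_shift \<phi> b) = \<phi>"
proof (rule fps_ext)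
  fix n
  define C where "C j = fps_const (1 / fact j) * b ^ j * (ddz ^^ j) \<phi>" for j
  have ordC: "ord_ge j (C j)" for j using ord_ge_shift_term[OF ord_ge_0, of j b \<phi>] by (simp add:
      C_def)
  have ordL: "fps_nth (lagrange_term b k (C j)) n = 0" if "n < k + j" for k j
    using ord_ge_lagrange_term[OF ordC, of j k b] that by (auto simp: ord_ge_def add.commute)
  have L: "fps_nth (lagrange_term b k (comp_shift \<phi> b)) n = (\<Sum>j\<le>n. fps_nth (lagrange_term b k (C j))
      n)" for k
  proof -
    have "ord_ge (Suc n) (comp_shift \<phi> b - (\<Sum>j\<le>n. C j))"
      unfolding ord_ge_def
    proof (intro allI impI)
      fix i assume "i < Suc n"
      have "(\<Sum>j\<le>n. fps_nth (C j) i) = (\<Sum>j\<le>i. fps_nth (C j) i)"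
        by (rule sum.mono_neutral_right) (use \<open>i < Suc n\<close> ordC in \<open>auto simp: ord_ge_def\<close>)
      thus "fps_nth (comp_shift \<phi> b - (\<Sum>j\<le>n. C j)) i = 0"
        by (simp add: fps_nth_comp_shift C_def fps_sum_nth)
    qed
    from ord_ge_lagrange_term[OF this, of k b]
    have "fps_nth (lagrange_term b k (comp_shift \<phi> b - (\<Sum>j\<le>n. C j))) n = 0"
      by (auto simp: ord_ge_def)
    thus ?thesis by (simp add: lagrange_term_diff lagrange_term_sum fps_sum_nth)
  qed
  have "fps_nth (lagrange_inverse b (comp_shift \<phi> b)) n = (\<Sum>k\<le>n. \<Sum>j\<le>n. fps_nth (lagrange_term b k (C
      j)) n)"
    by (simp add: lagrange_inverse_def L)
  also have "\<dots> = (\<Sum>k\<le>n. \<Sum>j\<le>n - k. fps_nth (lagrange_term b k (C j)) n)"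
    by (intro sum.cong sum.mono_neutral_right refl) (auto intro!: ordL)
  also have "\<dots> = (\<Sum>m\<le>n. \<Sum>k\<le>m. fps_nth (lagrange_term b k (C (m - k))) n)"
    by (subst sum.triangle_reindex_eq[symmetric, of "\<lambda>k j. fps_nth (lagrange_term b k (C j)) n"])
       (simp add: sum.Sigma, rule sum.cong, auto)
  also have "\<dots> = (\<Sum>m\<le>n. if m = 0 then fps_nth \<phi> n else 0)"
  proof (intro sum.cong refl)
    fix m
    show "(\<Sum>k\<le>m. fps_nth (lagrange_term b k (C (m - k))) n) = (if m = 0 then fps_nth \<phi> n else 0)"
      using lagrange_shift_convolution[of m b \<phi>] by (auto simp: C_def simp flip: fps_sum_nth)
  qed
  finally show "fps_nth (lagrange_inverse b (comp_shift \<phi> b)) n = fps_nth \<phi> n" by simp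
qed

subsection \<open>The kernels\<close>

lemma fps_nth_norm_bound:
  fixes f :: "complex fps"
  assumes "fps_conv_radius f > 0"
  obtains C R where "C > 0" "R > 0" "\<And>n. norm (fps_nth f n) \<le> C * R ^ n"
proof -
  obtain r where r: "0 < ereal r" "ereal r < fps_conv_radius f"
    using ereal_dense2[OF assms] by (auto simp: zero_ereal_def)
  hence "r > 0" by simp
  have "summable (\<lambda>n. norm (fps_nth f n * complex_of_real r ^ n))"
    by (rule norm_summable_fps) (use r in simp)
  hence "(\<lambda>n. norm (fps_nth f n * complex_of_real r ^ n)) \<longlonglongrightarrow> 0" by (rule summable_LIMSEQ_zero)
  hence "Bseq (\<lambda>n. norm (fps_nth f n * complex_of_real r ^ n))" using convergent_imp_Bseq
      convergent_def by blast
  then obtain K where K: "K > 0" "\<And>n. norm (norm (fps_nth f n * complex_of_real r ^ n)) \<le> K" by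
      (rule BseqE) blast
  show thesis
  proof (rule that[of K "1 / r"])
    fix n
    have "norm (fps_nth f n) * r ^ n \<le> K"
      using K(2)[of n] \<open>r > 0\<close> by (simp add: norm_mult norm_power)
    thus "norm (fps_nth f n) \<le> K * (1 / r) ^ n"
      using \<open>r > 0\<close> by (simp add: field_simps power_divide)
  qed (use K \<open>r > 0\<close> in auto)
qed

lemma fps_conv_radius_pos_of_bound:
  fixes f :: "complex fps"
  assumes "R > 0" "\<And>n. norm (fps_nth f n) \<le> C * R ^ n"
  shows "fps_conv_radius f > 0"
proof -
  have "summable (\<lambda>n. fps_nth f n * complex_of_real (1 / (2 * R)) ^ n)"
  proof (rule summable_comparison_test'[of "\<lambda>n. C * (1 / 2) ^ n" 0])
    show "summable (\<lambda>n. C * (1 / 2 :: real) ^ n)" by (intro summable_mult summable_geometric) auto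
    fix n
    have "norm (fps_nth f n * complex_of_real (1 / (2 * R)) ^ n) = norm (fps_nth f n) * (1 / (2 *
        R)) ^ n"
      using assms(1) by (simp add: norm_mult norm_power norm_divide)
    also have "\<dots> \<le> (C * R ^ n) * (1 / (2 * R)) ^ n"
      using assms by (intro mult_right_mono) auto
    also have "\<dots> = C * (1 / 2) ^ n"
      using assms(1) by (simp add: power_divide power_mult_distrib)
    finally show "norm (fps_nth f n * complex_of_real (1 / (2 * R)) ^ n) \<le> C * (1 / 2) ^ n" .
  qed
  hence "fps_conv_radius f \<ge> ereal (norm (complex_of_real (1 / (2 * R))))"
    unfolding fps_conv_radius_def by (rule conv_radius_geI)
  moreover have "norm (complex_of_real (1 / (2 * R))) > 0" using assms(1) by simp
  ultimately show ?thesis by (metis ereal_less(2) less_le_trans)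
qed

text \<open>The point is that \<open>R\<close> does not depend on \<open>k\<close>. Doubling the
  rate \<open>R0\<close> leaves \<open>(1 / 2) ^ i\<close> in the Cauchy product; its sum is at most
  2, which is the doubling of \<open>C0\<close>.\<close>

lemma fps_power_nth_bound:
  fixes b :: "complex fps"
  assumes "fps_conv_radius b > 0"
  obtains C R where "C > 0" "R > 0" "\<And>k n. norm (fps_nth (b ^ k) n) \<le> C ^ k * R ^ n"
proof -
  obtain C0 R0 where CR: "C0 > 0" "R0 > 0" "\<And>n. norm (fps_nth b n) \<le> C0 * R0 ^ n"
    using fps_nth_norm_bound[OF assms] by metis
  define C where "C = 2 * C0"
  define R where "R = 2 * R0"
  have pos: "C > 0" "R > 0" using CR by (auto simp: C_def R_def)
  have "norm (fps_nth (b ^ k) n) \<le> C ^ k * R ^ n" for k n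
  proof (induction k arbitrary: n)
    case 0
    show ?case using pos by (cases n) auto
  next
    case (Suc k)
    have "norm (fps_nth (b ^ Suc k) n) \<le> (\<Sum>i=0..n. norm (fps_nth b i * fps_nth (b ^ k) (n - i)))"
      by (simp add: fps_mult_nth norm_sum)
    also have "\<dots> \<le> (\<Sum>i=0..n. C0 * C ^ k * R ^ n * (1 / 2) ^ i)"
    proof (rule sum_mono)
      fix i assume i: "i \<in> {0..n}"
      have "norm (fps_nth b i * fps_nth (b ^ k) (n - i)) \<le> (C0 * R0 ^ i) * (C ^ k * R ^ (n - i))"
        unfolding norm_mult using CR pos by (intro mult_mono Suc.IH) auto
      also have "R0 ^ i = R ^ i * (1 / 2) ^ i" by (simp add: R_def power_mult_distrib power_divide)
      also have "(C0 * (R ^ i * (1 / 2) ^ i)) * (C ^ k * R ^ (n - i)) = C0 * C ^ k * (R ^ i * R ^ (n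
          - i)) * (1 / 2) ^ i"
        by (simp only: mult_ac)
      also have "R ^ i * R ^ (n - i) = R ^ n" using i by (simp flip: power_add)
      finally show "norm (fps_nth b i * fps_nth (b ^ k) (n - i)) \<le> C0 * C ^ k * R ^ n * (1 / 2) ^ i"
          .
    qed
    also have "\<dots> = C0 * C ^ k * R ^ n * (\<Sum>i=0..n. (1 / 2) ^ i)"
      by (simp add: sum_distrib_left)
    also have "(\<Sum>i=0..n. (1 / 2 :: real) ^ i) \<le> 2"
      using sum_gp_basic[of "1 / 2 :: real" n] by (simp add: atLeast0AtMost)
    hence "C0 * C ^ k * R ^ n * (\<Sum>i=0..n. (1 / 2) ^ i) \<le> C0 * C ^ k * R ^ n * 2"
      using CR pos by (intro mult_left_mono) auto
    also have "\<dots> = C ^ Suc k * R ^ n" by (simp add: C_def)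
    finally show ?case .
  qed
  thus thesis using that pos by metis
qed

text \<open>Without a constant term, \<open>b ^ Suc k\<close> has order at least
  \<open>Suc k\<close>, so for such \<open>b\<close> the sum contains every \<open>k\<close> with a
  nonzero coefficient.\<close>

definition kernel_poly :: "complex fps \<Rightarrow> nat \<Rightarrow> complex \<Rightarrow> complex" where
  "kernel_poly b n x = (\<Sum>k\<le>n. x ^ k / fact (Suc k) * fps_nth (b ^ Suc k) (Suc n))"

text \<open>
  \<open>shift_kernel b x\<close> is the Borel transform of \<open>\<Sum>k\<ge>1. x\<^sup>k\<^sup>-\<^sup>1 b\<^sup>k / k!\<close>.
\<close>

definition shift_kernel :: "complex fps \<Rightarrow> complex \<Rightarrow> complex \<Rightarrow> complex" where
  "shift_kernel b x u = (\<Sum>n. kernel_poly b n x * u ^ n / fact n)"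

text \<open>Replacing \<open>C ^ k\<close> by \<open>\<eta> ^ k\<close> leaves
  \<open>(C / \<eta>) ^ k\<close>, which is at most \<open>L ^ n\<close> because
  \<open>k \<le> n\<close>, and so can be charged to the power of \<open>u\<close>. Hence the growth
  rate in \<open>x\<close> may be any positive \<eta>, at the price of \<open>R\<close>.\<close>

lemma kernel_term_bound:
  assumes b: "fps_conv_radius b > 0" and \<eta>: "\<eta> > 0"
  obtains C R where "C > 0" "R > 0"
    "\<And>n x u. norm (kernel_poly b n x * u ^ n / fact n) \<le> C * exp (\<eta> * norm x) * ((R * norm u) ^ n /
        fact n)"
proof -
  obtain C R where CR: "C > 0" "R > 0" "\<And>k n. norm (fps_nth (b ^ k) n) \<le> C ^ k * R ^ n"
    using fps_power_nth_bound[OF b] by metis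
  \<comment> \<open>The maximum with 1 makes the powers of \<open>L\<close> increasing, so that the
    exponent \<open>k\<close> can be raised to \<open>n\<close>.\<close>
  define L where "L = max 1 (C / \<eta>)"
  have L: "L \<ge> 1" "C / \<eta> \<le> L" by (auto simp: L_def)
  have P: "norm (kernel_poly b n x) \<le> C * R * (R * L) ^ n * exp (\<eta> * norm x)" for n x
  proof -
    have "norm (kernel_poly b n x) \<le> (\<Sum>k\<le>n. norm (x ^ k / fact (Suc k) * fps_nth (b ^ Suc k) (Suc
        n)))"
      unfolding kernel_poly_def by (rule norm_sum)
    also have "\<dots> \<le> (\<Sum>k\<le>n. C * R * (R * L) ^ n * ((\<eta> * norm x) ^ k / fact k))"
    proof (rule sum_mono)
      fix k assume "k \<in> {..n}"
      have "norm (x ^ k / fact (Suc k) * fps_nth (b ^ Suc k) (Suc n)) = norm x ^ k / fact (Suc k) *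
          norm (fps_nth (b ^ Suc k) (Suc n))"
        by (simp add: norm_mult norm_divide norm_power del: fact_Suc power_Suc)
      also have "\<dots> \<le> norm x ^ k / fact k * (C ^ Suc k * R ^ Suc n)"
      proof (rule mult_mono[OF _ CR(3)])
        show "norm x ^ k / fact (Suc k) \<le> norm x ^ k / fact k"
          by (intro divide_left_mono fact_mono) auto
      qed auto
      also have "\<dots> = C * R * R ^ n * ((\<eta> * norm x) ^ k / fact k) * (C / \<eta>) ^ k"
        using \<eta> by (simp add: power_mult_distrib power_divide field_simps)
      also have "(C / \<eta>) ^ k \<le> L ^ n"
      proof -
        have "(C / \<eta>) ^ k \<le> L ^ k" using L CR \<eta> by (intro power_mono) auto
        also have "\<dots> \<le> L ^ n" using L \<open>k \<in> {..n}\<close> by (intro power_increasing) auto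
        finally show ?thesis .
      qed
      hence "C * R * R ^ n * ((\<eta> * norm x) ^ k / fact k) * (C / \<eta>) ^ k \<le> C * R * R ^ n * ((\<eta> * norm
          x) ^ k / fact k) * L ^ n"
        using CR \<eta> by (intro mult_left_mono) auto
      also have "\<dots> = C * R * (R * L) ^ n * ((\<eta> * norm x) ^ k / fact k)"
        by (simp add: power_mult_distrib)
      finally show "norm (x ^ k / fact (Suc k) * fps_nth (b ^ Suc k) (Suc n)) \<le> C * R * (R * L) ^ n
          * ((\<eta> * norm x) ^ k / fact k)" .
    qed
    also have "\<dots> = C * R * (R * L) ^ n * (\<Sum>k\<le>n. (\<eta> * norm x) ^ k / fact k)"
      by (simp add: sum_distrib_left)
    also have "(\<Sum>k\<le>n. (\<eta> * norm x) ^ k / fact k) \<le> exp (\<eta> * norm x)"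
    proof -
      have "(\<Sum>k\<le>n. (\<eta> * norm x) ^ k / fact k) \<le> (\<Sum>k. (\<eta> * norm x) ^ k / fact k)"
        using summable_exp[of "\<eta> * norm x"] \<eta> by (intro sum_le_suminf) (auto simp: divide_inverse
            mult.commute)
      thus ?thesis by (simp add: exp_def divide_inverse mult.commute)
    qed
    hence "C * R * (R * L) ^ n * (\<Sum>k\<le>n. (\<eta> * norm x) ^ k / fact k) \<le> C * R * (R * L) ^ n * exp (\<eta> *
        norm x)"
      using CR L by (intro mult_left_mono) auto
    finally show ?thesis .
  qed
  show thesis
  proof (rule that[of "C * R" "R * L"])
    fix n x u
    have "norm (kernel_poly b n x * u ^ n / fact n) = norm (kernel_poly b n x) * (norm u ^ n / fact
        n)"
      by (simp add: norm_mult norm_divide norm_power)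
    also have "\<dots> \<le> (C * R * (R * L) ^ n * exp (\<eta> * norm x)) * (norm u ^ n / fact n)"
      by (intro mult_right_mono P) auto
    also have "\<dots> = C * R * exp (\<eta> * norm x) * ((R * L * norm u) ^ n / fact n)"
      by (simp add: power_mult_distrib)
    finally show "norm (kernel_poly b n x * u ^ n / fact n) \<le> C * R * exp (\<eta> * norm x) * ((R * L *
        norm u) ^ n / fact n)" .
  qed (use CR L in auto)
qed

lemma summable_exp_div: "summable (\<lambda>n. c * (x ^ n / fact n))" for x c :: real
  using summable_exp[of x] by (intro summable_mult) (simp add: divide_inverse mult.commute)

lemma shift_kernel_bound:
  assumes b: "fps_conv_radius b > 0" and \<eta>: "\<eta> > 0"
  shows "\<exists>C>0. \<exists>R>0. \<forall>x u. norm (shift_kernel b x u) \<le> C * exp (\<eta> * norm x + R * norm u)"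
proof -
  obtain C R where CR: "C > 0" "R > 0"
    "\<And>n x u. norm (kernel_poly b n x * u ^ n / fact n) \<le> C * exp (\<eta> * norm x) * ((R * norm u) ^ n /
        fact n)"
    using kernel_term_bound[OF b \<eta>] by metis
  have "norm (shift_kernel b x u) \<le> C * exp (\<eta> * norm x + R * norm u)" for x u
  proof -
    have "norm (shift_kernel b x u) \<le> (\<Sum>n. C * exp (\<eta> * norm x) * ((R * norm u) ^ n / fact n))"
      unfolding shift_kernel_def by (rule norm_suminf_le[OF CR(3) summable_exp_div])
    also have "\<dots> = C * exp (\<eta> * norm x) * exp (R * norm u)"
      using summable_exp[of "R * norm u"] by (subst suminf_mult) (simp_all add: exp_def
          divide_inverse mult.commute)
    finally show ?thesis by (simp add: exp_add)
  qed
  with CR(1,2) show ?thesis by blast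
qed

lemma shift_kernel_uniform_limit:
  assumes b: "fps_conv_radius b > 0" and bound: "\<And>z. z \<in> A \<Longrightarrow> norm (f z) \<le> r \<and> norm (g z) \<le> r"
  shows "uniform_limit A (\<lambda>N z. \<Sum>n<N. kernel_poly b n (f z) * g z ^ n / fact n) (\<lambda>z. shift_kernel b
      (f z) (g z)) sequentially"
proof -
  obtain C R where CR: "C > 0" "R > 0"
    "\<And>n x u. norm (kernel_poly b n x * u ^ n / fact n) \<le> C * exp (1 * norm x) * ((R * norm u) ^ n /
        fact n)"
    using kernel_term_bound[OF b zero_less_one] by metis
  show ?thesis
    unfolding shift_kernel_def
  proof (rule Weierstrass_m_test)
    show "summable (\<lambda>n. C * exp r * ((R * r) ^ n / fact n))" by (rule summable_exp_div)
    fix n z assume z: "z \<in> A"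
    have "norm (kernel_poly b n (f z) * g z ^ n / fact n) \<le> C * exp (1 * norm (f z)) * ((R * norm (g
        z)) ^ n / fact n)"
      by (rule CR(3))
    also have "\<dots> \<le> C * exp r * ((R * r) ^ n / fact n)"
      using bound[OF z] CR order_trans[OF norm_ge_zero, of "g z" r] by (intro mult_mono
          divide_right_mono power_mono) auto
    finally show "norm (kernel_poly b n (f z) * g z ^ n / fact n) \<le> C * exp r * ((R * r) ^ n / fact
        n)" .
  qed
qed

lemma holomorphic_shift_kernel:
  assumes b: "fps_conv_radius b > 0" and S: "open S" and f: "f holomorphic_on S" and g: "g
      holomorphic_on S"
  shows "(\<lambda>z. shift_kernel b (f z) (g z)) holomorphic_on S"
proof (rule holomorphic_uniform_sequence[OF S])
  show "(\<lambda>z. \<Sum>n<N. kernel_poly b n (f z) * g z ^ n / fact n) holomorphic_on S" for N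
    unfolding kernel_poly_def by (intro holomorphic_intros f g) auto
  fix x assume "x \<in> S"
  then obtain d where d: "d > 0" "cball x d \<subseteq> S"
    using S open_contains_cball by blast
  have cf: "continuous_on (cball x d) f" "continuous_on (cball x d) g"
    by (rule continuous_on_subset[OF holomorphic_on_imp_continuous_on[OF f] d(2)],
        rule continuous_on_subset[OF holomorphic_on_imp_continuous_on[OF g] d(2)])
  obtain r1 where r1: "\<And>z. z \<in> cball x d \<Longrightarrow> norm (f z) \<le> r1"
    using continuous_on_compact_norm_bound[OF compact_cball cf(1)] by metis
  obtain r2 where r2: "\<And>z. z \<in> cball x d \<Longrightarrow> norm (g z) \<le> r2"
    using continuous_on_compact_norm_bound[OF compact_cball cf(2)] by metis
  have "uniform_limit (cball x d) (\<lambda>N z. \<Sum>n<N. kernel_poly b n (f z) * g z ^ n / fact n) (\<lambda>z.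
      shift_kernel b (f z) (g z)) sequentially"
  proof (rule shift_kernel_uniform_limit[OF b])
    fix z assume z: "z \<in> cball x d"
    show "norm (f z) \<le> max r1 r2 \<and> norm (g z) \<le> max r1 r2"
      using r1[OF z] r2[OF z] by auto
  qed
  with d show "\<exists>d>0. cball x d \<subseteq> S \<and> uniform_limit (cball x d) (\<lambda>N z. \<Sum>n<N. kernel_poly b n (f z) *
      g z ^ n / fact n) (\<lambda>z. shift_kernel b (f z) (g z)) sequentially"
    by (intro exI[of _ d] conjI)
qed

lemma continuous_shift_kernel:
  assumes b: "fps_conv_radius b > 0"
  shows "continuous_on UNIV (\<lambda>(x, u). shift_kernel b x u)"
proof -
  have "continuous_on (ball 0 r) (\<lambda>x. shift_kernel b (fst x) (snd x))" for r :: real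
  proof (rule uniform_limit_theorem)
    show "uniform_limit (ball 0 r) (\<lambda>N x. \<Sum>n<N. kernel_poly b n (fst x) * snd x ^ n / fact n) (\<lambda>x.
        shift_kernel b (fst x) (snd x)) sequentially"
    proof (rule shift_kernel_uniform_limit[OF b, where r = r])
      fix x :: "complex \<times> complex" assume "x \<in> ball 0 r"
      thus "norm (fst x) \<le> r \<and> norm (snd x) \<le> r"
        using norm_fst_le[of "fst x" "snd x"] norm_snd_le[of "snd x" "fst x"] by (auto simp:
            dist_norm)
    qed
    show "\<forall>\<^sub>F N in sequentially. continuous_on (ball 0 r) (\<lambda>x. \<Sum>n<N. kernel_poly b n (fst x) * snd x
        ^ n / fact n)"
      unfolding kernel_poly_def by (intro always_eventually allI continuous_intros) (auto simp del:
          fact_Suc)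
  qed auto
  hence "continuous_on (\<Union>r::real. ball 0 r) (\<lambda>x. shift_kernel b (fst x) (snd x))"
    by (intro continuous_on_open_UN) auto
  moreover have "(\<Union>r::real. ball 0 r) = (UNIV :: (complex \<times> complex) set)"
  proof (intro set_eqI iffI UNIV_I)
    fix x :: "complex \<times> complex"
    have "x \<in> ball 0 (norm x + 1)" by (simp add: dist_norm)
    thus "x \<in> (\<Union>r::real. ball 0 r)" by blast
  qed
  ultimately show ?thesis by (simp add: case_prod_unfold)
qed

lemma continuous_on_shift_kernel [continuous_intros]:
  assumes b: "fps_conv_radius b > 0" and "continuous_on A f" "continuous_on A g"
  shows "continuous_on A (\<lambda>z. shift_kernel b (f z) (g z))"
proof -
  from continuous_on_compose2[OF continuous_shift_kernel[OF b] continuous_on_Pair[OF assms(2,3)]]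
  show ?thesis by simp
qed

text \<open>On the Borel side \<open>d/dz\<close> multiplies by \<open>- w\<close>. Of the power
  \<open>(- w) ^ k\<close> in the k-th Taylor term, one factor \<open>w\<close> is left to
  \<open>volterra_eq\<close>, and its sign is the minus in front.\<close>

definition right_kernel :: "complex fps \<Rightarrow> complex \<Rightarrow> complex \<Rightarrow> complex" where
  "right_kernel b z w = - shift_kernel b (- w) (z - w)"

text \<open>The outer derivatives of Lagrange's formula give powers of \<open>z\<close>, and
  \<open>exp w\<close> turns the transform of \<phi>(z) into that of \<phi>(z - 1). The sign comes
  from moving the integral to the other side of the equation.\<close>

definition left_kernel :: "complex fps \<Rightarrow> complex \<Rightarrow> complex \<Rightarrow> complex" where
  "left_kernel b z w = - (shift_kernel b z (z - w) * exp w)"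

lemma right_kernel_bound:
  assumes b: "fps_conv_radius b > 0" and \<eta>: "\<eta> > 0"
  shows "\<exists>C>0. \<exists>R>0. \<forall>z w. norm (right_kernel b z w) \<le> C * exp (\<eta> * norm w + R * norm (z - w))"
proof -
  obtain C R where CR: "C > 0" "R > 0" "\<And>x u. norm (shift_kernel b x u) \<le> C * exp (\<eta> * norm x + R *
      norm u)"
    using shift_kernel_bound[OF b \<eta>] by metis
  have "norm (right_kernel b z w) \<le> C * exp (\<eta> * norm w + R * norm (z - w))" for z w
    using CR(3)[of "- w" "z - w"] by (simp add: right_kernel_def)
  with CR(1,2) show ?thesis by (intro exI conjI allI)
qed

lemma left_kernel_bound:
  assumes b: "fps_conv_radius b > 0" and \<eta>: "\<eta> > 0"
  shows "\<exists>C>0. \<exists>R>0. \<forall>z w. norm (left_kernel b z w) \<le> C * exp (\<eta> * norm z + R * norm (z - w) + Re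
      w)"
proof -
  obtain C R where CR: "C > 0" "R > 0" "\<And>x u. norm (shift_kernel b x u) \<le> C * exp (\<eta> * norm x + R *
      norm u)"
    using shift_kernel_bound[OF b \<eta>] by metis
  have "norm (left_kernel b z w) \<le> C * exp (\<eta> * norm z + R * norm (z - w) + Re w)" for z w
    using mult_right_mono[OF CR(3)[of z "z - w"], of "exp (Re w)"]
    by (simp add: left_kernel_def norm_mult exp_add mult.assoc)
  with CR(1,2) show ?thesis by (intro exI conjI allI)
qed

section \<open>Both kernels are entire\<close>

lemma entire_kernel_mult_right:
  assumes k: "entire_kernel k" and e: "e holomorphic_on UNIV"
  shows "entire_kernel (\<lambda>z w. k z w * e w)"
  unfolding entire_kernel_def
proof (intro conjI allI impI)
  have ec: "continuous_on UNIV e" by (rule holomorphic_on_imp_continuous_on[OF e])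
  show "continuous_on UNIV (\<lambda>(z, w). k z w * e w)"
    unfolding case_prod_unfold
    by (intro continuous_on_mult entire_kernel_continuous[OF k] continuous_on_compose2[OF ec]
        continuous_intros) auto
  show "(\<lambda>z. k (f z) (g z) * e (g z)) holomorphic_on S" if "open S" "f holomorphic_on S" "g
      holomorphic_on S" for S f g
    using holomorphic_on_compose_gen[OF that(3) e] entire_kernel_holomorphic[OF k that]
    by (intro holomorphic_on_mult) (simp_all add: o_def)
  fix r :: real
  obtain A B where AB: "\<And>z w. norm w \<le> r \<Longrightarrow> norm (k z w) \<le> A * exp (B * norm z)"
    using k unfolding entire_kernel_def by metis
  obtain M where M: "M > 0" "\<And>w. w \<in> cball 0 r \<Longrightarrow> norm (e w) \<le> M"
    using continuous_on_compact_norm_bound[OF compact_cball continuous_on_subset[OF ec subset_UNIV]]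
        by metis
  have "norm (k z w * e w) \<le> (A * M) * exp (B * norm z)" if w: "norm w \<le> r" for z w
  proof -
    have "norm (k z w) * norm (e w) \<le> (A * exp (B * norm z)) * M"
      using AB[OF w, of z] M(2)[of w] w order_trans[OF norm_ge_zero AB[OF w, of z]] by (intro
          mult_mono) auto
    thus ?thesis by (simp add: norm_mult mult_ac)
  qed
  thus "\<exists>A B. \<forall>z w. norm w \<le> r \<longrightarrow> norm (k z w * e w) \<le> A * exp (B * norm z)" by (intro exI allI impI)
qed

text \<open>The linear form covers both cases: (\<alpha>, \<beta>) is (0, - 1) for the right kernel
  and (1, 0) for the left one.\<close>

lemma entire_shift_kernel:
  assumes b: "fps_conv_radius b > 0"
  shows "entire_kernel (\<lambda>z w. shift_kernel b (\<alpha> * z + \<beta> * w) (z - w))"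
  unfolding entire_kernel_def
proof (intro conjI allI impI)
  show "continuous_on UNIV (\<lambda>(z, w). shift_kernel b (\<alpha> * z + \<beta> * w) (z - w))"
    unfolding case_prod_unfold by (intro continuous_intros b)
  show "(\<lambda>z. shift_kernel b (\<alpha> * f z + \<beta> * g z) (f z - g z)) holomorphic_on S"
    if "open S" "f holomorphic_on S" "g holomorphic_on S" for S f g
    by (intro holomorphic_shift_kernel b holomorphic_on_diff holomorphic_on_add
        holomorphic_on_mult holomorphic_on_const that)
  fix r :: real
  obtain C R where CR: "C > 0" "R > 0" "\<And>x u. norm (shift_kernel b x u) \<le> C * exp (1 * norm x + R *
      norm u)"
    using shift_kernel_bound[OF b zero_less_one] by metis
  have "norm (shift_kernel b (\<alpha> * z + \<beta> * w) (z - w)) \<le>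
      (C * exp ((norm \<beta> + R) * r)) * exp ((norm \<alpha> + R) * norm z)" if "norm w \<le> r" for z w
  proof -
    have "norm (\<alpha> * z + \<beta> * w) \<le> norm \<alpha> * norm z + norm \<beta> * norm w"
      by (rule order_trans[OF norm_triangle_ineq]) (simp add: norm_mult)
    also have "\<dots> \<le> norm \<alpha> * norm z + norm \<beta> * r"
      using that by (intro add_left_mono mult_left_mono) auto
    finally have "norm (\<alpha> * z + \<beta> * w) \<le> norm \<alpha> * norm z + norm \<beta> * r" .
    moreover have "R * norm (z - w) \<le> R * (norm z + r)"
      using norm_triangle_ineq4[of z w] that CR(2) by (intro mult_left_mono) auto
    ultimately have "1 * norm (\<alpha> * z + \<beta> * w) + R * norm (z - w) \<le> (norm \<beta> + R) * r + (norm \<alpha> + R) *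
        norm z"
      by (simp add: algebra_simps)
    hence "C * exp (1 * norm (\<alpha> * z + \<beta> * w) + R * norm (z - w)) \<le>
        C * exp ((norm \<beta> + R) * r + (norm \<alpha> + R) * norm z)"
      using CR(1) by (intro mult_left_mono) auto
    with CR(3)[of "\<alpha> * z + \<beta> * w" "z - w"] show ?thesis by (simp add: exp_add mult.assoc)
  qed
  thus "\<exists>A B. \<forall>z w. norm w \<le> r \<longrightarrow> norm (shift_kernel b (\<alpha> * z + \<beta> * w) (z - w)) \<le> A * exp (B * norm
      z)"
    by (intro exI allI impI)
qed

lemma entire_right_kernel: "fps_conv_radius b > 0 \<Longrightarrow> entire_kernel (right_kernel b)"
  using entire_kernel_mult_right[OF entire_shift_kernel, of b "\<lambda>_. - 1" 0 "- 1"]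
  by (simp add: right_kernel_def[abs_def])

lemma entire_left_kernel: "fps_conv_radius b > 0 \<Longrightarrow> entire_kernel (left_kernel b)"
  using entire_kernel_mult_right[OF entire_shift_kernel, of b "\<lambda>w. - exp w" 1 0]
  by (simp add: left_kernel_def[abs_def] holomorphic_on_minus holomorphic_on_exp)

subsection \<open>Borel transforms of composition operators\<close>

text \<open>The Beta integral, that is, the convolution of two powers. Induction on \<open>n\<close>
  by parts; the primitive \<open>(z - w) ^ Suc n * w ^ Suc j\<close> vanishes at both ends of the
  segment.\<close>

lemma has_contour_integral_beta:
  "((\<lambda>w. (z - w) ^ n * w ^ j) has_contour_integral (fact n * fact j / fact (n + j + 1) * z ^ (n + j
      + 1))) (linepath 0 z)"
proof (induction n arbitrary: j)
  case 0
  have "((\<lambda>w. w ^ j) has_contour_integral (z ^ Suc j / of_nat (Suc j) - 0 ^ Suc j / of_nat (Suc j)))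
      (linepath 0 z)"
  proof -
    have "((\<lambda>w. w ^ Suc j / of_nat (Suc j)) has_field_derivative w ^ j) (at w within UNIV)" for w ::
        complex
      by (rule derivative_eq_intros refl | simp del: of_nat_Suc power_Suc)+
    from contour_integral_primitive[of UNIV "\<lambda>w. w ^ Suc j / of_nat (Suc j)" "\<lambda>w. w ^ j" "linepath 0
        z", OF this]
    show ?thesis by (simp only: valid_path_linepath pathstart_linepath pathfinish_linepath
        subset_UNIV)
  qed
  moreover have "fact 0 * fact j / fact (0 + j + 1) * z ^ (0 + j + 1) = z ^ Suc j / of_nat (Suc j) -
      0 ^ Suc j / of_nat (Suc j)"
    by (simp add: fact_Suc del: of_nat_Suc power_Suc)
  ultimately show ?case
    by (simp only: power_0 mult_1_left)
next
  case (Suc n)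
  define c where "c = (of_nat (Suc n) / of_nat (Suc j) :: complex)"
  have d: "((\<lambda>w. (z - w) ^ Suc n * w ^ Suc j / of_nat (Suc j)) has_field_derivative
          ((z - w) ^ Suc n * w ^ j - c * ((z - w) ^ n * w ^ Suc j))) (at w within UNIV)" for w
    by (rule derivative_eq_intros refl | simp del: of_nat_Suc power_Suc)+
       (simp add: c_def field_simps del: of_nat_Suc power_Suc)
  from contour_integral_primitive[of UNIV "\<lambda>w. (z - w) ^ Suc n * w ^ Suc j / of_nat (Suc j)" "\<lambda>w. (z
      - w) ^ Suc n * w ^ j - c * ((z - w) ^ n * w ^ Suc j)" "linepath 0 z", OF d]
  have 1: "((\<lambda>w. (z - w) ^ Suc n * w ^ j - c * ((z - w) ^ n * w ^ Suc j)) has_contour_integral 0)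
      (linepath 0 z)"
    by simp
  have "((\<lambda>w. ((z - w) ^ Suc n * w ^ j - c * ((z - w) ^ n * w ^ Suc j)) + c * ((z - w) ^ n * w ^ Suc
      j)) has_contour_integral
        0 + c * (fact n * fact (Suc j) / fact (n + Suc j + 1) * z ^ (n + Suc j + 1))) (linepath 0
            z)"
    by (intro has_contour_integral_add has_contour_integral_lmul 1 Suc.IH)
  moreover have "0 + c * (fact n * fact (Suc j) / fact (n + Suc j + 1) * z ^ (n + Suc j + 1)) =
        fact (Suc n) * fact j / fact (Suc n + j + 1) * z ^ (Suc n + j + 1)"
  proof -
    have "c * (fact n * fact (Suc j)) = fact (Suc n) * fact j"
      unfolding c_def fact_Suc by (simp del: of_nat_Suc)
    thus ?thesis by (simp add: mult.assoc[symmetric] del: fact_Suc power_Suc)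
  qed
  ultimately have "((\<lambda>w. ((z - w) ^ Suc n * w ^ j - c * ((z - w) ^ n * w ^ Suc j)) + c * ((z - w) ^
      n * w ^ Suc j)) has_contour_integral
        fact (Suc n) * fact j / fact (Suc n + j + 1) * z ^ (Suc n + j + 1)) (linepath 0 z)"
    by (simp only:)
  thus ?case by (simp only: diff_add_cancel)
qed

text \<open>Allows Taylor coefficients to be computed from truncations. Once the lower coefficients
  agree, dividing the difference by \<open>z ^ i\<close> leaves a function that tends to 0, and its
  value at 0 is the difference of the coefficients of index \<open>i\<close>.\<close>

lemma fps_nth_eq_of_bigo:
  fixes f g :: "complex \<Rightarrow> complex"
  assumes F: "f has_fps_expansion F" and G: "g has_fps_expansion G"
    and bound: "\<forall>\<^sub>F z in nhds 0. norm (f z - g z) \<le> A * norm z ^ Suc N"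
    and "i \<le> N"
  shows "fps_nth F i = fps_nth G i"
  using \<open>i \<le> N\<close>
proof (induction i rule: less_induct)
  case (less i)
  define D where "D = F - G"
  define S where "S = fps_shift i D"
  have D: "(\<lambda>z. f z - g z) has_fps_expansion D"
    unfolding D_def by (intro has_fps_expansion_diff F G)
  have DS: "D = fps_X ^ i * S"
  proof (rule fps_ext)
    fix n show "fps_nth D n = fps_nth (fps_X ^ i * S) n"
      using less by (auto simp: fps_X_power_mult_nth S_def D_def)
  qed
  have conv: "fps_conv_radius S > 0"
    using D by (simp add: S_def has_fps_expansion_def)
  have "\<forall>\<^sub>F z in nhds 0. z \<in> eball (0::complex) (fps_conv_radius S)"
    using conv by (intro eventually_nhds_in_open) (auto simp: zero_ereal_def)
  moreover have "\<forall>\<^sub>F z in nhds 0. eval_fps D z = f z - g z"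
    using D by (simp add: has_fps_expansion_def)
  ultimately have "\<forall>\<^sub>F z in nhds 0. z \<noteq> 0 \<longrightarrow> norm (eval_fps S z) \<le> A * norm z ^ (Suc N - i)"
    using bound
  proof eventually_elim
    case (elim z)
    show ?case
    proof
      assume "z \<noteq> 0"
      have "eval_fps D z = z ^ i * eval_fps S z"
        unfolding DS using elim by (subst eval_fps_mult) auto
      hence "norm z ^ i * norm (eval_fps S z) \<le> A * norm z ^ Suc N"
        using elim by (simp add: norm_mult norm_power del: power_Suc)
      also have "norm z ^ Suc N = norm z ^ i * norm z ^ (Suc N - i)"
        using less.prems by (simp flip: power_add)
      finally have "norm z ^ i * norm (eval_fps S z) \<le> norm z ^ i * (A * norm z ^ (Suc N - i))"
        by (simp add: mult_ac)
      thus "norm (eval_fps S z) \<le> A * norm z ^ (Suc N - i)"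
        using \<open>z \<noteq> 0\<close> by (simp add: mult_le_cancel_left)
    qed
  qed
  hence ev: "\<forall>\<^sub>F z in at 0. norm (eval_fps S z) \<le> A * norm z ^ (Suc N - i)"
    by (simp add: eventually_at_filter)
  have "((\<lambda>z::complex. A * norm z ^ (Suc N - i)) \<longlongrightarrow> A * norm (0::complex) ^ (Suc N - i)) (at 0)"
    by (intro tendsto_intros)
  hence "((\<lambda>z::complex. A * norm z ^ (Suc N - i)) \<longlongrightarrow> 0) (at 0)"
    using less.prems by (simp add: zero_power)
  from Lim_null_comparison[OF ev this] have "(eval_fps S \<longlongrightarrow> 0) (at 0)" .
  moreover have "(eval_fps S \<longlongrightarrow> eval_fps S 0) (at 0)"
    using continuous_eval_fps[of 0 S UNIV] conv by (simp add: continuous_at zero_ereal_def)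
  ultimately have "eval_fps S 0 = 0" by (intro LIM_unique[of "eval_fps S" _ 0])
  thus ?case by (simp add: eval_fps_at_0 S_def D_def)
qed

section \<open>Truncation errors of the kernel and of convergent series\<close>

lemma suminf_tail_norm_bound:
  fixes f :: "nat \<Rightarrow> complex"
  assumes f: "\<And>n. norm (f n) \<le> c n * x ^ n" and x: "0 \<le> x" "x \<le> r" and r: "r > 0"
    and c: "\<And>n. c n \<ge> 0" "summable (\<lambda>n. c n * r ^ n)"
  shows "norm (suminf f - (\<Sum>n<N. f n)) \<le> (\<Sum>n. c (n + N) * r ^ n) * x ^ N"
proof -
  have sumr: "summable (\<lambda>n. c (n + N) * r ^ n)"
  proof -
    have "summable (\<lambda>n. c (n + N) * r ^ (n + N))" by (rule summable_ignore_initial_segment[OF c(2)])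
    hence "summable (\<lambda>n. c (n + N) * r ^ (n + N) * (1 / r ^ N))" by (rule summable_mult2)
    thus ?thesis using r by (simp add: power_add)
  qed
  have le: "norm (f (n + N)) \<le> c (n + N) * r ^ n * x ^ N" for n
  proof -
    have "norm (f (n + N)) \<le> c (n + N) * (x ^ n * x ^ N)" using f[of "n + N"] by (simp add:
        power_add)
    also have "\<dots> \<le> c (n + N) * (r ^ n * x ^ N)"
      using c(1) x by (intro mult_left_mono mult_right_mono power_mono) auto
    finally show ?thesis by (simp add: mult_ac)
  qed
  have sumf: "summable f"
  proof (rule summable_comparison_test'[OF c(2), of 0])
    fix n
    have "c n * x ^ n \<le> c n * r ^ n" using c(1) x by (intro mult_left_mono power_mono) auto
    thus "norm (f n) \<le> c n * r ^ n" using f[of n] by linarith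
  qed
  have "suminf f - (\<Sum>n<N. f n) = (\<Sum>n. f (n + N))"
    using suminf_minus_initial_segment[OF sumf, of N] by simp
  also have "norm \<dots> \<le> (\<Sum>n. c (n + N) * r ^ n * x ^ N)"
    by (rule norm_suminf_le[OF le summable_mult2[OF sumr]])
  also have "\<dots> = (\<Sum>n. c (n + N) * r ^ n) * x ^ N"
    by (rule suminf_mult2[OF sumr, symmetric])
  finally show ?thesis .
qed

lemma shift_kernel_tail:
  assumes b: "fps_conv_radius b > 0"
  obtains A where "\<And>x u. norm x \<le> 1 \<Longrightarrow> norm u \<le> 1 \<Longrightarrow>
    norm (shift_kernel b x u - (\<Sum>n<N. kernel_poly b n x * u ^ n / fact n)) \<le> A * norm u ^ N"
proof -
  obtain C R where CR: "C > 0" "R > 0"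
    "\<And>n x u. norm (kernel_poly b n x * u ^ n / fact n) \<le> C * exp (1 * norm x) * ((R * norm u) ^ n /
        fact n)"
    using kernel_term_bound[OF b zero_less_one] by metis
  define c where "c n = C * exp 1 * (R ^ n / fact n)" for n :: nat
  have "norm (shift_kernel b x u - (\<Sum>n<N. kernel_poly b n x * u ^ n / fact n)) \<le> (\<Sum>n. c (n + N) * 1
      ^ n) * norm u ^ N"
    if "norm x \<le> 1" "norm u \<le> 1" for x u
    unfolding shift_kernel_def
  proof (rule suminf_tail_norm_bound)
    fix n
    have "norm (kernel_poly b n x * u ^ n / fact n) \<le> C * exp (1 * norm x) * ((R * norm u) ^ n /
        fact n)"
      by (rule CR(3))
    also have "\<dots> \<le> C * exp 1 * ((R * norm u) ^ n / fact n)"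
      using that CR by (intro mult_right_mono mult_left_mono) auto
    also have "\<dots> = c n * norm u ^ n" by (simp add: c_def power_mult_distrib)
    finally show "norm (kernel_poly b n x * u ^ n / fact n) \<le> c n * norm u ^ n" .
    show "c n \<ge> 0" using CR by (simp add: c_def)
  next
    show "summable (\<lambda>n. c n * 1 ^ n)" unfolding c_def using summable_exp_div[of "C * exp 1" R] by
        simp
  qed (use that in auto)
  thus thesis by (rule that)
qed

lemma eval_fps_tail:
  fixes \<phi> :: "complex fps"
  assumes r: "r > 0" "ereal r < fps_conv_radius \<phi>"
  obtains A where "\<And>w. norm w \<le> r \<Longrightarrow> norm (eval_fps \<phi> w - (\<Sum>m<N. fps_nth \<phi> m * w ^ m)) \<le> A * norm w ^
      N"
proof -
  define c where "c n = norm (fps_nth \<phi> n)" for n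
  have "norm (eval_fps \<phi> w - (\<Sum>m<N. fps_nth \<phi> m * w ^ m)) \<le> (\<Sum>n. c (n + N) * r ^ n) * norm w ^ N"
    if "norm w \<le> r" for w
    unfolding eval_fps_def
  proof (rule suminf_tail_norm_bound)
    show "summable (\<lambda>n. c n * r ^ n)"
      using norm_summable_fps[of "complex_of_real r" \<phi>] r by (simp add: c_def norm_mult norm_power)
  qed (use that r in \<open>auto simp: c_def norm_mult norm_power\<close>)
  thus thesis by (rule that)
qed

text \<open>
  Both kernels have the form \<open>shift_kernel b (X z w) (z - w)\<close> where \<open>X z w\<close> is \<open>- w\<close> or \<open>z\<close>; the
  functions \<open>e\<close>, \<open>p\<close>, \<open>q\<close> describe the powers \<open>(X z w)\<^sup>k = e k z\<^bsup>p k\<^esup> w\<^bsup>q k\<^esup>\<close>.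
\<close>

definition kernel_coeff ::
    "complex fps \<Rightarrow> (nat \<Rightarrow> complex) \<Rightarrow> (nat \<Rightarrow> nat) \<Rightarrow> complex fps \<Rightarrow> nat \<Rightarrow> nat \<Rightarrow> nat \<Rightarrow> complex" where
  "kernel_coeff b e q \<phi> n k m =
     e k * fps_nth (b ^ Suc k) (Suc n) / fact (Suc k) * fps_nth \<phi> m * (fact (q k + m + 1) / fact (n
         + q k + m + 2))"

text \<open>The monomial with indices \<open>n\<close>, \<open>k\<close>, \<open>m\<close> has
  degree \<open>n + k + m + 2\<close>, where the 2 comes from the factor \<open>w\<close> and from
  the integration. Thus \<open>N\<close> determines \<open>m\<close>.\<close>

definition kernel_entry ::
    "complex fps \<Rightarrow> (nat \<Rightarrow> complex) \<Rightarrow> (nat \<Rightarrow> nat) \<Rightarrow> complex fps \<Rightarrow> nat \<Rightarrow> nat \<Rightarrow> nat \<Rightarrow> complex" where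
  "kernel_entry b e q \<phi> N k n =
     (if n + k + 2 \<le> N then kernel_coeff b e q \<phi> n k (N - n - k - 2) else 0)"

definition kernel_series ::
    "complex fps \<Rightarrow> (nat \<Rightarrow> complex) \<Rightarrow> (nat \<Rightarrow> nat) \<Rightarrow> complex fps \<Rightarrow> complex fps" where
  "kernel_series b e q \<phi> = Abs_fps (\<lambda>N. \<Sum>n<N. \<Sum>k\<le>n. kernel_entry b e q \<phi> N k n)"

lemma has_contour_integral_truncated_kernel:
  assumes X: "\<And>z w k. X z w ^ k = e k * z ^ p k * w ^ q k" and pq: "\<And>k. p k + q k = k"
  shows "((\<lambda>w. (\<Sum>n<N. kernel_poly b n (X z w) * (z - w) ^ n / fact n) * (w * (\<Sum>m<N. fps_nth \<phi> m * w
      ^ m)))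
           has_contour_integral
          (\<Sum>n<N. \<Sum>k\<le>n. \<Sum>m<N. kernel_coeff b e q \<phi> n k m * z ^ (n + k + m + 2))) (linepath 0 z)"
proof -
  define c where "c n k m = e k * z ^ p k / fact (Suc k) * fps_nth (b ^ Suc k) (Suc n) / fact n *
      fps_nth \<phi> m" for n k m
  have "((\<lambda>w. \<Sum>n<N. \<Sum>k\<le>n. \<Sum>m<N. c n k m * ((z - w) ^ n * w ^ (q k + m + 1))) has_contour_integral
          (\<Sum>n<N. \<Sum>k\<le>n. \<Sum>m<N. c n k m * (fact n * fact (q k + m + 1) / fact (n + (q k + m + 1) + 1) *
              z ^ (n + (q k + m + 1) + 1)))) (linepath 0 z)"
    by (intro has_contour_integral_sum has_contour_integral_lmul has_contour_integral_beta) auto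
  also have "(\<lambda>w. \<Sum>n<N. \<Sum>k\<le>n. \<Sum>m<N. c n k m * ((z - w) ^ n * w ^ (q k + m + 1))) =
     (\<lambda>w. (\<Sum>n<N. kernel_poly b n (X z w) * (z - w) ^ n / fact n) * (w * (\<Sum>m<N. fps_nth \<phi> m * w ^
         m)))"
  proof
    fix w
    have "(\<Sum>n<N. kernel_poly b n (X z w) * (z - w) ^ n / fact n) * (w * (\<Sum>m<N. fps_nth \<phi> m * w ^ m))
        =
          (\<Sum>n<N. (\<Sum>k\<le>n. X z w ^ k / fact (Suc k) * fps_nth (b ^ Suc k) (Suc n) * ((z - w) ^ n / fact
              n))) * (\<Sum>m<N. w * (fps_nth \<phi> m * w ^ m))"
      unfolding kernel_poly_def sum_distrib_right[symmetric] sum_distrib_left by simp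
    also have "\<dots> = (\<Sum>n<N. \<Sum>k\<le>n. \<Sum>m<N. (X z w ^ k / fact (Suc k) * fps_nth (b ^ Suc k) (Suc n) * ((z
        - w) ^ n / fact n)) * (w * (fps_nth \<phi> m * w ^ m)))"
      unfolding sum_distrib_right by (simp only: sum_distrib_left)
    also have "\<dots> = (\<Sum>n<N. \<Sum>k\<le>n. \<Sum>m<N. c n k m * ((z - w) ^ n * w ^ (q k + m + 1)))"
    proof (rule sum.cong[OF refl], rule sum.cong[OF refl], rule sum.cong[OF refl])
      fix n k m
      have "w ^ (q k + m + 1) = w * (w ^ m * w ^ q k)" by (simp add: power_add mult_ac)
      thus "(X z w ^ k / fact (Suc k) * fps_nth (b ^ Suc k) (Suc n) * ((z - w) ^ n / fact n)) * (w *
          (fps_nth \<phi> m * w ^ m)) =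
            c n k m * ((z - w) ^ n * w ^ (q k + m + 1))"
        unfolding c_def X by (simp add: mult_ac del: fact_Suc power_Suc)
    qed
    finally show "(\<Sum>n<N. \<Sum>k\<le>n. \<Sum>m<N. c n k m * ((z - w) ^ n * w ^ (q k + m + 1))) =
      (\<Sum>n<N. kernel_poly b n (X z w) * (z - w) ^ n / fact n) * (w * (\<Sum>m<N. fps_nth \<phi> m * w ^ m))" ..
  qed
  also have "(\<Sum>n<N. \<Sum>k\<le>n. \<Sum>m<N. c n k m * (fact n * fact (q k + m + 1) / fact (n + (q k + m + 1) +
      1) * z ^ (n + (q k + m + 1) + 1))) =
     (\<Sum>n<N. \<Sum>k\<le>n. \<Sum>m<N. kernel_coeff b e q \<phi> n k m * z ^ (n + k + m + 2))"
  proof (rule sum.cong[OF refl], rule sum.cong[OF refl], rule sum.cong[OF refl])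
    fix n k m
    have "z ^ (n + k + m + 2) = z ^ (p k + (n + (q k + m + 1) + 1))"
      by (rule arg_cong[where f = "\<lambda>i. z ^ i"]) (use pq[of k] in simp)
    moreover have "n + q k + m + 2 = n + (q k + m + 1) + 1" by simp
    ultimately show "c n k m * (fact n * fact (q k + m + 1) / fact (n + (q k + m + 1) + 1) * z ^ (n
        + (q k + m + 1) + 1)) =
       kernel_coeff b e q \<phi> n k m * z ^ (n + k + m + 2)"
      unfolding c_def kernel_coeff_def by (simp only: power_add) (simp add: mult_ac del: fact_Suc
          power_Suc)
  qed
  finally show ?thesis .
qed

text \<open>Truncating the kernel and \<phi> at order \<open>N\<close> changes the integral by
  O(\<open>z ^ Suc N\<close>): \<open>N\<close> powers come from the tails and one from the length
  of the segment. The truncated integral is a finite sum of Beta integrals, in which the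
  \<open>N\<close>-th coefficient is visible.\<close>

theorem shift_kernel_integral_expansion:
  assumes b: "fps_conv_radius b > 0" and \<phi>: "fps_conv_radius \<phi> > 0"
    and k: "entire_kernel (\<lambda>z w. shift_kernel b (X z w) (z - w))"
    and X: "\<And>z w k. X z w ^ k = e k * z ^ p k * w ^ q k" and pq: "\<And>k. p k + q k = k"
    and X_le: "\<And>z w. norm w \<le> norm z \<Longrightarrow> norm (X z w) \<le> norm z"
    and X_cont: "continuous_on UNIV (\<lambda>x. X (fst x) (snd x))"
  shows "(\<lambda>z. contour_integral (linepath 0 z) (\<lambda>w. shift_kernel b (X z w) (z - w) * (w * eval_fps \<phi>
      w)))
           has_fps_expansion
         kernel_series b e q \<phi>"
proof -
  define K where "K z w = shift_kernel b (X z w) (z - w)" for z w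
  define I where "I z = contour_integral (linepath 0 z) (\<lambda>w. K z w * (w * eval_fps \<phi> w))" for z
  obtain r0 where r0: "0 < ereal r0" "ereal r0 < fps_conv_radius \<phi>"
    using ereal_dense2[OF \<phi>] by (auto simp: zero_ereal_def)
  define r where "r = min r0 1"
  have r: "r > 0" "r \<le> 1" using r0(1) by (auto simp: r_def)
  have r_conv: "ereal r < fps_conv_radius \<phi>"
    by (rule le_less_trans[OF _ r0(2)]) (simp add: r_def)
  have \<phi>_hol: "eval_fps \<phi> holomorphic_on cball 0 r"
  proof (rule holomorphic_on_eval_fps, rule subsetI)
    fix w :: complex assume "w \<in> cball 0 r"
    hence "ereal (dist 0 w) \<le> ereal r" by simp
    thus "w \<in> eball 0 (fps_conv_radius \<phi>)" using le_less_trans[OF _ r_conv] by simp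
  qed
  have \<phi>_cont: "continuous_on A (eval_fps \<phi>)" if "A \<subseteq> cball 0 r" for A
    by (rule continuous_on_subset[OF holomorphic_on_imp_continuous_on[OF \<phi>_hol] that])
  have I_hol: "I holomorphic_on ball 0 r"
    unfolding I_def
  proof (rule holomorphic_on_volterra_integral)
    show "entire_kernel K" using k unfolding K_def[abs_def] .
    show "closed_segment 0 z \<subseteq> ball 0 r" if "z \<in> ball 0 r" for z :: complex
      using that r(1) by (intro closed_segment_subset convex_ball) auto
    show "eval_fps \<phi> holomorphic_on ball 0 r"
      by (rule holomorphic_on_subset[OF \<phi>_hol ball_subset_cball])
  qed auto
  have I_exp: "I has_fps_expansion fps_expansion I 0"
    by (rule has_fps_expansion_fps_expansion[OF _ _ I_hol]) (use r in auto)
  obtain B where B: "B > 0" "\<And>w. w \<in> cball 0 r \<Longrightarrow> norm (eval_fps \<phi> w) \<le> B"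
    using continuous_on_compact_norm_bound[OF compact_cball \<phi>_cont[OF order_refl]] by metis
  obtain C R where CR: "C > 0" "R > 0" "\<And>x u. norm (shift_kernel b x u) \<le> C * exp (1 * norm x + R *
      norm u)"
    using shift_kernel_bound[OF b zero_less_one] by metis
  have coeff: "fps_nth (fps_expansion I 0) N = (\<Sum>n<N. \<Sum>k\<le>n. kernel_entry b e q \<phi> N k n)" for N
  proof -
    define KN where "KN z w = (\<Sum>n<N. kernel_poly b n (X z w) * (z - w) ^ n / fact n)" for z w
    define \<phi>N where "\<phi>N w = (\<Sum>m<N. fps_nth \<phi> m * w ^ m)" for w
    define IN where "IN z = (\<Sum>n<N. \<Sum>k\<le>n. \<Sum>m<N. kernel_coeff b e q \<phi> n k m * z ^ (n + k + m + 2))"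
        for z
    define FN where "FN = (\<Sum>n<N. \<Sum>k\<le>n. \<Sum>m<N. fps_const (kernel_coeff b e q \<phi> n k m) * fps_X ^ (n + k
        + m + 2))"
    have IN: "((\<lambda>w. KN z w * (w * \<phi>N w)) has_contour_integral IN z) (linepath 0 z)" for z
      unfolding KN_def \<phi>N_def IN_def by (rule has_contour_integral_truncated_kernel[OF X pq])
    have FN: "IN has_fps_expansion FN"
      unfolding IN_def[abs_def] FN_def
      by (intro has_fps_expansion_sum has_fps_expansion_cmult_left has_fps_expansion_fps_X_power)
    obtain A1 where A1: "\<And>x u. norm x \<le> 1 \<Longrightarrow> norm u \<le> 1 \<Longrightarrow>
      norm (shift_kernel b x u - (\<Sum>n<N. kernel_poly b n x * u ^ n / fact n)) \<le> A1 * norm u ^ N"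
      using shift_kernel_tail[OF b, of N] by metis
    obtain A2 where A2: "\<And>w. norm w \<le> r \<Longrightarrow> norm (eval_fps \<phi> w - \<phi>N w) \<le> A2 * norm w ^ N"
      using eval_fps_tail[OF r(1) r_conv, of N] unfolding \<phi>N_def by metis
    define A where "A = \<bar>A1\<bar> * B + (C * exp (1 + R) + \<bar>A1\<bar>) * \<bar>A2\<bar>"
    have A: "A \<ge> 0" using B CR by (simp add: A_def)
    have bound: "norm (I z - IN z) \<le> A * norm z ^ Suc N" if z: "z \<in> ball 0 r" for z
    proof -
      have nz: "norm z \<le> 1" "norm z \<le> r" using z r by auto
      have seg: "norm w \<le> norm z \<and> norm (z - w) \<le> norm z" if "w \<in> closed_segment 0 z" for w
        using segment_bound[OF that] by (simp add: norm_minus_commute)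
      have seg_r: "closed_segment 0 z \<subseteq> cball 0 r"
      proof
        fix w assume "w \<in> closed_segment 0 z"
        from seg[OF this] nz show "w \<in> cball 0 r" by simp
      qed
      have Xz: "continuous_on (closed_segment 0 z) (X z)"
        using continuous_on_compose2[OF X_cont continuous_on_Pair[OF continuous_on_const[of _ z]
            continuous_on_id[of "closed_segment 0 z"]]]
        by simp
      have int: "(\<lambda>w. K z w * (w * eval_fps \<phi> w)) contour_integrable_on linepath 0 z"
        unfolding K_def
        by (intro contour_integrable_continuous_linepath continuous_on_mult \<phi>_cont[OF seg_r]
            continuous_on_id
              continuous_on_shift_kernel[OF b] Xz continuous_on_diff continuous_on_const)
      have "((\<lambda>w. K z w * (w * eval_fps \<phi> w) - KN z w * (w * \<phi>N w)) has_contour_integral (I z - IN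
          z)) (linepath 0 z)"
        unfolding I_def by (intro has_contour_integral_diff has_contour_integral_integral int IN)
      hence "norm (I z - IN z) \<le> (A * norm z ^ N) * norm (z - 0)"
      proof (rule has_contour_integral_bound_linepath)
        fix w assume w: "w \<in> closed_segment 0 z"
        have nw: "norm w \<le> norm z" "norm (z - w) \<le> norm z" "norm w \<le> r" "norm w \<le> 1" "norm (z - w) \<le>
            1"
          using seg[OF w] nz by auto
        have nX: "norm (X z w) \<le> 1" using X_le[OF nw(1)] nz by linarith
        have k1: "norm (K z w - KN z w) \<le> \<bar>A1\<bar> * norm z ^ N"
        proof -
          have "norm (K z w - KN z w) \<le> A1 * norm (z - w) ^ N"
            unfolding K_def KN_def by (rule A1[OF nX nw(5)])
          also have "\<dots> \<le> \<bar>A1\<bar> * norm z ^ N"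
            using nw by (intro mult_mono power_mono) auto
          finally show ?thesis .
        qed
        have k2: "norm (KN z w) \<le> C * exp (1 + R) + \<bar>A1\<bar>"
        proof -
          have "1 * norm (X z w) + R * norm (z - w) \<le> 1 + R * 1"
            using nX nw CR(2) by (intro add_mono mult_left_mono) auto
          hence "C * exp (1 * norm (X z w) + R * norm (z - w)) \<le> C * exp (1 + R)"
            using CR(1) by simp
          hence "norm (K z w) \<le> C * exp (1 + R)"
            using CR(3)[of "X z w" "z - w"] by (simp add: K_def)
          moreover have "\<bar>A1\<bar> * norm z ^ N \<le> \<bar>A1\<bar> * 1"
            using nz by (intro mult_left_mono power_le_one) auto
          moreover have "norm (KN z w) \<le> norm (K z w) + norm (K z w - KN z w)"
            using norm_triangle_ineq4[of "K z w" "K z w - KN z w"] by simp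
          ultimately show ?thesis using k1 by linarith
        qed
        have p2: "norm (eval_fps \<phi> w - \<phi>N w) \<le> \<bar>A2\<bar> * norm z ^ N"
        proof -
          have "norm (eval_fps \<phi> w - \<phi>N w) \<le> A2 * norm w ^ N" by (rule A2[OF nw(3)])
          also have "\<dots> \<le> \<bar>A2\<bar> * norm z ^ N"
            using nw by (intro mult_mono power_mono) auto
          finally show ?thesis .
        qed
        \<comment> \<open>Each summand pairs one truncation error with one bounded factor; the
          truncated kernel was bounded in \<open>k2\<close> through the full one.\<close>
        have "K z w * (w * eval_fps \<phi> w) - KN z w * (w * \<phi>N w) =
              w * ((K z w - KN z w) * eval_fps \<phi> w + KN z w * (eval_fps \<phi> w - \<phi>N w))"
          by (simp add: algebra_simps)
        also have "norm \<dots> \<le> 1 * ((\<bar>A1\<bar> * norm z ^ N) * B + (C * exp (1 + R) + \<bar>A1\<bar>) * (\<bar>A2\<bar> * norm z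
            ^ N))"
          unfolding norm_mult
        proof (rule mult_mono)
          have "norm ((K z w - KN z w) * eval_fps \<phi> w) \<le> (\<bar>A1\<bar> * norm z ^ N) * B"
            unfolding norm_mult using k1 B nw by (intro mult_mono) auto
          moreover have "norm (KN z w * (eval_fps \<phi> w - \<phi>N w)) \<le> (C * exp (1 + R) + \<bar>A1\<bar>) * (\<bar>A2\<bar> *
              norm z ^ N)"
            unfolding norm_mult using k2 p2 CR by (intro mult_mono) auto
          ultimately show "norm ((K z w - KN z w) * eval_fps \<phi> w + KN z w * (eval_fps \<phi> w - \<phi>N w)) \<le>
             (\<bar>A1\<bar> * norm z ^ N) * B + (C * exp (1 + R) + \<bar>A1\<bar>) * (\<bar>A2\<bar> * norm z ^ N)"
            by (rule norm_triangle_mono)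
        qed (use nw in auto)
        also have "\<dots> = A * norm z ^ N" by (simp add: A_def algebra_simps)
        finally show "norm (K z w * (w * eval_fps \<phi> w) - KN z w * (w * \<phi>N w)) \<le> A * norm z ^ N" .
      qed (use A in auto)
      thus ?thesis by (simp add: mult_ac)
    qed
    have "\<forall>\<^sub>F z in nhds 0. z \<in> ball 0 r" using r by (intro eventually_nhds_in_open) auto
    hence "\<forall>\<^sub>F z in nhds 0. norm (I z - IN z) \<le> A * norm z ^ Suc N"
      by eventually_elim (rule bound)
    from fps_nth_eq_of_bigo[OF I_exp FN this order_refl]
    have "fps_nth (fps_expansion I 0) N = fps_nth FN N" .
    also have "\<dots> = (\<Sum>n<N. \<Sum>k\<le>n. \<Sum>m<N. if N = n + k + m + 2 then kernel_coeff b e q \<phi> n k m else 0)"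
    proof -
      have "fps_nth (fps_const c * fps_X ^ j) N = (if N = j then c else 0)" for c :: complex and j
        by (simp add: fps_X_power_nth)
      thus ?thesis unfolding FN_def fps_sum_nth by (simp only:)
    qed
    also have "\<dots> = (\<Sum>n<N. \<Sum>k\<le>n. kernel_entry b e q \<phi> N k n)"
    proof (rule sum.cong[OF refl], rule sum.cong[OF refl])
      fix n k
      show "(\<Sum>m<N. if N = n + k + m + 2 then kernel_coeff b e q \<phi> n k m else 0) =
            kernel_entry b e q \<phi> N k n"
      proof (cases "n + k + 2 \<le> N")
        case True
        have "(\<Sum>m<N. if N = n + k + m + 2 then kernel_coeff b e q \<phi> n k m else 0) =
              (\<Sum>m<N. if N - n - k - 2 = m then kernel_coeff b e q \<phi> n k m else 0)"
          by (intro sum.cong refl if_cong) (use True in auto)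
        also have "\<dots> = kernel_coeff b e q \<phi> n k (N - n - k - 2)"
          by (subst sum.delta') (use True in auto)
        finally show ?thesis using True by (simp add: kernel_entry_def)
      qed (auto simp: kernel_entry_def)
    qed
    finally show ?thesis .
  qed
  have "kernel_series b e q \<phi> = fps_expansion I 0"
    by (rule fps_ext) (simp only: coeff kernel_series_def fps_nth_Abs_fps)
  thus ?thesis using I_exp unfolding I_def[abs_def] K_def by simp
qed

text \<open>The triangle \<open>k \<le> n\<close> may be enlarged to a square, since
  \<open>b ^ Suc k\<close> has no coefficient of index \<open>Suc n\<close> for
  \<open>n < k\<close>. With \<open>k\<close> outermost the sum matches the Taylor and Lagrange
  expansions term by term.\<close>

lemma fps_nth_kernel_series:
  assumes b0: "fps_nth b 0 = 0"
  shows "fps_nth (kernel_series b e q \<phi>) N = (\<Sum>k\<le>N. \<Sum>n\<le>N. kernel_entry b e q \<phi> N k n)"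
proof -
  have zero: "kernel_coeff b e q \<phi> n k m = 0" if "n < k" for n k m
    using startsby_zero_power_prefix[OF b0, of "Suc k"] that by (simp add: kernel_coeff_def)
  have "(\<Sum>n<N. \<Sum>k\<le>n. kernel_entry b e q \<phi> N k n) = (\<Sum>n<N. \<Sum>k\<le>N. kernel_entry b e q \<phi> N k n)"
    by (intro sum.cong refl sum.mono_neutral_left) (auto simp: zero kernel_entry_def)
  also have "\<dots> = (\<Sum>n\<le>N. \<Sum>k\<le>N. kernel_entry b e q \<phi> N k n)"
    by (intro sum.mono_neutral_left) (auto simp: kernel_entry_def)
  finally show ?thesis
    unfolding kernel_series_def fps_nth_Abs_fps by (subst sum.swap)
qed

section \<open>Coefficients of the transformed composition operators\<close>

lemma fps_nth_mult_Suc: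
  assumes "fps_nth (f :: complex fps) 0 = 0"
  shows "fps_nth (f * g) (Suc N) = (\<Sum>n\<le>N. fps_nth f (Suc n) * fps_nth g (N - n))"
  unfolding fps_mult_nth atLeast0AtMost sum.atMost_Suc_shift using assms by simp

text \<open>The Taylor term of index 0 gives \<phi>. In the term of index \<open>Suc k\<close>, the
  product of \<open>b ^ Suc k\<close> with a derivative of \<Phi> becomes a convolution, and the
  factorials of the Borel transform combine to the quotient in \<open>kernel_coeff\<close>.\<close>

lemma borel_comp_shift_nth:
  assumes b0: "fps_nth b 0 = 0" and \<Phi>0: "fps_nth \<Phi> 0 = 0" and \<phi>: "\<phi> = borel_transform \<Phi>"
  shows "fps_nth (borel_transform (comp_shift \<Phi> b)) N =
     fps_nth \<phi> N - (\<Sum>k\<le>N. \<Sum>n\<le>N. kernel_entry b (\<lambda>k. (- 1) ^ k) (\<lambda>k. k) \<phi> N k n)"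
proof -
  have \<Phi>: "fps_nth \<Phi> (Suc m) = fact m * fps_nth \<phi> m" for m
    by (simp add: \<phi> borel_transform_def)
  have ddz: "fps_nth ((ddz ^^ Suc k) \<Phi>) (N - n) = (if n + k + 2 \<le> N then - ((- 1) ^ k * fact (N - n
      - 1) * fps_nth \<phi> (N - n - k - 2)) else 0)" for n k
  proof (cases "n + k + 2 \<le> N")
    case True
    define m where "m = N - n - k - 2"
    have Nn: "N - n = Suc m + Suc k" "N - n - 1 = m + Suc k" using True by (auto simp: m_def)
    show ?thesis
      unfolding Nn fps_nth_ddz_funpow \<Phi> using True by (simp add: m_def)
  next
    case False
    have "ord_ge (1 + Suc k) ((ddz ^^ Suc k) \<Phi>)"
      by (rule ord_ge_ddz_funpow) (simp add: ord_ge_def \<Phi>0)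
    thus ?thesis using False by (auto simp: ord_ge_def simp del: funpow.simps)
  qed
  have coef: "fps_nth (fps_const (1 / fact (Suc k)) * b ^ Suc k * (ddz ^^ Suc k) \<Phi>) (Suc N) / fact N
      =
        - (\<Sum>n\<le>N. kernel_entry b (\<lambda>k. (- 1) ^ k) (\<lambda>k. k) \<phi> N k n)" for k
  proof -
    have "fps_nth (fps_const (1 / fact (Suc k)) * b ^ Suc k * (ddz ^^ Suc k) \<Phi>) (Suc N) =
          1 / fact (Suc k) * fps_nth (b ^ Suc k * (ddz ^^ Suc k) \<Phi>) (Suc N)"
      by (simp only: mult.assoc fps_mult_left_const_nth)
    also have "fps_nth (b ^ Suc k * (ddz ^^ Suc k) \<Phi>) (Suc N) = (\<Sum>n\<le>N. fps_nth (b ^ Suc k) (Suc n) *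
        fps_nth ((ddz ^^ Suc k) \<Phi>) (N - n))"
      by (rule fps_nth_mult_Suc) (simp add: b0)
    finally have "fps_nth (fps_const (1 / fact (Suc k)) * b ^ Suc k * (ddz ^^ Suc k) \<Phi>) (Suc N) /
        fact N =
        (\<Sum>n\<le>N. 1 / fact (Suc k) * (fps_nth (b ^ Suc k) (Suc n) * fps_nth ((ddz ^^ Suc k) \<Phi>) (N - n))
            / fact N)"
      by (simp only: sum_distrib_left sum_divide_distrib)
    also have "\<dots> = (\<Sum>n\<le>N. - kernel_entry b (\<lambda>k. (- 1) ^ k) (\<lambda>k. k) \<phi> N k n)"
    proof (intro sum.cong refl)
      fix n
      show "1 / fact (Suc k) * (fps_nth (b ^ Suc k) (Suc n) * fps_nth ((ddz ^^ Suc k) \<Phi>) (N - n)) /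
          fact N =
        - kernel_entry b (\<lambda>k. (- 1) ^ k) (\<lambda>k. k) \<phi> N k n"
      proof (cases "n + k + 2 \<le> N")
        case True
        hence "k + (N - n - k - 2) + 1 = N - n - 1" "n + k + (N - n - k - 2) + 2 = N" by auto
        thus ?thesis
          unfolding ddz kernel_entry_def kernel_coeff_def using True by (simp del: fact_Suc
              power_Suc)
      qed (simp add: ddz kernel_entry_def del: funpow.simps)
    qed
    finally show ?thesis by (simp only: sum_negf)
  qed
  have "fps_nth (borel_transform (comp_shift \<Phi> b)) N =
        (\<Sum>k\<le>Suc N. fps_nth (fps_const (1 / fact k) * b ^ k * (ddz ^^ k) \<Phi>) (Suc N) / fact N)"
    by (simp only: borel_transform_def fps_nth_Abs_fps fps_nth_comp_shift sum_divide_distrib)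
  also have "\<dots> = fps_nth \<phi> N + (\<Sum>k\<le>N. fps_nth (fps_const (1 / fact (Suc k)) * b ^ Suc k * (ddz ^^
      Suc k) \<Phi>) (Suc N) / fact N)"
    unfolding sum.atMost_Suc_shift by (simp add: \<Phi> del: fact_Suc power_Suc funpow.simps(2))
  finally show ?thesis by (simp only: coef sum_negf) simp
qed

text \<open>The \<open>k\<close> outer derivatives become a factor \<open>z ^ k\<close> outside the
  convolution, hence the exponent 0 of \<open>w\<close>. The signs of Lagrange's formula, of the
  outer derivatives and of \<open>ddz \<Phi>\<close> multiply to 1.\<close>

lemma borel_lagrange_inverse_nth:
  assumes b0: "fps_nth b 0 = 0" and \<Phi>0: "fps_nth \<Phi> 0 = 0" and \<phi>: "\<phi> = borel_transform \<Phi>"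
  shows "fps_nth (borel_transform (lagrange_inverse b \<Phi>)) N =
     fps_nth \<phi> N + (\<Sum>k\<le>N. \<Sum>n\<le>N. kernel_entry b (\<lambda>k. 1) (\<lambda>k. 0) \<phi> N k n)"
proof -
  have \<Phi>: "fps_nth \<Phi> (Suc m) = fact m * fps_nth \<phi> m" for m
    by (simp add: \<phi> borel_transform_def)
  have dd: "fps_nth (ddz \<Phi>) M = (if 2 \<le> M then - (fact (M - 1) * fps_nth \<phi> (M - 2)) else 0)" for M
  proof (cases "2 \<le> M")
    case True
    then obtain m where "M = Suc (Suc m)" by (metis add_2_eq_Suc le_Suc_ex)
    thus ?thesis by (simp add: fps_nth_ddz \<Phi> algebra_simps)
  next
    case False
    hence "M = 0 \<or> M = 1" by auto
    thus ?thesis by (auto simp: fps_nth_ddz)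
  qed
  have coef: "fps_nth (lagrange_term b (Suc k) \<Phi>) (Suc N) / fact N =
     (\<Sum>n\<le>N. kernel_entry b (\<lambda>k. 1) (\<lambda>k. 0) \<phi> N k n)" if "k \<le> N" for k
  proof -
    \<comment> \<open>The outer derivatives are stripped off first; they shift the index by
      \<open>k\<close>.\<close>
    have "Suc N = Suc (N - k) + k" using that by simp
    hence "fps_nth ((ddz ^^ k) (b ^ Suc k * ddz \<Phi>)) (Suc N) = (- 1) ^ k * fact N / fact (N - k) *
        fps_nth (b ^ Suc k * ddz \<Phi>) (Suc (N - k))"
      using fps_nth_ddz_funpow[of k "b ^ Suc k * ddz \<Phi>" "N - k"] that by simp
    also have "fps_nth (b ^ Suc k * ddz \<Phi>) (Suc (N - k)) = (\<Sum>n\<le>N - k. fps_nth (b ^ Suc k) (Suc n) *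
        fps_nth (ddz \<Phi>) (N - k - n))"
      by (rule fps_nth_mult_Suc) (simp add: b0)
    finally have "fps_nth (lagrange_term b (Suc k) \<Phi>) (Suc N) / fact N =
       (\<Sum>n\<le>N - k. (- 1) ^ Suc k / fact (Suc k) * ((- 1) ^ k * fact N / fact (N - k) * (fps_nth (b ^
           Suc k) (Suc n) * fps_nth (ddz \<Phi>) (N - k - n))) / fact N)"
      by (simp only: lagrange_term.simps fps_mult_left_const_nth sum_distrib_left
          sum_divide_distrib)
    also have "\<dots> = (\<Sum>n\<le>N - k. kernel_entry b (\<lambda>k. 1) (\<lambda>k. 0) \<phi> N k n)"
    proof (intro sum.cong refl)
      fix n assume "n \<in> {..N - k}"
      show "(- 1) ^ Suc k / fact (Suc k) * ((- 1) ^ k * fact N / fact (N - k) * (fps_nth (b ^ Suc k)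
          (Suc n) * fps_nth (ddz \<Phi>) (N - k - n))) / fact N =
         kernel_entry b (\<lambda>k. 1) (\<lambda>k. 0) \<phi> N k n"
      proof (cases "n + k + 2 \<le> N")
        case True
        define m where "m = N - n - k - 2"
        have eqs: "N - k - n - 2 = m" "N - k - n - 1 = m + 1" "n + 0 + m + 2 = N - k" "2 \<le> N - k -
            n" "0 + m + 1 = m + 1"
          using True by (auto simp: m_def)
        have sgn: "(- 1) ^ Suc k * (- 1) ^ k = (- 1 :: complex)"
          by (simp add: power_mult_distrib[symmetric] flip: power_add)
        have "(- 1) ^ Suc k / fact (Suc k) * ((- 1) ^ k * fact N / fact (N - k) * (fps_nth (b ^ Suc
            k) (Suc n) * - (fact (m + 1) * fps_nth \<phi> m))) / fact N
          = - ((- 1) ^ Suc k * (- 1) ^ k) * (fps_nth (b ^ Suc k) (Suc n) / fact (Suc k) * fps_nth \<phi>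
              m * (fact (m + 1) / fact (N - k)))"
          by (simp add: mult_ac del: fact_Suc power_Suc)
        also have "\<dots> = kernel_coeff b (\<lambda>k. 1) (\<lambda>k. 0) \<phi> n k m"
          unfolding sgn kernel_coeff_def eqs by simp
        finally show ?thesis
          unfolding dd eqs kernel_entry_def using True eqs(4) by (simp only: m_def if_True)
      next
        case False
        hence "\<not> 2 \<le> N - k - n" by linarith
        thus ?thesis using False by (simp add: dd kernel_entry_def)
      qed
    qed
    also have "\<dots> = (\<Sum>n\<le>N. kernel_entry b (\<lambda>k. 1) (\<lambda>k. 0) \<phi> N k n)"
      by (intro sum.mono_neutral_left) (auto simp: kernel_entry_def)
    finally show ?thesis .
  qed
  have "fps_nth (borel_transform (lagrange_inverse b \<Phi>)) N = (\<Sum>k\<le>Suc N. fps_nth (lagrange_term b k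
      \<Phi>) (Suc N) / fact N)"
    by (simp only: borel_transform_def fps_nth_Abs_fps lagrange_inverse_def sum_divide_distrib)
  also have "\<dots> = fps_nth \<phi> N + (\<Sum>k\<le>N. fps_nth (lagrange_term b (Suc k) \<Phi>) (Suc N) / fact N)"
    unfolding sum.atMost_Suc_shift by (simp add: \<Phi> del: lagrange_term.simps(2))
  also have "(\<Sum>k\<le>N. fps_nth (lagrange_term b (Suc k) \<Phi>) (Suc N) / fact N) =
     (\<Sum>k\<le>N. \<Sum>n\<le>N. kernel_entry b (\<lambda>k. 1) (\<lambda>k. 0) \<phi> N k n)"
    by (intro sum.cong refl coef) auto
  finally show ?thesis .
qed

lemma borel_comp_shift_minus_one:
  assumes \<Phi>0: "fps_nth \<Phi> 0 = 0"
  shows "borel_transform (comp_shift \<Phi> (- 1)) = fps_exp 1 * borel_transform \<Phi>"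
proof (rule fps_ext)
  fix N
  have \<Phi>: "fps_nth \<Phi> (Suc m) = fact m * fps_nth (borel_transform \<Phi>) m" for m
    by (simp add: borel_transform_def)
  have coef: "fps_nth (fps_const (1 / fact k) * (- 1) ^ k * (ddz ^^ k) \<Phi>) (Suc N) / fact N =
     (if k \<le> N then 1 / fact k * fps_nth (borel_transform \<Phi>) (N - k) else 0)" if "k \<le> Suc N" for k
  proof -
    have "(- 1 :: complex fps) = fps_const (- 1)" by (rule fps_ext) simp
    hence "(- 1 :: complex fps) ^ k = fps_const ((- 1) ^ k)" by (simp only: fps_const_power)
    hence "fps_const (1 / fact k) * (- 1) ^ k = fps_const ((- 1) ^ k / fact k :: complex)"
      by (simp only: fps_const_mult mult_1_left times_divide_eq_left)
    hence e: "fps_nth (fps_const (1 / fact k) * (- 1) ^ k * (ddz ^^ k) \<Phi>) (Suc N) = (- 1) ^ k / fact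
        k * fps_nth ((ddz ^^ k) \<Phi>) (Suc N)"
      by (simp only: fps_mult_left_const_nth)
    show ?thesis
    proof (cases "k \<le> N")
      case True
      hence "Suc N = Suc (N - k) + k" by simp
      hence "fps_nth ((ddz ^^ k) \<Phi>) (Suc N) = (- 1) ^ k * fact N / fact (N - k) * fps_nth \<Phi> (Suc (N
          - k))"
        using fps_nth_ddz_funpow[of k \<Phi> "N - k"] True by simp
      moreover have "(- 1) ^ k * (- 1) ^ k = (1 :: complex)" by (simp flip: power_mult_distrib)
      ultimately show ?thesis unfolding e \<Phi> using True by (simp add: field_simps)
    next
      case False
      \<comment> \<open>The last Taylor term contributes nothing: \<Phi> starts at \<open>X\<close>,
        so its k-th derivative starts at \<open>X ^ Suc k\<close>, one beyond the index in
        question.\<close>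
      hence "k = Suc N" using that by simp
      moreover have "ord_ge (1 + k) ((ddz ^^ k) \<Phi>)"
        by (rule ord_ge_ddz_funpow) (simp add: ord_ge_def \<Phi>0)
      ultimately show ?thesis unfolding e using False by (simp add: ord_ge_def)
    qed
  qed
  have "fps_nth (borel_transform (comp_shift \<Phi> (- 1))) N =
        (\<Sum>k\<le>Suc N. fps_nth (fps_const (1 / fact k) * (- 1) ^ k * (ddz ^^ k) \<Phi>) (Suc N) / fact N)"
    by (simp only: borel_transform_def fps_nth_Abs_fps fps_nth_comp_shift sum_divide_distrib)
  also have "\<dots> = (\<Sum>k\<le>Suc N. if k \<le> N then 1 / fact k * fps_nth (borel_transform \<Phi>) (N - k) else 0)"
    by (intro sum.cong refl coef) auto
  also have "\<dots> = (\<Sum>k\<le>N. 1 / fact k * fps_nth (borel_transform \<Phi>) (N - k))"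
    by simp
  also have "\<dots> = fps_nth (fps_exp 1 * borel_transform \<Phi>) N"
    by (simp add: fps_mult_nth atLeast0AtMost)
  finally show "fps_nth (borel_transform (comp_shift \<Phi> (- 1))) N = fps_nth (fps_exp 1 *
      borel_transform \<Phi>) N" .
qed

subsection \<open>The data attached to a parabolic germ\<close>

lemma exp_type_borel:
  assumes f: "fps_conv_radius f > 0"
  shows "fps_conv_radius (borel_transform f) = \<infinity>" and "exp_type (eval_fps (borel_transform f))"
proof -
  obtain C R where CR: "C > 0" "R > 0" "\<And>n. norm (fps_nth f n) \<le> C * R ^ n"
    using fps_nth_norm_bound[OF f] by metis
  have bound: "norm (fps_nth (borel_transform f) n * z ^ n) \<le> C * R * ((R * norm z) ^ n / fact n)"
      for n z
  proof -
    have "norm (fps_nth (borel_transform f) n * z ^ n) = norm (fps_nth f (Suc n)) * (norm z ^ n /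
        fact n)"
      by (simp add: borel_transform_def norm_mult norm_divide norm_power)
    also have "\<dots> \<le> (C * R ^ Suc n) * (norm z ^ n / fact n)"
      by (intro mult_right_mono CR(3)) auto
    also have "\<dots> = C * R * ((R * norm z) ^ n / fact n)" by (simp add: power_mult_distrib)
    finally show ?thesis .
  qed
  show conv: "fps_conv_radius (borel_transform f) = \<infinity>"
    unfolding fps_conv_radius_def
    by (rule conv_radius_inftyI'') (rule summable_comparison_test'[OF summable_exp_div, of 0], rule
        bound)
  have "norm (eval_fps (borel_transform f) z) \<le> (C * R) * exp (R * norm z)" for z
  proof -
    have "norm (eval_fps (borel_transform f) z) \<le> (\<Sum>n. C * R * ((R * norm z) ^ n / fact n))"
      unfolding eval_fps_def by (rule norm_suminf_le[OF bound summable_exp_div])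
    also have "\<dots> = C * R * exp (R * norm z)"
      using summable_exp[of "R * norm z"] by (subst suminf_mult) (simp_all add: exp_def
          divide_inverse mult.commute)
    finally show ?thesis .
  qed
  moreover have "eval_fps (borel_transform f) holomorphic_on UNIV"
    by (rule holomorphic_on_eval_fps) (simp add: conv)
  ultimately show "exp_type (eval_fps (borel_transform f))"
    unfolding exp_type_def by (intro conjI exI allI)
qed

text \<open>With \<open>g = X * u\<close> for - c F(- X / c), the germ at infinity is the reciprocal
  of \<open>g\<close>. Hence \<open>inverse u = 1 + (1 + a) * X\<close>, and convergence passes from
  \<open>F\<close> to \<open>u\<close>, to its inverse and to \<open>a\<close>.\<close>

lemma a_series_conv_radius:
  assumes F: "fps_conv_radius F > 0"
    and norm: "fps_nth F 0 = 0" "fps_nth F 1 = 1" "fps_nth F 2 = c" "c \<noteq> 0"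
  shows "fps_conv_radius (a_series F c) > 0"
proof -
  define a where "a = a_series F c"
  define g where "g = fps_const (- c) * fps_compose F (fps_const (- 1 / c) * fps_X)"
  have g_nth: "fps_nth g n = - c * ((- 1 / c) ^ n * fps_nth F n)" for n
    by (simp add: g_def fps_compose_linear)
  obtain C R where CR: "C > 0" "R > 0" "\<And>n. norm (fps_nth F n) \<le> C * R ^ n"
    using fps_nth_norm_bound[OF F] by metis
  have g_conv: "fps_conv_radius g > 0"
  proof (rule fps_conv_radius_pos_of_bound)
    show "R / norm c > 0" using CR norm(4) by simp
    fix n
    have "norm (fps_nth g n) = norm c * (1 / norm c) ^ n * norm (fps_nth F n)"
      by (simp add: g_nth norm_mult norm_power norm_divide)
    also have "\<dots> \<le> norm c * (1 / norm c) ^ n * (C * R ^ n)"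
      by (intro mult_left_mono CR(3)) auto
    also have "\<dots> = (norm c * C) * (R / norm c) ^ n" by (simp add: power_divide)
    finally show "norm (fps_nth g n) \<le> (norm c * C) * (R / norm c) ^ n" .
  qed
  define u where "u = fps_shift 1 g"
  have g: "g = fps_X * u"
    by (rule fps_ext) (use norm in \<open>auto simp: u_def g_nth\<close>)
  have u0: "fps_nth u 0 = 1" using norm by (simp add: u_def g_nth)
  have g_nz: "g \<noteq> 0" using u0 by (auto simp: g)
  have "germ_at_infinity F c = inverse (fps_to_fls g)"
  proof -
    have "fls_const (- c) * fps_to_fls (fps_compose F (fps_const (- 1 / c) * fps_X)) = fps_to_fls g"
      by (simp add: g_def fls_times_fps_to_fls del: fls_const_uminus fps_const_neg)
    thus ?thesis
      unfolding germ_at_infinity_def by (simp only: fls_const_uminus mult_minus_left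
          inverse_minus_eq flip: \<open>fls_const (- c) * _ = _\<close>)
  qed
  hence "germ_at_infinity F c * fps_to_fls g = 1"
    using g_nz by (simp add: fps_to_fls_eq_0_iff)
  hence "(fls_X_inv + 1 + fps_to_fls a) * (fls_X * fps_to_fls u) = 1"
    unfolding germ_at_infinity_eq(1)[OF norm] a_def[symmetric] by (simp add: g fls_times_fps_to_fls)
  moreover have X: "fls_X_inv * fls_X = (1 :: complex fls)"
    by (simp add: fls_X_inv_times_conv_shift)
  have "(fls_X_inv + 1 + fps_to_fls a) * (fls_X * fps_to_fls u) =
        (fls_X_inv * fls_X) * fps_to_fls u + (1 + fps_to_fls a) * fls_X * fps_to_fls u"
    by (simp only: algebra_simps)
  hence "(fls_X_inv + 1 + fps_to_fls a) * (fls_X * fps_to_fls u) = fps_to_fls ((1 + (1 + a) * fps_X)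
      * u)"
    unfolding X by (simp add: fls_times_fps_to_fls algebra_simps)
  ultimately have "fps_to_fls ((1 + (1 + a) * fps_X) * u) = fps_to_fls 1" by simp
  hence "(1 + (1 + a) * fps_X) * u = 1" by (simp only: fps_to_fls_eq_iff)
  hence "inverse u = 1 + (1 + a) * fps_X"
    by (metis fps_inverse_unique mult.commute)
  hence a: "a = fps_shift 1 (inverse u - 1 - fps_X)"
    by (intro fps_ext) (simp add: algebra_simps)
  have "fps_conv_radius (inverse u) > 0"
    by (rule fps_conv_radius_inverse_pos) (use u0 g_conv in \<open>auto simp: u_def\<close>)
  hence "fps_conv_radius (inverse u - 1) > 0"
    using fps_conv_radius_diff[of "inverse u" 1] by (auto intro: less_le_trans)
  hence "fps_conv_radius (inverse u - 1 - fps_X) > 0"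
    using fps_conv_radius_diff[of "inverse u - 1" fps_X] by (auto intro: less_le_trans)
  thus ?thesis unfolding a_def[symmetric] a by simp
qed

text \<open>Read off in the Borel plane, where the shift is multiplication by the exponential
  series; restoring the factorial of \<open>N\<close> produces the binomial coefficients.\<close>

lemma comp_shift_minus_one_nth:
  assumes "fps_nth a 0 = 0"
  shows "fps_nth (comp_shift a (- 1)) (Suc N) = (\<Sum>k\<le>N. of_nat (N choose k) * fps_nth a (Suc (N -
      k)))"
proof -
  have "fps_nth (comp_shift a (- 1)) (Suc N) = fact N * fps_nth (borel_transform (comp_shift a (-
      1))) N"
    by (simp add: borel_transform_def)
  also have "\<dots> = fact N * (\<Sum>k\<le>N. 1 / fact k * (fps_nth a (Suc (N - k)) / fact (N - k)))"
    unfolding borel_comp_shift_minus_one[OF assms]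
    by (simp add: fps_mult_nth atLeast0AtMost borel_transform_def)
  also have "\<dots> = (\<Sum>k\<le>N. of_nat (N choose k) * fps_nth a (Suc (N - k)))"
    unfolding sum_distrib_left
  proof (rule sum.cong[OF refl])
    fix k assume "k \<in> {..N}"
    thus "fact N * (1 / fact k * (fps_nth a (Suc (N - k)) / fact (N - k))) = of_nat (N choose k) *
        fps_nth a (Suc (N - k))"
      by (simp add: binomial_fact)
  qed
  finally show ?thesis .
qed

text \<open>By the binomial theorem a geometric bound with rate \<open>R\<close> turns into one with
  rate \<open>1 + R\<close>.\<close>

lemma comp_shift_minus_one_conv_radius:
  assumes a: "fps_conv_radius a > 0" and a0: "fps_nth a 0 = 0"
  shows "fps_conv_radius (comp_shift a (- 1)) > 0"
proof -
  obtain C R where CR: "C > 0" "R > 0" "\<And>n. norm (fps_nth a n) \<le> C * R ^ n"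
    using fps_nth_norm_bound[OF a] by metis
  show ?thesis
  proof (rule fps_conv_radius_pos_of_bound)
    show "1 + R > 0" using CR by simp
    fix n
    show "norm (fps_nth (comp_shift a (- 1)) n) \<le> C * (1 + R) ^ n"
    proof (cases n)
      case 0
      thus ?thesis using CR a0 by (simp add: fps_nth_comp_shift)
    next
      case (Suc N)
      have "norm (fps_nth (comp_shift a (- 1)) (Suc N)) \<le> (\<Sum>k\<le>N. norm (of_nat (N choose k) * fps_nth
          a (Suc (N - k))))"
        unfolding comp_shift_minus_one_nth[OF a0] by (rule norm_sum)
      also have "\<dots> \<le> (\<Sum>k\<le>N. of_nat (N choose k) * (C * R ^ Suc (N - k)))"
        unfolding norm_mult norm_of_nat by (intro sum_mono mult_left_mono CR(3)) auto
      also have "\<dots> = C * R * (\<Sum>k\<le>N. of_nat (N choose k) * 1 ^ k * R ^ (N - k))"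
        unfolding sum_distrib_left by (rule sum.cong) auto
      also have "\<dots> = C * R * (1 + R) ^ N" by (simp only: binomial_ring)
      also have "\<dots> \<le> C * (1 + R) * (1 + R) ^ N"
        using CR by (intro mult_right_mono mult_left_mono) auto
      finally show ?thesis by (simp add: Suc)
    qed
  qed
qed

lemma b_series_props:
  assumes F: "fps_conv_radius F > 0"
    and norm: "fps_nth F 0 = 0" "fps_nth F 1 = 1" "fps_nth F 2 = c" "c \<noteq> 0"
  shows "fps_conv_radius (b_series F c) > 0" "fps_nth (b_series F c) 0 = 0" "fps_nth (b_series F c)
      1 = - resit F c"
proof -
  note a0 = germ_at_infinity_eq(2)[OF norm]
  show "fps_conv_radius (b_series F c) > 0"
    unfolding b_series_def by (rule comp_shift_minus_one_conv_radius[OF a_series_conv_radius[OF F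
        norm] a0])
  show "fps_nth (b_series F c) 0 = 0" by (simp add: b_series_def fps_nth_comp_shift a0)
  show "fps_nth (b_series F c) 1 = - resit F c"
    using comp_shift_minus_one_nth[OF a0, of 0] by (simp add: b_series_def resit_def)
qed

text \<open>The logarithm starts with \<open>X\<close>, so \<open>resit F c\<close> times it cancels
  the leading coefficient \<open>- resit F c\<close> of \<open>b\<close>. Since the coefficient of
  \<open>X\<close> in \<open>b1\<close> is the value at 0 of the inhomogeneous term, this
  cancellation is what permits a solution holomorphic at the origin.\<close>

lemma b1_series_props:
  assumes F: "fps_conv_radius F > 0"
    and norm: "fps_nth F 0 = 0" "fps_nth F 1 = 1" "fps_nth F 2 = c" "c \<noteq> 0"
  shows "fps_conv_radius (b1_series F c) > 0" "fps_nth (b1_series F c) 0 = 0" "fps_nth (b1_series F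
      c) 1 = 0"
proof -
  define b where "b = b_series F c"
  note b = b_series_props[OF F norm, folded b_def]
  define J where "J = inverse (1 - fps_X :: complex fps)"
  have J: "J * (1 - fps_X) = 1" unfolding J_def by (rule inverse_mult_eq_1) simp
  have J0: "fps_nth J 0 = 1" by (simp add: J_def)
  have "fps_nth (J * (1 - fps_X)) 1 = 0" unfolding J by simp
  hence J1: "fps_nth J 1 = 1" using J0 by (simp add: fps_mult_nth)
  define H where "H = (1 + fps_X * b) / (1 - fps_X) - 1"
  have H: "H = (1 + fps_X * b) * J - 1"
    unfolding H_def J_def by (subst fps_divide_unit) simp_all
  have H0: "fps_nth H 0 = 0" by (simp add: H J0)
  have H1: "fps_nth H 1 = 1" using b(2) J1 by (simp add: H fps_mult_nth J0)
  have "fps_conv_radius J > 0"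
    unfolding J_def
  proof (rule fps_conv_radius_inverse_pos)
    show "fps_conv_radius (1 - fps_X :: complex fps) > 0"
      by (rule less_le_trans[OF _ fps_conv_radius_diff]) simp
  qed simp
  moreover have "fps_conv_radius (fps_X * b) > 0"
    by (rule less_le_trans[OF _ fps_conv_radius_mult]) (use b in simp)
  hence "fps_conv_radius (1 + fps_X * b) > 0"
    by (intro less_le_trans[OF _ fps_conv_radius_add]) simp
  ultimately have "fps_conv_radius ((1 + fps_X * b) * J) > 0"
    by (intro less_le_trans[OF _ fps_conv_radius_mult]) simp
  hence H_conv: "fps_conv_radius H > 0"
    unfolding H by (intro less_le_trans[OF _ fps_conv_radius_diff]) simp
  have "(eval_fps (fps_ln 1) \<circ> eval_fps H) has_fps_expansion fps_compose (fps_ln 1) H"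
    by (intro has_fps_expansion_compose eval_fps_has_fps_expansion H_conv H0) simp
  hence L_conv: "fps_conv_radius (fps_compose (fps_ln 1) H) > 0"
    by (simp add: has_fps_expansion_def)
  have b1: "b1_series F c = b + fps_const (resit F c) * fps_compose (fps_ln 1) H"
    by (simp add: b1_series_def b_def H_def)
  have "fps_conv_radius (fps_const (resit F c) * fps_compose (fps_ln 1) H) > 0"
    by (rule less_le_trans[OF _ fps_conv_radius_mult]) (use L_conv in simp)
  thus "fps_conv_radius (b1_series F c) > 0"
    unfolding b1 by (intro less_le_trans[OF _ fps_conv_radius_add]) (use b(1) in simp)
  have ln: "fps_nth (fps_ln 1 :: complex fps) 0 = 0" "fps_nth (fps_ln 1 :: complex fps) 1 = 1"
    by (simp_all add: fps_ln_def)
  show "fps_nth (b1_series F c) 0 = 0"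
    using b(2) ln(1) by (simp add: b1 fps_compose_nth)
  show "fps_nth (b1_series F c) 1 = 0"
    using b(3) ln H1 by (simp add: b1 fps_compose_nth)
qed

subsection \<open>Resurgence of the formal solution\<close>

lemma entire_shift_kernel_right:
  "fps_conv_radius b > 0 \<Longrightarrow> entire_kernel (\<lambda>z w. shift_kernel b (- w) (z - w))"
  using entire_shift_kernel[of b 0 "- 1"] by simp

lemma entire_shift_kernel_left:
  "fps_conv_radius b > 0 \<Longrightarrow> entire_kernel (\<lambda>z w. shift_kernel b z (z - w))"
  using entire_shift_kernel[of b 1 0] by simp

lemma borel_comp_shift_expansion:
  assumes b: "fps_conv_radius b > 0" "fps_nth b 0 = 0" and \<Phi>0: "fps_nth \<Phi> 0 = 0"
    and \<phi>: "\<phi> = borel_transform \<Phi>" "fps_conv_radius \<phi> > 0"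
  shows "(\<lambda>z. eval_fps \<phi> z + contour_integral (linepath 0 z) (\<lambda>w. right_kernel b z w * (w * eval_fps
      \<phi> w)))
           has_fps_expansion borel_transform (comp_shift \<Phi> b)"
proof -
  have "(\<lambda>z. contour_integral (linepath 0 z) (\<lambda>w. shift_kernel b (- w) (z - w) * (w * eval_fps \<phi>
      w)))
           has_fps_expansion
         kernel_series b (\<lambda>k. (- 1) ^ k) (\<lambda>k. k) \<phi>"
  proof (rule shift_kernel_integral_expansion[OF b(1) \<phi>(2) entire_shift_kernel_right[OF b(1)], where
      p = "\<lambda>_. 0"])
    show "(- w) ^ k = (- 1) ^ k * z ^ 0 * w ^ k" for z w :: complex and k
      by (simp only: power_minus[of w] power_0 mult_1_right)
    show "continuous_on UNIV (\<lambda>x :: complex \<times> complex. - snd x)" by (intro continuous_intros)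
  qed simp_all
  hence "(\<lambda>z. eval_fps \<phi> z - contour_integral (linepath 0 z) (\<lambda>w. shift_kernel b (- w) (z - w) * (w
      * eval_fps \<phi> w)))
           has_fps_expansion
         \<phi> - kernel_series b (\<lambda>k. (- 1) ^ k) (\<lambda>k. k) \<phi>"
    by (intro has_fps_expansion_diff eval_fps_has_fps_expansion \<phi>(2))
  also have "\<phi> - kernel_series b (\<lambda>k. (- 1) ^ k) (\<lambda>k. k) \<phi>
     = borel_transform (comp_shift \<Phi> b)"
    by (rule fps_ext) (simp only: fps_sub_nth fps_nth_kernel_series[OF b(2)] borel_comp_shift_nth[OF
        b(2) \<Phi>0 \<phi>(1)])
  finally show ?thesis
    unfolding right_kernel_def mult_minus_left contour_integral_neg by (simp only:
        diff_conv_add_uminus)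
qed

lemma borel_lagrange_inverse_expansion:
  assumes b: "fps_conv_radius b > 0" "fps_nth b 0 = 0" and \<Phi>0: "fps_nth \<Phi> 0 = 0"
    and \<phi>: "\<phi> = borel_transform \<Phi>" "fps_conv_radius \<phi> > 0"
  shows "(\<lambda>z. eval_fps \<phi> z + contour_integral (linepath 0 z) (\<lambda>w. shift_kernel b z (z - w) * (w *
      eval_fps \<phi> w)))
           has_fps_expansion borel_transform (lagrange_inverse b \<Phi>)"
proof -
  have "(\<lambda>z. contour_integral (linepath 0 z) (\<lambda>w. shift_kernel b z (z - w) * (w * eval_fps \<phi> w)))
           has_fps_expansion
         kernel_series b (\<lambda>k. 1) (\<lambda>k. 0) \<phi>"
  proof (rule shift_kernel_integral_expansion[OF b(1) \<phi>(2) entire_shift_kernel_left[OF b(1)], where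
      p = "\<lambda>k. k"])
    show "continuous_on UNIV (\<lambda>x :: complex \<times> complex. fst x)" by (intro continuous_intros)
  qed simp_all
  hence "(\<lambda>z. eval_fps \<phi> z + contour_integral (linepath 0 z) (\<lambda>w. shift_kernel b z (z - w) * (w *
      eval_fps \<phi> w)))
           has_fps_expansion
         \<phi> + kernel_series b (\<lambda>k. 1) (\<lambda>k. 0) \<phi>"
    by (intro has_fps_expansion_add eval_fps_has_fps_expansion \<phi>(2))
  also have "\<phi> + kernel_series b (\<lambda>k. 1) (\<lambda>k. 0) \<phi>
     = borel_transform (lagrange_inverse b \<Phi>)"
    by (rule fps_ext) (simp only: fps_add_nth fps_nth_kernel_series[OF b(2)]
        borel_lagrange_inverse_nth[OF b(2) \<Phi>0 \<phi>(1)])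
  finally show ?thesis .
qed

section \<open>Passing between formal solutions and solution germs\<close>

lemma has_fps_expansion_unique_eventually:
  assumes "f has_fps_expansion F" "g has_fps_expansion F"
  shows "\<forall>\<^sub>F z in nhds 0. f z = g z"
proof -
  have "\<forall>\<^sub>F z in nhds 0. eval_fps F z = f z" "\<forall>\<^sub>F z in nhds 0. eval_fps F z = g z"
    using assms by (auto simp: has_fps_expansion_def)
  thus ?thesis by eventually_elim simp
qed

lemma borel_transform_add: "borel_transform (f + g) = borel_transform f + borel_transform g"
  by (rule fps_ext) (simp add: borel_transform_def add_divide_distrib)

lemma borel_transform_inj:
  assumes "borel_transform f = borel_transform g" "fps_nth f 0 = fps_nth g 0"
  shows "f = g"
proof (rule fps_ext)
  fix n
  show "fps_nth f n = fps_nth g n"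
  proof (cases n)
    case (Suc m)
    have "fps_nth (borel_transform f) m = fps_nth (borel_transform g) m" by (simp only: assms(1))
    thus ?thesis by (simp add: borel_transform_def Suc)
  qed (use assms in simp)
qed

lemma exp_mult_expansion:
  fixes \<phi> :: "complex fps"
  assumes "fps_conv_radius \<phi> > 0"
  shows "(\<lambda>z. exp z * eval_fps \<phi> z) has_fps_expansion fps_exp 1 * \<phi>"
  using has_fps_expansion_mult[OF has_fps_expansion_exp[of 1] eval_fps_has_fps_expansion[OF assms]]
      by simp

lemma volterra_germ_right_of_formal:
  assumes b: "fps_conv_radius b > 0" "fps_nth b 0 = 0" and b1: "fps_conv_radius b1 > 0"
    and \<Phi>0: "fps_nth \<Phi> 0 = 0" and eq: "comp_shift \<Phi> (- 1) = comp_shift \<Phi> b + b1"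
    and conv: "fps_conv_radius (borel_transform \<Phi>) > 0"
  shows "volterra_germ (right_kernel b) 0 (borel_transform \<Phi>)"
proof -
  define \<phi> where "\<phi> = borel_transform \<Phi>"
  note conv' = conv[folded \<phi>_def]
  have "(\<lambda>z. exp z * eval_fps \<phi> z) has_fps_expansion fps_exp 1 * \<phi>"
    by (rule exp_mult_expansion[OF conv'])
  also have "fps_exp 1 * \<phi> = borel_transform (comp_shift \<Phi> b) + borel_transform b1"
    using borel_comp_shift_minus_one[OF \<Phi>0] by (simp add: eq borel_transform_add \<phi>_def)
  finally have L: "(\<lambda>z. exp z * eval_fps \<phi> z) has_fps_expansion borel_transform (comp_shift \<Phi> b) +
      borel_transform b1" .
  have "(\<lambda>z. (eval_fps \<phi> z + contour_integral (linepath 0 z) (\<lambda>w. right_kernel b z w * (w * eval_fps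
      \<phi> w))) + eval_fps (borel_transform b1) z)
           has_fps_expansion borel_transform (comp_shift \<Phi> b) + borel_transform b1"
    by (intro has_fps_expansion_add borel_comp_shift_expansion b \<Phi>0 \<phi>_def conv'
        eval_fps_has_fps_expansion)
       (simp add: exp_type_borel[OF b1])
  from has_fps_expansion_unique_eventually[OF L this]
  have "\<forall>\<^sub>F z in nhds 0. volterra_eq (right_kernel b) (eval_fps (borel_transform b1)) 0 (eval_fps \<phi>)
      z"
    by eventually_elim (simp add: volterra_eq_def algebra_simps)
  thus ?thesis
    unfolding volterra_germ_def \<phi>_def[symmetric] using conv' exp_type_borel(2)[OF b1] by auto
qed

text \<open>With \<open>h\<close> the Borel transform of \<open>b1\<close> this is the Borel
  transform of \<open>lagrange_inverse b b1\<close>, the inhomogeneous term of the left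
  equation.\<close>

lemma exp_type_lagrange_borel:
  assumes b: "fps_conv_radius b > 0" and h: "exp_type h"
  shows "exp_type (\<lambda>z. h z + contour_integral (linepath 0 z) (\<lambda>w. shift_kernel b z (z - w) * (w * h
      w)))"
proof (rule exp_type_add[OF h])
  obtain C R where CR: "C > 0" "R > 0" "\<And>x u. norm (shift_kernel b x u) \<le> C * exp (1 * norm x + R *
      norm u)"
    using shift_kernel_bound[OF b zero_less_one] by metis
  obtain A B where AB: "A > 0" "B > 0" "\<And>z. norm (h z) \<le> A * exp (B * norm z)"
    using exp_typeE[OF h] by metis
  have hh: "h holomorphic_on UNIV" by (rule exp_type_holomorphic[OF h])
  have le: "x \<le> exp x" for x :: real using exp_ge_add_one_self[of x] by linarith
  \<comment> \<open>The 3 collects three factors \<open>exp (norm z)\<close>: the growth of the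
    kernel in its first argument, the bound for the factor \<open>w\<close>, and the bound for the
    length of the segment.\<close>
  have "norm (contour_integral (linepath 0 z) (\<lambda>w. shift_kernel b z (z - w) * (w * h w))) \<le> (C * A)
      * exp ((3 + R + B) * norm z)" for z
  proof -
    let ?N = "norm z"
    have "norm (contour_integral (linepath 0 z) (\<lambda>w. shift_kernel b z (z - w) * (w * h w))) \<le>
          (C * exp (1 * ?N + R * ?N) * (exp ?N * (A * exp (B * ?N)))) * norm (z - 0)"
    proof (rule contour_integral_bound_linepath)
      show "(\<lambda>w. shift_kernel b z (z - w) * (w * h w)) contour_integrable_on linepath 0 z"
        by (intro contour_integrable_continuous_linepath continuous_on_mult continuous_on_id
            continuous_on_shift_kernel[OF b]
              continuous_on_const continuous_on_diff continuous_on_subset[OF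
                  holomorphic_on_imp_continuous_on[OF hh] subset_UNIV])
      show "0 \<le> C * exp (1 * ?N + R * ?N) * (exp ?N * (A * exp (B * ?N)))" using CR AB by simp
      fix w assume w: "w \<in> closed_segment 0 z"
      have nw: "norm w \<le> ?N" "norm (z - w) \<le> ?N" using segment_bound[OF w] by (auto simp:
          norm_minus_commute)
      have "norm (shift_kernel b z (z - w)) \<le> C * exp (1 * ?N + R * ?N)"
        by (rule order_trans[OF CR(3)]) (use CR nw in \<open>auto intro!: mult_left_mono\<close>)
      moreover have "norm w \<le> exp ?N" using nw le[of ?N] by linarith
      moreover have "norm (h w) \<le> A * exp (B * ?N)"
        by (rule order_trans[OF AB(3)]) (use AB nw in \<open>auto intro!: mult_left_mono\<close>)
      ultimately show "norm (shift_kernel b z (z - w) * (w * h w)) \<le> C * exp (1 * ?N + R * ?N) *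
          (exp ?N * (A * exp (B * ?N)))"
        unfolding norm_mult using CR AB by (intro mult_mono) auto
    qed
    also have "\<dots> \<le> (C * exp (1 * ?N + R * ?N) * (exp ?N * (A * exp (B * ?N)))) * exp ?N"
      using le[of ?N] CR AB by (intro mult_left_mono) auto
    also have "\<dots> = (C * A) * exp ((3 + R + B) * ?N)"
    proof -
      have "(3 + R + B) * ?N = (1 * ?N + R * ?N) + ?N + B * ?N + ?N" by (simp add: algebra_simps)
      thus ?thesis by (simp only: exp_add mult_ac)
    qed
    finally show ?thesis .
  qed
  moreover have "(\<lambda>z. contour_integral (linepath 0 z) (\<lambda>w. shift_kernel b z (z - w) * (w * h w)))
      holomorphic_on UNIV"
    by (rule holomorphic_on_volterra_integral[OF entire_shift_kernel_left[OF b] open_UNIV _ hh])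
        simp
  ultimately show "exp_type (\<lambda>z. contour_integral (linepath 0 z) (\<lambda>w. shift_kernel b z (z - w) * (w
      * h w)))"
    unfolding exp_type_def by (intro conjI exI allI)
qed

text \<open>Applying the Lagrange inverse L to the functional equation, with \<Psi> = \<Phi>(z - 1),
  gives L \<Psi> = \<Phi> + L \<open>b1\<close>. The Borel transform of \<Psi> is \<open>exp\<close>
  times that of \<Phi>, which turns this into an equation for the latter with kernel
  \<open>left_kernel b\<close>.\<close>

lemma volterra_germ_left_of_formal:
  assumes b: "fps_conv_radius b > 0" "fps_nth b 0 = 0" and b1: "fps_conv_radius b1 > 0" "fps_nth b1
      0 = 0"
    and \<Phi>0: "fps_nth \<Phi> 0 = 0" and eq: "comp_shift \<Phi> (- 1) = comp_shift \<Phi> b + b1"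
    and conv: "fps_conv_radius (borel_transform \<Phi>) > 0"
  shows "volterra_germ (left_kernel b) 0 (borel_transform \<Phi>)"
proof -
  define \<phi> where "\<phi> = borel_transform \<Phi>"
  note conv' = conv[folded \<phi>_def]
  define \<Psi> where "\<Psi> = comp_shift \<Phi> (- 1)"
  define \<psi> where "\<psi> = borel_transform \<Psi>"
  define h where "h = eval_fps (borel_transform b1)"
  define g where "g z = h z + contour_integral (linepath 0 z) (\<lambda>w. shift_kernel b z (z - w) * (w * h
      w))" for z
  have \<psi>: "\<psi> = fps_exp 1 * \<phi>"
    unfolding \<psi>_def \<Psi>_def \<phi>_def by (rule borel_comp_shift_minus_one[OF \<Phi>0])
  have \<psi>_conv: "fps_conv_radius \<psi> > 0"
    unfolding \<psi> by (rule less_le_trans[OF _ fps_conv_radius_mult]) (use conv' in simp)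
  have \<Psi>0: "fps_nth \<Psi> 0 = 0" by (simp add: \<Psi>_def fps_nth_comp_shift \<Phi>0)
  have b1_conv: "fps_conv_radius (borel_transform b1) > 0" by (simp add: exp_type_borel(1)[OF
      b1(1)])
  have "lagrange_inverse b \<Psi> - lagrange_inverse b b1 = lagrange_inverse b (comp_shift \<Phi> b)"
    unfolding lagrange_inverse_diff[symmetric] by (simp add: \<Psi>_def eq)
  hence L\<Psi>: "lagrange_inverse b \<Psi> = \<Phi> + lagrange_inverse b b1"
    unfolding lagrange_inverse_comp_shift by (simp add: algebra_simps)
  have "(\<lambda>z. eval_fps \<psi> z + contour_integral (linepath 0 z) (\<lambda>w. shift_kernel b z (z - w) * (w *
      eval_fps \<psi> w)))
           has_fps_expansion borel_transform (lagrange_inverse b \<Psi>)"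
    by (rule borel_lagrange_inverse_expansion[OF b \<Psi>0 \<psi>_def \<psi>_conv])
  moreover have "(\<lambda>z. eval_fps \<phi> z + g z) has_fps_expansion borel_transform (lagrange_inverse b \<Psi>)"
    unfolding L\<Psi> borel_transform_add g_def h_def \<phi>_def[symmetric]
    by (intro has_fps_expansion_add[of "eval_fps \<phi>"] eval_fps_has_fps_expansion conv'
          borel_lagrange_inverse_expansion[OF b b1(2) refl b1_conv])
  ultimately have ev: "\<forall>\<^sub>F z in nhds 0. eval_fps \<psi> z + contour_integral (linepath 0 z) (\<lambda>w.
      shift_kernel b z (z - w) * (w * eval_fps \<psi> w)) = eval_fps \<phi> z + g z"
    by (rule has_fps_expansion_unique_eventually)
  obtain r0 where r0: "0 < ereal r0" "ereal r0 < fps_conv_radius \<phi>"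
    using ereal_dense2[OF conv'] by (auto simp: zero_ereal_def)
  have \<psi>_eval: "eval_fps \<psi> w = exp w * eval_fps \<phi> w" if "norm w \<le> r0" for w
  proof -
    have "ereal (norm w) < fps_conv_radius \<phi>"
      using that r0(2) by (metis ereal_less_eq(3) le_less_trans)
    thus ?thesis unfolding \<psi> by (subst eval_fps_mult) auto
  qed
  have \<phi>_cont: "continuous_on (cball 0 r0) (eval_fps \<phi>)"
  proof (rule continuous_on_subset[OF continuous_on_eval_fps], rule subsetI)
    fix w :: complex assume "w \<in> cball 0 r0"
    hence "ereal (dist 0 w) \<le> ereal r0" by simp
    thus "w \<in> eball 0 (fps_conv_radius \<phi>)" using le_less_trans[OF _ r0(2)] by simp
  qed
  have "\<forall>\<^sub>F z in nhds 0. z \<in> ball (0::complex) r0"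
    using r0(1) by (intro eventually_nhds_in_open) auto
  with ev have "\<forall>\<^sub>F z in nhds 0. volterra_eq (left_kernel b) g 0 (eval_fps \<phi>) z"
  proof eventually_elim
    case (elim z)
    have seg: "norm w \<le> r0" if "w \<in> closed_segment 0 z" for w
      using segment_bound[OF that] elim(2) by simp
    have "contour_integral (linepath 0 z) (\<lambda>w. shift_kernel b z (z - w) * (w * eval_fps \<psi> w)) =
          contour_integral (linepath 0 z) (\<lambda>w. - (left_kernel b z w * (w * eval_fps \<phi> w)))"
      by (intro contour_integral_eq) (use seg \<psi>_eval in \<open>simp add: left_kernel_def mult_ac\<close>)
    also have "\<dots> = - contour_integral (linepath 0 z) (\<lambda>w. left_kernel b z w * (w * eval_fps \<phi> w))"
      by (rule contour_integral_neg)
    finally have "exp z * eval_fps \<phi> z - contour_integral (linepath 0 z) (\<lambda>w. left_kernel b z w * (w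
        * eval_fps \<phi> w)) = eval_fps \<phi> z + g z"
      using elim(1) \<psi>_eval[OF seg[of z]] by simp
    thus ?case by (simp add: volterra_eq_def algebra_simps)
  qed
  moreover have "exp_type g"
    unfolding g_def h_def by (rule exp_type_lagrange_borel[OF b(1) exp_type_borel(2)[OF b1(1)]])
  ultimately show ?thesis
    unfolding volterra_germ_def \<phi>_def[symmetric] using conv' by auto
qed

text \<open>Instead of a recursion for the coefficients, the Volterra equation is solved on the disc
  of radius 2 \<pi>, the largest centred at 0 without a further zero of \<open>exp z - 1\<close>.
  The Taylor series of the solution is taken as Borel transform, so its radius of convergence comes
  for free, and translating the equation back gives the formal one.\<close>

lemma formal_solution_exists:
  assumes b: "fps_conv_radius b > 0" "fps_nth b 0 = 0"
    and b1: "fps_conv_radius b1 > 0" "fps_nth b1 0 = 0" "fps_nth b1 1 = 0"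
  obtains \<Phi> where "fps_nth \<Phi> 0 = 0" "comp_shift \<Phi> (- 1) = comp_shift \<Phi> b + b1"
    "fps_conv_radius (borel_transform \<Phi>) \<ge> ereal (2 * pi)"
proof -
  define g where "g = eval_fps (borel_transform b1)"
  have star: "punctured_star 0 (ball 0 (2 * pi))"
    unfolding punctured_star_def
  proof (intro conjI ballI impI)
    show "closed_segment 0 z \<subseteq> ball 0 (2 * pi)" if "z \<in> ball 0 (2 * pi)" for z :: complex
      using that by (intro closed_segment_subset convex_ball) auto
    show "z = 0" if "z \<in> ball 0 (2 * pi)" "exp z = 1" for z :: complex
      using exp_eq_1_in_ball_2pi[OF that(2)] that(1) by simp
  qed auto
  have g_hol: "g holomorphic_on UNIV"
    unfolding g_def by (rule exp_type_holomorphic[OF exp_type_borel(2)[OF b1(1)]])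
  have g0: "g 0 = 0" using b1(3) by (simp add: g_def eval_fps_at_0 borel_transform_def)
  obtain f where f: "f holomorphic_on ball 0 (2 * pi)" "\<And>z. z \<in> ball 0 (2 * pi) \<Longrightarrow> volterra_eq
      (right_kernel b) g 0 f z"
    using volterra_solution_exists[OF entire_right_kernel[OF b(1)] star g_hol g0] by metis
  define \<phi> where "\<phi> = fps_expansion f 0"
  define \<Phi> where "\<Phi> = Abs_fps (\<lambda>n. if n = 0 then 0 else fact (n - 1) * fps_nth \<phi> (n - 1))"
  have \<Phi>: "fps_nth \<Phi> 0 = 0" "borel_transform \<Phi> = \<phi>"
    by (simp_all add: \<Phi>_def borel_transform_def fps_eq_iff)
  have f_hol: "f holomorphic_on eball 0 (ereal (2 * pi))" using f(1) by simp
  have conv: "fps_conv_radius \<phi> \<ge> ereal (2 * pi)"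
    unfolding \<phi>_def by (rule conv_radius_fps_expansion[OF f_hol])
  hence conv0: "fps_conv_radius \<phi> > 0"
    by (rule less_le_trans[rotated]) simp
  have "\<forall>\<^sub>F z in nhds 0. eval_fps \<phi> z = f z"
    using eventually_eval_fps_expansion(2)[OF f(1) open_ball, of 0] by (simp add: \<phi>_def)
  from eventually_volterra_eq_cong[OF this]
  have "\<forall>\<^sub>F z in nhds 0. volterra_eq (right_kernel b) g 0 (eval_fps \<phi>) z"
  proof (rule iffD2)
    have "\<forall>\<^sub>F z in nhds 0. z \<in> ball 0 (2 * pi)" by (intro eventually_nhds_in_open) auto
    thus "\<forall>\<^sub>F z in nhds 0. volterra_eq (right_kernel b) g 0 f z"
      by eventually_elim (rule f(2))
  qed
  hence ev: "\<forall>\<^sub>F z in nhds 0. (eval_fps \<phi> z + contour_integral (linepath 0 z) (\<lambda>w. right_kernel b z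
      w * (w * eval_fps \<phi> w))) + g z = exp z * eval_fps \<phi> z"
    by eventually_elim (simp add: volterra_eq_def algebra_simps)
  have "(\<lambda>z. (eval_fps \<phi> z + contour_integral (linepath 0 z) (\<lambda>w. right_kernel b z w * (w * eval_fps
      \<phi> w))) + g z)
           has_fps_expansion borel_transform (comp_shift \<Phi> b) + borel_transform b1"
    unfolding g_def
    by (intro has_fps_expansion_add borel_comp_shift_expansion b \<Phi>(1) \<Phi>(2)[symmetric] conv0
        eval_fps_has_fps_expansion)
       (simp add: exp_type_borel[OF b1(1)])
  hence "(\<lambda>z. exp z * eval_fps \<phi> z) has_fps_expansion borel_transform (comp_shift \<Phi> b) +
      borel_transform b1"
    using has_fps_expansion_cong[OF ev refl] by blast
  from fps_expansion_eqI[OF this] fps_expansion_eqI[OF exp_mult_expansion[OF conv0]]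
  have "fps_exp 1 * \<phi> = borel_transform (comp_shift \<Phi> b) + borel_transform b1" by simp
  hence "borel_transform (comp_shift \<Phi> (- 1)) = borel_transform (comp_shift \<Phi> b + b1)"
    unfolding borel_transform_add borel_comp_shift_minus_one[OF \<Phi>(1)] \<Phi>(2) .
  \<comment> \<open>The Borel transform forgets the constant coefficient, which is 0 on both
    sides.\<close>
  hence "comp_shift \<Phi> (- 1) = comp_shift \<Phi> b + b1"
    by (rule borel_transform_inj) (simp add: fps_nth_comp_shift \<Phi>(1) b1(2))
  with \<Phi> conv show thesis using that by blast
qed

text \<open>Because \<open>Re p = 0\<close>, the two open half-planes together with a small disc
  around \<open>p\<close> form a set star-shaped about \<open>p\<close>. The germ extends to it
  once, and by the identity theorem the same extension satisfies both equations: the right one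
  controls the directions in \<open>D1\<close>, the left one those in \<open>D2\<close>.\<close>

lemma volterra_germ_growth:
  assumes b: "fps_conv_radius b > 0" and p: "Re p = 0" "exp p = 1 \<Longrightarrow> p = 0"
    and right: "volterra_germ (right_kernel b) p h" and left: "volterra_germ (left_kernel b) p h"
    and \<delta>: "\<delta> \<in> {0<..<pi / 2}"
  shows "\<exists>C0 R0. C0 > 0 \<and> R0 > 0 \<and>
           (\<forall>t\<ge>0. \<forall>\<theta> \<in> {- \<delta>..\<delta>} \<union> {pi - \<delta>..pi + \<delta>}.
              \<exists>k. analytic_cont (linepath p (p + of_real t * exp (\<i> * of_real \<theta>))) h k \<and>
                  norm (eval_fps k 0) \<le> C0 * exp (R0 * t))"
proof -
  obtain r where r: "r > 0" "\<And>z. z \<in> ball p r \<Longrightarrow> exp z = 1 \<Longrightarrow> z = 0 \<and> p = 0"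
  proof (cases "p = 0")
    case True
    show ?thesis
    proof (rule that[of "2 * pi"])
      fix z assume "z \<in> ball p (2 * pi)" "exp z = 1"
      thus "z = 0 \<and> p = 0" using exp_eq_1_in_ball_2pi[of z] True by simp
    qed simp
  next
    case False
    have "open {z::complex. exp z \<noteq> 1}"
      by (intro open_Collect_neq continuous_intros)
    moreover have "p \<in> {z. exp z \<noteq> 1}" using p(2) False by auto
    ultimately obtain r where "r > 0" "ball p r \<subseteq> {z. exp z \<noteq> 1}" by (rule openE)
    thus ?thesis using that[of r] by blast
  qed
  define S where "S = {z. Re z \<noteq> 0} \<union> ball p r"
  have star: "punctured_star p S"
    unfolding punctured_star_def
  proof (intro conjI ballI impI)
    show "open S" unfolding S_def by (intro open_Un open_ball open_Collect_neq continuous_intros)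
    show "p \<in> S" using r(1) by (simp add: S_def)
    show "closed_segment p z \<subseteq> S" if z: "z \<in> S" for z
    proof (cases "z \<in> ball p r")
      case True
      have "closed_segment p z \<subseteq> ball p r"
        using True r(1) by (intro closed_segment_subset convex_ball) auto
      thus ?thesis by (auto simp: S_def)
    next
      case False
      hence "Re z \<noteq> 0" using z by (simp add: S_def)
      show ?thesis
      proof
        fix w assume "w \<in> closed_segment p z"
        then obtain u where u: "w = (1 - u) *\<^sub>R p + u *\<^sub>R z" by (auto simp: closed_segment_def)
        show "w \<in> S"
        proof (cases "u = 0")
          case True
          thus ?thesis using r(1) by (simp add: u S_def)
        next
          case False
          hence "Re w \<noteq> 0" using \<open>Re z \<noteq> 0\<close> by (simp add: u p(1))
          thus ?thesis by (simp add: S_def)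
        qed
      qed
    qed
    fix z assume z: "z \<in> S" "exp z = 1"
    hence "Re z = 0" by (simp add: exp_eq_1)
    hence "z \<in> ball p r" using z(1) by (simp add: S_def)
    from r(2)[OF this z(2)] show "z = 0" "p = 0" by simp_all
  qed
  note S = punctured_starD(1-3)[OF star]
  obtain \<phi> g where \<phi>: "\<phi> holomorphic_on S" "exp_type g"
    "\<And>z. z \<in> S \<Longrightarrow> volterra_eq (right_kernel b) g p \<phi> z" "fps_expansion \<phi> p = h"
    using volterra_germ_extend[OF entire_right_kernel[OF b] star right] by metis
  obtain g' where g': "exp_type g'" "\<forall>\<^sub>F z in nhds p. volterra_eq (left_kernel b) g' p \<phi> z"
    using left volterra_germ_fps_expansion_iff[OF \<phi>(1) S(1,2)] unfolding \<phi>(4) by metis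
  have eq': "volterra_eq (left_kernel b) g' p \<phi> z" if "z \<in> S" for z
    by (rule volterra_eq_identity[OF entire_left_kernel[OF b] S \<phi>(1) exp_type_holomorphic[OF g'(1)]
        g'(2) that])
  define \<mu> where "\<mu> = cos \<delta>"
  have \<mu>: "\<mu> > 0" unfolding \<mu>_def using \<delta> by (intro cos_gt_zero) auto
  have cball: "cball p (r / 2) \<subseteq> S" using r(1) by (auto simp: S_def)
  have \<phi>_cont: "continuous_on S \<phi>" by (rule holomorphic_on_imp_continuous_on[OF \<phi>(1)])
  have ray: "p + of_real t * d \<in> S" if "Re d \<noteq> 0" "0 \<le> t" for d t
    using that S(2) by (cases "t = 0") (auto simp: S_def p(1))
  define D1 where "D1 = (\<lambda>\<theta>. exp (\<i> * of_real \<theta>)) ` {- \<delta>..\<delta>}"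
  define D2 where "D2 = (\<lambda>\<theta>. exp (\<i> * of_real \<theta>)) ` {pi - \<delta>..pi + \<delta>}"
  have cos_ge: "\<mu> \<le> cos \<theta>" if "\<bar>\<theta>\<bar> \<le> \<delta>" for \<theta>
  proof -
    have "cos \<delta> \<le> cos \<bar>\<theta>\<bar>" using that \<delta> by (intro cos_monotone_0_pi_le) auto
    thus ?thesis by (simp add: \<mu>_def)
  qed
  have D1: "norm d = 1 \<and> Re d \<ge> \<mu>" if "d \<in> D1" for d
    using that cos_ge by (auto simp: D1_def Re_exp)
  have D2: "norm d = 1 \<and> Re d \<le> - \<mu>" if "d \<in> D2" for d
  proof -
    from that obtain \<theta> where \<theta>: "d = exp (\<i> * of_real \<theta>)" "\<bar>\<theta> - pi\<bar> \<le> \<delta>" by (auto simp: D2_def)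
    have "cos \<theta> = - cos (\<theta> - pi)" by (simp add: cos_diff)
    thus ?thesis using cos_ge[OF \<theta>(2)] by (simp add: \<theta>(1) Re_exp)
  qed
  have r2: "r / 2 > 0" using r(1) by simp
  have "\<exists>C0 R0. C0 > 0 \<and> R0 > 0 \<and> (\<forall>d\<in>D1. \<forall>t\<ge>0. norm (\<phi> (p + of_real t * d)) \<le> C0 * exp (R0 * t))"
  proof (rule volterra_growth_right[OF entire_right_kernel[OF b] \<phi>(2) r2 \<mu> cball \<phi>_cont p(1) _ D1 _
      right_kernel_bound[OF b]])
    show ray1: "p + of_real t * d \<in> S" if "d \<in> D1" "0 \<le> t" for d t
      using ray[of d t] D1[OF that(1)] \<mu> that(2) by auto
    show "volterra_eq (right_kernel b) g p \<phi> (p + of_real t * d)" if "d \<in> D1" "0 \<le> t" for d t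
      by (rule \<phi>(3)[OF ray1[OF that]])
  qed
  then obtain C1 R1 where CR1: "C1 > 0" "R1 > 0" "\<And>d t. d \<in> D1 \<Longrightarrow> t \<ge> 0 \<Longrightarrow> norm (\<phi> (p + of_real t *
      d)) \<le> C1 * exp (R1 * t)"
    by metis
  have "\<exists>C0 R0. C0 > 0 \<and> R0 > 0 \<and> (\<forall>d\<in>D2. \<forall>t\<ge>0. norm (\<phi> (p + of_real t * d)) \<le> C0 * exp (R0 * t))"
  proof (rule volterra_growth_left[OF entire_left_kernel[OF b] g'(1) r2 \<mu> cball \<phi>_cont p(1) _ D2 _
      left_kernel_bound[OF b]])
    show ray2: "p + of_real t * d \<in> S" if "d \<in> D2" "0 \<le> t" for d t
      using ray[of d t] D2[OF that(1)] \<mu> that(2) by auto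
    show "volterra_eq (left_kernel b) g' p \<phi> (p + of_real t * d)" if "d \<in> D2" "0 \<le> t" for d t
      by (rule eq'[OF ray2[OF that]])
  qed
  then obtain C2 R2 where CR2: "C2 > 0" "R2 > 0" "\<And>d t. d \<in> D2 \<Longrightarrow> t \<ge> 0 \<Longrightarrow> norm (\<phi> (p + of_real t *
      d)) \<le> C2 * exp (R2 * t)"
    by metis
  have main: "\<exists>k. analytic_cont (linepath p (p + of_real t * d)) h k \<and> norm (eval_fps k 0) \<le> (C1 +
      C2) * exp ((R1 + R2) * t)"
    if t: "t \<ge> 0" and d: "d \<in> D1 \<union> D2" for t d
  proof (intro exI conjI)
    define q where "q = p + of_real t * d"
    have q: "q \<in> S"
      unfolding q_def using ray[OF _ t, of d] D1[of d] D2[of d] \<mu> d by auto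
    have lp: "linepath p q s \<in> S" if "s \<in> {0..1}" for s
      using S(3)[OF q] linepath_in_path[OF that, of p q] by blast
    have "analytic_cont_on 0 1 (linepath p q) (\<lambda>s. fps_expansion \<phi> (linepath p q s))"
      by (rule analytic_cont_on_fps_expansion[OF \<phi>(1) S(1) continuous_on_linepath lp])
    hence "analytic_cont (linepath p q) h (fps_expansion \<phi> q)"
      unfolding analytic_cont_iff
      by (intro exI[of _ "\<lambda>s. fps_expansion \<phi> (linepath p q s)"]) (simp add: linepath_def \<phi>(4))
    thus "analytic_cont (linepath p (p + of_real t * d)) h (fps_expansion \<phi> q)"
      by (simp add: q_def)
    have "eval_fps (fps_expansion \<phi> q) 0 = \<phi> q"
      using eventually_nhds_x_imp_x[OF eventually_eval_fps_expansion(2)[OF \<phi>(1) S(1) q]] by simp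
    also have "norm (\<phi> q) \<le> (C1 + C2) * exp ((R1 + R2) * t)"
    proof (cases "d \<in> D1")
      case True
      have "norm (\<phi> q) \<le> C1 * exp (R1 * t)" unfolding q_def by (rule CR1(3)[OF True t])
      also have "\<dots> \<le> (C1 + C2) * exp ((R1 + R2) * t)"
        using CR1 CR2 t by (intro mult_mono) (auto intro!: mult_right_mono)
      finally show ?thesis .
    next
      case False
      hence "d \<in> D2" using d by simp
      have "norm (\<phi> q) \<le> C2 * exp (R2 * t)" unfolding q_def by (rule CR2(3)[OF \<open>d \<in> D2\<close> t])
      also have "\<dots> \<le> (C1 + C2) * exp ((R1 + R2) * t)"
        using CR1 CR2 t by (intro mult_mono) (auto intro!: mult_right_mono)
      finally show ?thesis .
    qed
    finally show "norm (eval_fps (fps_expansion \<phi> q) 0) \<le> (C1 + C2) * exp ((R1 + R2) * t)" .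
  qed
  show ?thesis
  proof (rule exI[of _ "C1 + C2"], rule exI[of _ "R1 + R2"], intro conjI allI impI ballI)
    fix t \<theta> :: real assume "t \<ge> 0" "\<theta> \<in> {- \<delta>..\<delta>} \<union> {pi - \<delta>..pi + \<delta>}"
    thus "\<exists>k. analytic_cont (linepath p (p + of_real t * exp (\<i> * of_real \<theta>))) h k \<and>
                  norm (eval_fps k 0) \<le> (C1 + C2) * exp ((R1 + R2) * t)"
      by (intro main) (auto simp: D1_def D2_def)
  qed (use CR1 CR2 in auto)
qed

theorem theorem1:
  fixes F :: "complex fps" and c :: complex
  assumes "fps_conv_radius F > 0"
    and "fps_nth F 0 = 0" and "fps_nth F 1 = 1" and "fps_nth F 2 = c" and "c \<noteq> 0"
  shows "(\<exists>!\<phi>. is_formal_solution F c \<phi>) \<and>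
    (\<forall>\<phi>. is_formal_solution F c \<phi> \<longrightarrow>
       resurgent (borel_transform \<phi>) \<and>
       (\<forall>\<gamma> h \<delta>0.
          (admissible_path \<gamma> \<and> Re (pathfinish \<gamma>) = 0 \<or> \<gamma> = (\<lambda>_. 0)) \<longrightarrow>
          analytic_cont \<gamma> (borel_transform \<phi>) h \<longrightarrow>
          \<delta>0 \<in> {0<..<pi / 2} \<longrightarrow>
          (\<exists>C0 R0. C0 > 0 \<and> R0 > 0 \<and>
             (\<forall>t\<ge>0. \<forall>\<theta> \<in> {- \<delta>0..\<delta>0} \<union> {pi - \<delta>0..pi + \<delta>0}.
                \<exists>k. analytic_cont
                      (linepath (pathfinish \<gamma>) (pathfinish \<gamma> + of_real t * exp (\<i> * of_real \<theta>))) h k \<and>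
                    norm (eval_fps k 0) \<le> C0 * exp (R0 * t)))))"
proof -
  define b where "b = b_series F c"
  define b1 where "b1 = b1_series F c"
  note b = b_series_props(1,2)[OF assms, folded b_def]
  note b1 = b1_series_props[OF assms, folded b1_def]
  have sol: "is_formal_solution F c \<phi> \<longleftrightarrow> fps_nth \<phi> 0 = 0 \<and> comp_shift \<phi> (- 1) = comp_shift \<phi> b + b1" for \<phi>
    by (simp add: is_formal_solution_def b_def b1_def)
  obtain \<Phi> where \<Phi>: "fps_nth \<Phi> 0 = 0" "comp_shift \<Phi> (- 1) = comp_shift \<Phi> b + b1"
    "fps_conv_radius (borel_transform \<Phi>) \<ge> ereal (2 * pi)"
    using formal_solution_exists[OF b b1] by metis
  have unique: "\<phi> = \<Phi>" if "is_formal_solution F c \<phi>" for \<phi>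
  proof -
    have "comp_shift (\<phi> - \<Phi>) (- 1) = comp_shift (\<phi> - \<Phi>) b"
      using that \<Phi>(2) by (simp add: sol comp_shift_diff)
    hence "\<phi> - \<Phi> = 0"
      using that \<Phi>(1) b(2) by (intro comp_shift_homogeneous_unique[of _ b]) (simp_all add: sol)
    thus ?thesis by simp
  qed
  have conv: "fps_conv_radius (borel_transform \<Phi>) > 0"
    by (rule less_le_trans[OF _ \<Phi>(3)]) simp
  have right: "volterra_germ (right_kernel b) 0 (borel_transform \<Phi>)"
    by (rule volterra_germ_right_of_formal[OF b b1(1) \<Phi>(1,2) conv])
  have left: "volterra_germ (left_kernel b) 0 (borel_transform \<Phi>)"
    by (rule volterra_germ_left_of_formal[OF b b1(1,2) \<Phi>(1,2) conv])
  show ?thesis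
  proof (intro conjI allI impI)
    show "\<exists>!\<phi>. is_formal_solution F c \<phi>"
    proof (rule ex1I)
      show "is_formal_solution F c \<Phi>" using \<Phi>(1,2) by (simp add: sol)
    qed (rule unique)
    fix \<phi> assume "is_formal_solution F c \<phi>"
    hence \<phi>: "\<phi> = \<Phi>" by (rule unique)
    show "resurgent (borel_transform \<phi>)"
      unfolding resurgent_def \<phi>
      using \<Phi>(3) analytic_cont_exists[OF entire_right_kernel[OF b(1)] _ right] by blast
    fix \<gamma> h \<delta>0
    assume \<gamma>: "admissible_path \<gamma> \<and> Re (pathfinish \<gamma>) = 0 \<or> \<gamma> = (\<lambda>_. 0)"
      and h: "analytic_cont \<gamma> (borel_transform \<phi>) h" and \<delta>0: "\<delta>0 \<in> {0<..<pi / 2}"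
    have start: "pathstart \<gamma> = 0"
      using \<gamma> by (auto simp: admissible_path_def pathstart_def)
    have finish: "Re (pathfinish \<gamma>) = 0" using \<gamma> by (auto simp: pathfinish_def)
    \<comment> \<open>An admissible path ends off \<open>two_pi_i_Z\<close>; only the constant path
      ends at a zero of \<open>exp z - 1\<close>, and that zero is 0.\<close>
    have avoid: "pathfinish \<gamma> = 0" if "exp (pathfinish \<gamma>) = 1"
      using \<gamma>
    proof
      assume "admissible_path \<gamma> \<and> Re (pathfinish \<gamma>) = 0"
      hence "pathfinish \<gamma> \<notin> two_pi_i_Z" by (simp add: admissible_path_def pathfinish_def)
      thus ?thesis using that by (simp add: two_pi_i_Z_eq)
    qed (simp add: pathfinish_def)
    have germs: "volterra_germ (right_kernel b) (pathfinish \<gamma>) h" "volterra_germ (left_kernel b) (pathfinish \<gamma>) h"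
      using volterra_germ_analytic_cont[OF entire_right_kernel[OF b(1)] h] volterra_germ_analytic_cont[OF entire_left_kernel[OF b(1)] h]
        right left by (simp_all add: start \<phi>)
    show "\<exists>C0 R0. C0 > 0 \<and> R0 > 0 \<and>
             (\<forall>t\<ge>0. \<forall>\<theta> \<in> {- \<delta>0..\<delta>0} \<union> {pi - \<delta>0..pi + \<delta>0}.
                \<exists>k. analytic_cont
                      (linepath (pathfinish \<gamma>) (pathfinish \<gamma> + of_real t * exp (\<i> * of_real \<theta>))) h k \<and>
                    norm (eval_fps k 0) \<le> C0 * exp (R0 * t))"
      by (rule volterra_germ_growth[OF b(1) finish avoid germs \<delta>0])
  qed
qed

end
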